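(* Let $\varphi\in L^2(G)$, $\varphi\ne0$, be a compactly supported refinable function with mask $m_0$. Then $\varphi$ generates compactly supported tight wavelet frames if and only if $m_0$ is a Walsh polynomial satisfying $m_0(\theta)=1$ and $$\sum_{l=0}^{p-1}|m_0(\omega\oplus\delta_l)|^2\le1,\qquad \omega\in G.$$
   Context: Fix an integer $p\ge2$. The Vilenkin group $G=G_p$ is the set of sequences $x=(x_j)_{j\in\mathbb Z}$ with $x_j\in\{0,\dots,p-1\}$ and $x_j\neq0$ for at most finitely many negative $j$; the operation $\oplus$ is coordinatewise addition modulo $p$, $\ominus$ is its inverse operation, and $\theta$ is the zero sequence. The topology is given by the neighborhoods of zero $U_l=\{x\in G: x_j=0\text{ for }j\le l\}$, $l\in\mathbb Z$; $U=U_0$; $\mu$ is the Haar measure with $\mu(U)=1$. Put $\lambda(x)=\sum_jx_jp^{-j}$ and $H=\{x\in G:x_j=0\text{ for }j>0\}$; for $\alpha\in\mathbb Z_+=\{0,1,2,\dots\}$, $h_{[\alpha]}$ is the unique element of $H$ with $\lambda(h_{[\alpha]})=\alpha$. $A$ is the automorphism $(Ax)_j=x_{j+1}$. $\chi(x,\omega)=\exp\big(\frac{2\pi i}{p}\sum_{j\in\mathbb Z}x_j\omega_{1-j}\big)$; generalized Walsh functions: $W_\alpha(x)=\chi(x,h_{[\alpha]})$; Walsh polynomials are finite linear combinations of the $W_\alpha$. The Fourier transform is $\widehat f(\omega)=\int_Gf(x)\overline{\chi(x,\omega)}\,d\mu(x)$, extended to $L^2(G)$ in the standard way. For $l\in\{0,\dots,p-1\}$,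 $\delta_l=A^{-1}h_{[l]}$ (coordinate $l$ at index $1$, all other coordinates $0$). A compactly supported $\varphi\in L^2(G)$ is refinable with mask $m_0$ if for some $n\in\mathbb N$ and some complex numbers $a_\alpha$, $\varphi(x)=p\sum_{\alpha=0}^{p^n-1}a_\alpha\varphi(Ax\ominus h_{[\alpha]})$ and $m_0(\omega)=\sum_{\alpha=0}^{p^n-1}a_\alpha\overline{W_\alpha(\omega)}$; equivalently $\widehat\varphi(\omega)=m_0(A^{-1}\omega)\widehat\varphi(A^{-1}\omega)$. Walsh polynomials $m_1,\dots,m_r$ ($r\ge p-1$) are wavelet masks for $m_0$ if for all $\omega\in G$ the $p\times(r+1)$ matrix $M(\omega)=(m_\nu(\omega\oplus\delta_s))_{s=0,\dots,p-1;\ \nu=0,\dots,r}$ satisfies $M(\omega)M^*(\omega)=I_p$. The corresponding wavelet functions are given by $\widehat{\psi^{(\nu)}}(\omega)=m_\nu(A^{-1}\omega)\widehat\varphi(A^{-1}\omega)$, $\nu=1,\dots,r$, and the wavelet system generated by $\varphi$ is $\psi^{(\nu)}_{j,k}(x)=p^{j/2}\psi^{(\nu)}(A^jx\ominus h_{[k]})$, $\nu=1,\dots,r$, $j\in\mathbb Z$, $k\in\mathbb Z_+$. The system is a tight frame in $L^2(G)$ if there is a constant $C>0$ with $\sum_{j\in\mathbb Z}\sum_{k\in\mathbb Z_+}\sum_{\nu=1}^r|\langle f,\psi^{(\nu)}_{j,k}\rangle|^2=C\|f\|_2^2$ for all $f\in L^2(G)$; it is compactly supported if every $\psi^{(\nu)}$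 is compactly supported. "$\varphi$ generates compactly supported tight wavelet frames" means that there exist $r\ge p-1$ and wavelet masks $m_1,\dots,m_r$ for $m_0$ such that the corresponding wavelet system is a compactly supported tight frame in $L^2(G)$. *)

theory Defs
  imports
    "HOL-Probability.Probability"
    "Jordan_Normal_Form.Schur_Decomposition"
begin

definition vil :: "nat \<Rightarrow> (int \<Rightarrow> nat) set" where
  "vil p = {x. (\<forall>j. x j < p) \<and> finite {j. j < 0 \<and> x j \<noteq> 0}}"

definition vzero :: "int \<Rightarrow> nat" where
  "vzero = (\<lambda>j. 0)"

definition vadd :: "nat \<Rightarrow> (int \<Rightarrow> nat) \<Rightarrow> (int \<Rightarrow> nat) \<Rightarrow> (int \<Rightarrow> nat)" where
  "vadd p x y = (\<lambda>j. (x j + y j) mod p)"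

definition vneg :: "nat \<Rightarrow> (int \<Rightarrow> nat) \<Rightarrow> (int \<Rightarrow> nat)" where
  "vneg p x = (\<lambda>j. (p - x j) mod p)"

definition vsub :: "nat \<Rightarrow> (int \<Rightarrow> nat) \<Rightarrow> (int \<Rightarrow> nat) \<Rightarrow> (int \<Rightarrow> nat)" where
  "vsub p x y = vadd p x (vneg p y)"

definition vU :: "nat \<Rightarrow> int \<Rightarrow> (int \<Rightarrow> nat) set" where
  "vU p l = {x \<in> vil p. \<forall>j\<le>l. x j = 0}"

definition vtop :: "nat \<Rightarrow> (int \<Rightarrow> nat) topology" where
  "vtop p = topology_generated_by {vadd p x ` vU p l | x l. x \<in> vil p}"

text \<open>On the second countable group \<open>vil p\<close> a translation invariant Borel measure that is finite
  on \<open>U\<close> is automatically finite on compact sets and regular, so the following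
  predicate singles out the normalised Haar measure; see \<open>ex1_haar\<close>.\<close>

definition is_haar :: "nat \<Rightarrow> (int \<Rightarrow> nat) measure \<Rightarrow> bool" where
  "is_haar p \<mu> \<longleftrightarrow>
     sets \<mu> = sigma_sets (vil p) {S. openin (vtop p) S} \<and>
     (\<forall>x\<in>vil p. \<forall>S\<in>sets \<mu>. emeasure \<mu> (vadd p x ` S) = emeasure \<mu> S) \<and>
     emeasure \<mu> (vU p 0) = 1"

definition haar :: "nat \<Rightarrow> (int \<Rightarrow> nat) measure" where
  "haar p = (THE \<mu>. is_haar p \<mu>)"

text \<open>\<open>dil j\<close> is the \<open>j\<close>-th power of the automorphism \<open>A = dil 1\<close>.\<close>

definition dil :: "int \<Rightarrow> (int \<Rightarrow> nat) \<Rightarrow> (int \<Rightarrow> nat)" where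
  "dil j x = (\<lambda>i. x (i + j))"

definition vlam :: "nat \<Rightarrow> (int \<Rightarrow> nat) \<Rightarrow> real" where
  "vlam p x = (\<Sum>\<^sub>\<infinity>j. real (x j) * real p powi (- j))"

definition vH :: "nat \<Rightarrow> (int \<Rightarrow> nat) set" where
  "vH p = {x \<in> vil p. \<forall>j>0. x j = 0}"

definition vh :: "nat \<Rightarrow> nat \<Rightarrow> (int \<Rightarrow> nat)" where
  "vh p \<alpha> = (THE h. h \<in> vH p \<and> vlam p h = real \<alpha>)"

definition vdelta :: "nat \<Rightarrow> nat \<Rightarrow> (int \<Rightarrow> nat)" where
  "vdelta p l = dil (-1) (vh p l)"

text \<open>For \<open>x\<close> and \<open>\<omega>\<close> in the group only finitely many terms of the sum do not vanish.\<close>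

definition vchi :: "nat \<Rightarrow> (int \<Rightarrow> nat) \<Rightarrow> (int \<Rightarrow> nat) \<Rightarrow> complex" where
  "vchi p x \<omega> = exp (2 * of_real pi * \<i> / of_nat p *
     of_nat (\<Sum>j | x j \<noteq> 0 \<and> \<omega> (1 - j) \<noteq> 0. x j * \<omega> (1 - j)))"

definition walsh :: "nat \<Rightarrow> nat \<Rightarrow> (int \<Rightarrow> nat) \<Rightarrow> complex" where
  "walsh p \<alpha> x = vchi p x (vh p \<alpha>)"

definition walsh_polynomial :: "nat \<Rightarrow> ((int \<Rightarrow> nat) \<Rightarrow> complex) \<Rightarrow> bool" where
  "walsh_polynomial p m \<longleftrightarrow>
     (\<exists>S c. finite S \<and> (\<forall>\<omega>\<in>vil p. m \<omega> = (\<Sum>\<alpha>\<in>S. c \<alpha> * walsh p \<alpha> \<omega>)))"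

text \<open>Elements of \<open>L\<^sup>2\<close> are represented by functions, and equality in \<open>L\<^sup>2\<close> by equality almost
  everywhere. Values outside the group are irrelevant.\<close>

definition vL2 :: "nat \<Rightarrow> ((int \<Rightarrow> nat) \<Rightarrow> complex) set" where
  "vL2 p = {f. f \<in> borel_measurable (haar p) \<and> integrable (haar p) (\<lambda>x. (cmod (f x))\<^sup>2)}"

definition vinner :: "nat \<Rightarrow> ((int \<Rightarrow> nat) \<Rightarrow> complex) \<Rightarrow> ((int \<Rightarrow> nat) \<Rightarrow> complex) \<Rightarrow> complex" where
  "vinner p f g = (\<integral>x. f x * cnj (g x) \<partial>haar p)"

definition vnorm :: "nat \<Rightarrow> ((int \<Rightarrow> nat) \<Rightarrow> complex) \<Rightarrow> real" where
  "vnorm p f = sqrt (\<integral>x. (cmod (f x))\<^sup>2 \<partial>haar p)"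

definition compactly_supported :: "nat \<Rightarrow> ((int \<Rightarrow> nat) \<Rightarrow> complex) \<Rightarrow> bool" where
  "compactly_supported p f \<longleftrightarrow>
     (\<exists>K. compactin (vtop p) K \<and> (AE x in haar p. x \<notin> K \<longrightarrow> f x = 0))"

definition fourier_integral :: "nat \<Rightarrow> ((int \<Rightarrow> nat) \<Rightarrow> complex) \<Rightarrow> (int \<Rightarrow> nat) \<Rightarrow> complex" where
  "fourier_integral p f \<omega> = (\<integral>x. f x * cnj (vchi p x \<omega>) \<partial>haar p)"

text \<open>\<open>has_fourier_transform p f g\<close>: the extension by continuity of the Fourier transform from
  \<open>L\<^sup>1 \<inter> L\<^sup>2\<close> to \<open>L\<^sup>2\<close> maps (the class of) \<open>f\<close> to (the class of) \<open>g\<close>.\<close>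

definition has_fourier_transform ::
    "nat \<Rightarrow> ((int \<Rightarrow> nat) \<Rightarrow> complex) \<Rightarrow> ((int \<Rightarrow> nat) \<Rightarrow> complex) \<Rightarrow> bool" where
  "has_fourier_transform p f g \<longleftrightarrow> f \<in> vL2 p \<and> g \<in> vL2 p \<and>
     (\<exists>F :: nat \<Rightarrow> (int \<Rightarrow> nat) \<Rightarrow> complex.
        (\<forall>n. F n \<in> vL2 p \<and> integrable (haar p) (F n) \<and> fourier_integral p (F n) \<in> vL2 p) \<and>
        (\<lambda>n. vnorm p (\<lambda>x. F n x - f x)) \<longlonglongrightarrow> 0 \<and>
        (\<lambda>n. vnorm p (\<lambda>\<omega>. fourier_integral p (F n) \<omega> - g \<omega>)) \<longlonglongrightarrow> 0)"

definition refinable_with_mask ::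
    "nat \<Rightarrow> ((int \<Rightarrow> nat) \<Rightarrow> complex) \<Rightarrow> ((int \<Rightarrow> nat) \<Rightarrow> complex) \<Rightarrow> bool" where
  "refinable_with_mask p \<phi> m0 \<longleftrightarrow>
     (\<exists>n\<ge>1. \<exists>a :: nat \<Rightarrow> complex.
        (AE x in haar p. \<phi> x = of_nat p * (\<Sum>\<alpha><p ^ n. a \<alpha> * \<phi> (vsub p (dil 1 x) (vh p \<alpha>)))) \<and>
        (\<forall>\<omega>\<in>vil p. m0 \<omega> = (\<Sum>\<alpha><p ^ n. a \<alpha> * cnj (walsh p \<alpha> \<omega>))))"

text \<open>A family of masks \<open>m\<close> is indexed by \<open>0, \<dots>, r\<close>, where \<open>m 0\<close> is the refinement mask.\<close>

definition mask_matrix ::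
    "nat \<Rightarrow> nat \<Rightarrow> (nat \<Rightarrow> (int \<Rightarrow> nat) \<Rightarrow> complex) \<Rightarrow> (int \<Rightarrow> nat) \<Rightarrow> complex mat" where
  "mask_matrix p r m \<omega> = mat p (r + 1) (\<lambda>(s, \<nu>). m \<nu> (vadd p \<omega> (vdelta p s)))"

definition wavelet_masks ::
    "nat \<Rightarrow> nat \<Rightarrow> (nat \<Rightarrow> (int \<Rightarrow> nat) \<Rightarrow> complex) \<Rightarrow> bool" where
  "wavelet_masks p r m \<longleftrightarrow>
     r \<ge> p - 1 \<and> (\<forall>\<nu>\<in>{1..r}. walsh_polynomial p (m \<nu>)) \<and>
     (\<forall>\<omega>\<in>vil p. mask_matrix p r m \<omega> * mat_adjoint (mask_matrix p r m \<omega>) = 1\<^sub>m p)"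

text \<open>\<open>\<psi>\<close> is the function whose Fourier transform is
  \<open>m (A\<^sup>-\<^sup>1 \<omega>)\<close> times the Fourier transform of \<open>\<phi>\<close> at \<open>A\<^sup>-\<^sup>1 \<omega>\<close>.\<close>

definition wavelet_function ::
    "nat \<Rightarrow> ((int \<Rightarrow> nat) \<Rightarrow> complex) \<Rightarrow> ((int \<Rightarrow> nat) \<Rightarrow> complex) \<Rightarrow> ((int \<Rightarrow> nat) \<Rightarrow> complex) \<Rightarrow> bool" where
  "wavelet_function p \<phi> m \<psi> \<longleftrightarrow>
     (\<exists>\<Phi> \<Psi>. has_fourier_transform p \<phi> \<Phi> \<and> has_fourier_transform p \<psi> \<Psi> \<and>
        (AE \<omega> in haar p. \<Psi> \<omega> = m (dil (-1) \<omega>) * \<Phi> (dil (-1) \<omega>)))"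

definition wavelet_shift ::
    "nat \<Rightarrow> ((int \<Rightarrow> nat) \<Rightarrow> complex) \<Rightarrow> int \<Rightarrow> nat \<Rightarrow> (int \<Rightarrow> nat) \<Rightarrow> complex" where
  "wavelet_shift p \<psi> j k x =
     of_real (real p powr (real_of_int j / 2)) * \<psi> (vsub p (dil j x) (vh p k))"

definition tight_wavelet_frame ::
    "nat \<Rightarrow> nat \<Rightarrow> (nat \<Rightarrow> (int \<Rightarrow> nat) \<Rightarrow> complex) \<Rightarrow> bool" where
  "tight_wavelet_frame p r \<psi> \<longleftrightarrow>
     (\<exists>C>0. \<forall>f\<in>vL2 p.
        ((\<lambda>(j, k, \<nu>). (cmod (vinner p f (wavelet_shift p (\<psi> \<nu>) j k)))\<^sup>2)
           has_sum (C * (vnorm p f)\<^sup>2)) ((UNIV :: int set) \<times> (UNIV :: nat set) \<times> {1..r}))"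

definition generates_compact_tight_frames ::
    "nat \<Rightarrow> ((int \<Rightarrow> nat) \<Rightarrow> complex) \<Rightarrow> ((int \<Rightarrow> nat) \<Rightarrow> complex) \<Rightarrow> bool" where
  "generates_compact_tight_frames p \<phi> m0 \<longleftrightarrow>
     (\<exists>r m \<psi>. m 0 = m0 \<and> wavelet_masks p r m \<and>
        (\<forall>\<nu>\<in>{1..r}. wavelet_function p \<phi> (m \<nu>) (\<psi> \<nu>)) \<and>
        (\<forall>\<nu>\<in>{1..r}. compactly_supported p (\<psi> \<nu>)) \<and>
        tight_wavelet_frame p r \<psi>)"

text \<open>The definite descriptions above are well defined: \<open>ex1_vh\<close> and \<open>ex1_haar\<close>. The lemmas
  \<open>vh_eq_vdig\<close>, \<open>vdelta_eq\<close> and \<open>openin_vtop_iff\<close> give explicit descriptions.\<close>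

lemma vadd_closed:
  assumes "x \<in> vil p" "y \<in> vil p"
  shows "vadd p x y \<in> vil p"
proof -
  have "p > 0" using assms(1) by (auto simp: vil_def)
  have "finite ({j. j < 0 \<and> x j \<noteq> 0} \<union> {j. j < 0 \<and> y j \<noteq> 0})"
    using assms by (auto simp: vil_def)
  then have "finite {j. j < 0 \<and> (x j + y j) mod p \<noteq> 0}"
    by (rule finite_subset[rotated]) (auto intro!: gr0I)
  with \<open>p > 0\<close> show ?thesis by (simp add: vil_def vadd_def)
qed

lemma vneg_closed:
  assumes "x \<in> vil p"
  shows "vneg p x \<in> vil p"
proof -
  have "p > 0" using assms by (auto simp: vil_def)
  have "finite {j. j < 0 \<and> x j \<noteq> 0}"
    using assms by (auto simp: vil_def)
  then have "finite {j. j < 0 \<and> (p - x j) mod p \<noteq> 0}"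
    by (rule finite_subset[rotated]) (auto intro!: gr0I)
  with \<open>p > 0\<close> show ?thesis by (simp add: vil_def vneg_def)
qed

lemma vadd_vneg_cancel:
  assumes "x \<in> vil p" "y \<in> vil p"
  shows "vadd p x (vadd p (vneg p x) y) = y" "vadd p (vneg p x) (vadd p x y) = y"
proof -
  have "x j < p" "y j < p" for j using assms by (auto simp: vil_def)
  then have le: "x j \<le> p" and y: "y j mod p = y j" for j by (auto simp: less_imp_le)
  have "(x j + ((p - x j) mod p + y j) mod p) mod p = y j" for j
  proof -
    have "(x j + ((p - x j) mod p + y j) mod p) mod p = (x j + (p - x j + y j)) mod p"
      by (metis mod_add_left_eq mod_add_right_eq)
    also have "x j + (p - x j + y j) = p + y j" using le[of j] by simp
    finally show ?thesis by (simp add: y)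
  qed
  moreover have "((p - x j) mod p + (x j + y j) mod p) mod p = y j" for j
  proof -
    have "((p - x j) mod p + (x j + y j) mod p) mod p = (p - x j + (x j + y j)) mod p"
      by (simp add: mod_add_left_eq mod_add_right_eq)
    also have "p - x j + (x j + y j) = p + y j" using le[of j] by simp
    finally show ?thesis by (simp add: y)
  qed
  ultimately show "vadd p x (vadd p (vneg p x) y) = y" "vadd p (vneg p x) (vadd p x y) = y"
    by (simp_all add: vadd_def vneg_def)
qed

definition vcoset :: "nat \<Rightarrow> (int \<Rightarrow> nat) \<Rightarrow> int \<Rightarrow> (int \<Rightarrow> nat) set" where
  "vcoset p x l = {y \<in> vil p. \<forall>j\<le>l. y j = x j}"

lemma vadd_cong_iff:
  assumes "x j < p" "y j < p" "(z::int \<Rightarrow> nat) j < p"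
  shows "vadd p z x j = vadd p z y j \<longleftrightarrow> x j = y j"
proof
  assume "vadd p z x j = vadd p z y j"
  then have *: "(z j + x j) mod p = (z j + y j) mod p" by (simp add: vadd_def)
  have "w = (if z j + w < p then (z j + w) mod p - z j else (z j + w) mod p + p - z j)"
    if "w < p" for w :: nat
    using that assms(3) by (auto simp: mod_if)
  moreover have "z j \<le> (z j + w) mod p \<longleftrightarrow> z j + w < p" if "w < p" for w :: nat
    using that assms(3) by (auto simp: mod_if)
  ultimately show "x j = y j" using assms(1,2) * by metis
qed (simp add: vadd_def)

lemma image_vadd_vcoset:
  assumes "z \<in> vil p" "x \<in> vil p"
  shows "vadd p z ` vcoset p x l = vcoset p (vadd p z x) l"
proof (intro equalityI subsetI)
  fix y assume "y \<in> vadd p z ` vcoset p x l"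
  with assms show "y \<in> vcoset p (vadd p z x) l"
    by (auto simp: vcoset_def vadd_closed) (simp add: vadd_def)
next
  fix y assume y: "y \<in> vcoset p (vadd p z x) l"
  then have yv: "y \<in> vil p" by (simp add: vcoset_def)
  let ?w = "vadd p (vneg p z) y"
  have w: "?w \<in> vil p" using assms yv by (intro vadd_closed vneg_closed)
  have zw: "vadd p z ?w = y" using vadd_vneg_cancel assms yv by blast
  have "?w j = x j" if "j \<le> l" for j
  proof -
    have "vadd p z ?w j = vadd p z x j" using y that zw by (simp add: vcoset_def)
    then show ?thesis using vadd_cong_iff[of ?w j p x z] w assms by (auto simp: vil_def)
  qed
  with w have "?w \<in> vcoset p x l" by (simp add: vcoset_def)
  then show "y \<in> vadd p z ` vcoset p x l" using zw by (metis image_eqI)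
qed

lemma vU_eq_vcoset: "vU p l = vcoset p vzero l"
  by (simp add: vU_def vcoset_def vzero_def)

lemma vzero_in_vil: "p > 0 \<Longrightarrow> vzero \<in> vil p"
  by (simp add: vil_def vzero_def)

lemma vadd_vzero: "x \<in> vil p \<Longrightarrow> vadd p x vzero = x"
  by (simp add: vil_def vzero_def vadd_def)

lemma image_vadd_vU:
  assumes "x \<in> vil p"
  shows "vadd p x ` vU p l = vcoset p x l"
proof -
  have "p > 0" using assms by (auto simp: vil_def)
  then show ?thesis
    using image_vadd_vcoset[OF assms vzero_in_vil] assms by (simp add: vU_eq_vcoset vadd_vzero)
qed

lemma vtop_alt: "vtop p = topology_generated_by {vcoset p x l | x l. x \<in> vil p}"
  unfolding vtop_def using image_vadd_vU by (intro arg_cong[where f = topology_generated_by]) blast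

lemma openin_vcoset: "x \<in> vil p \<Longrightarrow> openin (vtop p) (vcoset p x l)"
  unfolding vtop_alt by (intro topology_generated_by_Basis) blast

lemma vcoset_antimono: "l \<le> l' \<Longrightarrow> vcoset p x l' \<subseteq> vcoset p x l"
  by (auto simp: vcoset_def)

lemma vcoset_eq: "y \<in> vcoset p x l \<Longrightarrow> vcoset p y l = vcoset p x l"
  by (auto simp: vcoset_def)

lemma openin_vtop_iff:
  "openin (vtop p) S \<longleftrightarrow> S \<subseteq> vil p \<and> (\<forall>x\<in>S. \<exists>l. vcoset p x l \<subseteq> S)"
proof
  assume "openin (vtop p) S"
  then have "generate_topology_on {vcoset p x l | x l. x \<in> vil p} S"
    by (simp add: vtop_alt openin_topology_generated_by_iff)
  then show "S \<subseteq> vil p \<and> (\<forall>x\<in>S. \<exists>l. vcoset p x l \<subseteq> S)"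
  proof induction
    case (Int a b)
    show ?case
    proof (intro conjI ballI)
      fix x assume "x \<in> a \<inter> b"
      then obtain l l' where "vcoset p x l \<subseteq> a" "vcoset p x l' \<subseteq> b" using Int by blast
      then have "vcoset p x (max l l') \<subseteq> a \<inter> b"
        using vcoset_antimono[of l "max l l'"] vcoset_antimono[of l' "max l l'"] by fastforce
      then show "\<exists>l. vcoset p x l \<subseteq> a \<inter> b" by blast
    qed (use Int in auto)
  next
    case (UN K)
    then show ?case by blast
  next
    case (Basis s)
    then obtain x l where s: "s = vcoset p x l" by blast
    then have "\<forall>y\<in>s. vcoset p y l \<subseteq> s" using vcoset_eq by blast
    moreover have "s \<subseteq> vil p" using s by (auto simp: vcoset_def)
    ultimately show ?case by blast
  qed simp
next
  assume S: "S \<subseteq> vil p \<and> (\<forall>x\<in>S. \<exists>l. vcoset p x l \<subseteq> S)"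
  then obtain l where l: "\<And>x. x \<in> S \<Longrightarrow> vcoset p x (l x) \<subseteq> S" by metis
  have "S = (\<Union>x\<in>S. vcoset p x (l x))"
    using l S by (auto simp: vcoset_def)
  moreover have "openin (vtop p) (\<Union>x\<in>S. vcoset p x (l x))"
    using S by (intro openin_Union) (auto intro!: openin_vcoset)
  ultimately show "openin (vtop p) S" by simp
qed

definition vdig :: "nat \<Rightarrow> nat \<Rightarrow> (int \<Rightarrow> nat)" where
  "vdig p \<alpha> = (\<lambda>j. if j \<le> 0 then (\<alpha> div p ^ nat (- j)) mod p else 0)"

lemma digit_of_sum:
  fixes d :: "nat \<Rightarrow> nat"
  assumes "\<And>k. d k < p"
  shows "((\<Sum>k<n. d k * p ^ k) div p ^ i) mod p = (if i < n then d i else 0)"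
  using assms
proof (induction n arbitrary: d i)
  case (Suc n)
  let ?s = "\<Sum>k<n. d (Suc k) * p ^ k"
  have "p > 0" using Suc.prems[of 0] by simp
  have eq: "(\<Sum>k<Suc n. d k * p ^ k) = d 0 + p * ?s"
    by (simp only: sum.lessThan_Suc_shift) (simp add: sum_distrib_left mult_ac)
  show ?case
  proof (cases i)
    case 0
    then show ?thesis using Suc.prems[of 0] unfolding eq by simp
  next
    case (Suc i')
    have "(d 0 + p * ?s) div p ^ i = (d 0 + p * ?s) div p div p ^ i'"
      by (simp add: Suc div_mult2_eq)
    also have "(d 0 + p * ?s) div p = ?s"
      using Suc.prems[of 0] \<open>p > 0\<close> by simp
    finally show ?thesis
      unfolding eq using Suc.IH[of "\<lambda>k. d (Suc k)" i'] Suc.prems Suc by simp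
  qed
qed simp

lemma sum_of_digits:
  "(\<Sum>k<n. (\<alpha> div p ^ k mod p) * p ^ k) = (\<alpha>::nat) mod p ^ n"
proof (induction n)
  case (Suc n)
  have "\<alpha> mod p ^ Suc n = \<alpha> mod (p ^ n * p)" by (simp only: power_Suc2)
  also have "\<dots> = p ^ n * (\<alpha> div p ^ n mod p) + \<alpha> mod p ^ n" by (rule mod_mult2_eq)
  finally show ?case using Suc.IH by (simp add: mult_ac)
qed simp

lemma vlam_finite:
  assumes "\<And>j. j > 0 \<Longrightarrow> x j = 0" "\<And>k. k \<ge> n \<Longrightarrow> x (- int k) = 0"
  shows "vlam p x = real (\<Sum>k<n. x (- int k) * p ^ k)"
proof -
  have inj: "inj_on (\<lambda>k. - int k) {..<n}" by (auto simp: inj_on_def)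
  have "vlam p x = (\<Sum>\<^sub>\<infinity>j\<in>(\<lambda>k. - int k) ` {..<n}. real (x j) * real p powi (- j))"
    unfolding vlam_def
  proof (rule infsum_cong_neutral)
    fix j assume j: "j \<in> UNIV - (\<lambda>k. - int k) ` {..<n}"
    have "x j = 0"
    proof (cases "j > 0")
      case False
      then have "j = - int (nat (- j))" by simp
      moreover from this j have "nat (- j) \<ge> n" by (metis DiffD2 image_eqI lessThan_iff not_le)
      ultimately show ?thesis using assms(2) by metis
    qed (use assms in auto)
    then show "real (x j) * real p powi (- j) = 0" by simp
  qed auto
  also have "\<dots> = (\<Sum>j\<in>(\<lambda>k. - int k) ` {..<n}. real (x j) * real p powi (- j))"
    by simp
  also have "\<dots> = (\<Sum>k<n. real (x (- int k)) * real p ^ k)"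
    by (subst sum.reindex[OF inj]) simp
  finally show ?thesis by simp
qed

lemma vdig_eq_0:
  assumes "p \<ge> 2" "k \<ge> \<alpha>"
  shows "vdig p \<alpha> (- int k) = 0"
proof -
  have "k < p ^ k" using assms by (simp add: power_gt_expt)
  with assms show ?thesis by (simp add: vdig_def)
qed

lemma vdig_in_vH:
  assumes "p \<ge> 2"
  shows "vdig p \<alpha> \<in> vH p"
proof -
  have "{j. j < 0 \<and> vdig p \<alpha> j \<noteq> 0} \<subseteq> {- int \<alpha>..0}"
  proof clarsimp
    fix j :: int assume j: "j < 0" "0 < vdig p \<alpha> j"
    have "\<not> nat (- j) \<ge> \<alpha>" using vdig_eq_0[OF assms, of \<alpha> "nat (- j)"] j by auto
    then show "- int \<alpha> \<le> j" using j by linarith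
  qed
  then have "finite {j. j < 0 \<and> vdig p \<alpha> j \<noteq> 0}" by (rule finite_subset) simp
  then show ?thesis using assms by (auto simp: vH_def vil_def vdig_def)
qed

lemma vlam_vdig:
  assumes "p \<ge> 2"
  shows "vlam p (vdig p \<alpha>) = real \<alpha>"
proof -
  have "vlam p (vdig p \<alpha>) = real (\<Sum>k<\<alpha>. vdig p \<alpha> (- int k) * p ^ k)"
    using assms by (intro vlam_finite) (auto simp: vdig_eq_0, simp add: vdig_def)
  also have "(\<Sum>k<\<alpha>. vdig p \<alpha> (- int k) * p ^ k) = (\<Sum>k<\<alpha>. (\<alpha> div p ^ k mod p) * p ^ k)"
    by (simp add: vdig_def)
  also have "\<dots> = \<alpha>"
    using assms power_gt_expt[of p \<alpha>] by (simp add: sum_of_digits)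
  finally show ?thesis .
qed

lemma vH_vdig:
  assumes "h \<in> vH p"
  obtains \<alpha> where "h = vdig p \<alpha>"
proof -
  have lt: "h j < p" for j using assms by (auto simp: vH_def vil_def)
  have "finite {j. j < 0 \<and> h j \<noteq> 0}" using assms by (auto simp: vH_def vil_def)
  then have "finite ((\<lambda>j. nat (- j)) ` {j. j < 0 \<and> h j \<noteq> 0})" by simp
  then obtain n where n: "\<And>m. m \<in> (\<lambda>j. nat (- j)) ` {j. j < 0 \<and> h j \<noteq> 0} \<Longrightarrow> m < n"
    unfolding finite_nat_set_iff_bounded by blast
  have "h j = vdig p (\<Sum>k<Suc n. h (- int k) * p ^ k) j" for j
  proof (cases "j \<le> 0")
    case True
    then have "vdig p (\<Sum>k<Suc n. h (- int k) * p ^ k) j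
        = (if nat (- j) < Suc n then h (- int (nat (- j))) else 0)"
      unfolding vdig_def using digit_of_sum[of "\<lambda>k. h (- int k)" p "Suc n" "nat (- j)"] lt by simp
    also have "\<dots> = h j"
    proof (cases "nat (- j) < Suc n")
      case False
      then have "h j = 0" using n[of "nat (- j)"] True by fastforce
      with False show ?thesis by simp
    qed (use True in simp)
    finally show ?thesis by simp
  next
    case False
    then show ?thesis using assms by (simp add: vH_def vdig_def)
  qed
  then show ?thesis using that by blast
qed

lemma ex1_vh:
  assumes "p \<ge> 2"
  shows "\<exists>!h. h \<in> vH p \<and> vlam p h = real \<alpha>"
proof (rule ex1I[of _ "vdig p \<alpha>"])
  show "vdig p \<alpha> \<in> vH p \<and> vlam p (vdig p \<alpha>) = real \<alpha>"
    using assms by (simp add: vdig_in_vH vlam_vdig)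
next
  fix h assume h: "h \<in> vH p \<and> vlam p h = real \<alpha>"
  then obtain \<beta> where "h = vdig p \<beta>" using vH_vdig by blast
  with h show "h = vdig p \<alpha>" using vlam_vdig[OF assms] by simp
qed

lemma vh_eq_vdig:
  assumes "p \<ge> 2"
  shows "vh p \<alpha> = vdig p \<alpha>"
  unfolding vh_def using ex1_vh[OF assms] assms
  by (intro the1_equality) (simp_all add: vdig_in_vH vlam_vdig)

lemma vdelta_eq:
  assumes "p \<ge> 2" "l < p"
  shows "vdelta p l = (\<lambda>j. if j = 1 then l else 0)"
proof
  fix j :: int
  show "vdelta p l j = (if j = 1 then l else 0)"
  proof (cases "j < 1")
    case True
    define k where "k = nat (1 - j)"
    have k: "k > 0" "nat (- (j - 1)) = k" using True by (auto simp: k_def)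
    have "l < p ^ k" using self_le_power[of p k] assms k by linarith
    then show ?thesis using k True assms by (simp add: vdelta_def vh_eq_vdig dil_def vdig_def)
  qed (use assms in \<open>auto simp: vdelta_def vh_eq_vdig dil_def vdig_def\<close>)
qed

lemma countable_vH: "countable (vH p)"
proof (rule countable_subset)
  show "vH p \<subseteq> range (vdig p)" using vH_vdig by blast
qed simp

definition vbasis :: "nat \<Rightarrow> (int \<Rightarrow> nat) set set" where
  "vbasis p = insert {} {vcoset p x (int n) | x n. x \<in> vil p}"

lemma countable_vbasis: "countable (vbasis p)"
proof -
  have "{vcoset p x (int n) | x n. x \<in> vil p}
      \<subseteq> (\<lambda>(h, n). vcoset p (dil (- int n) h) (int n)) ` (vH p \<times> UNIV)"
  proof clarify
    fix x n assume x: "x \<in> vil p"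
    define h where "h = (\<lambda>j. if j \<le> 0 then x (j + int n) else 0)"
    have "finite ({j. j < 0 \<and> x j \<noteq> 0} \<union> {0..int n})" using x by (auto simp: vil_def)
    then have "finite ((\<lambda>j. j - int n) ` ({j. j < 0 \<and> x j \<noteq> 0} \<union> {0..int n}))" by (rule finite_imageI)
    moreover have "{j. j < 0 \<and> h j \<noteq> 0} \<subseteq> (\<lambda>j. j - int n) ` ({j. j < 0 \<and> x j \<noteq> 0} \<union> {0..int n})"
    proof
      fix j assume "j \<in> {j. j < 0 \<and> h j \<noteq> 0}"
      then have "j + int n \<in> {j. j < 0 \<and> x j \<noteq> 0} \<union> {0..int n}"
        by (auto simp: h_def)
      then show "j \<in> (\<lambda>j. j - int n) ` ({j. j < 0 \<and> x j \<noteq> 0} \<union> {0..int n})"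
        by (rule rev_image_eqI) simp
    qed
    ultimately have "finite {j. j < 0 \<and> h j \<noteq> 0}" by (rule rev_finite_subset)
    moreover have "p > 0" using x by (auto simp: vil_def)
    then have "h j < p" for j using x by (simp add: h_def vil_def)
    ultimately have "h \<in> vH p" by (auto simp: vH_def vil_def h_def)
    moreover have "vcoset p x (int n) = vcoset p (dil (- int n) h) (int n)"
      by (auto simp: vcoset_def dil_def h_def)
    ultimately show "vcoset p x (int n) \<in> (\<lambda>(h, n). vcoset p (dil (- int n) h) (int n)) ` (vH p \<times> UNIV)"
      by blast
  qed
  moreover have "countable ((\<lambda>(h, n). vcoset p (dil (- int n) h) (int n)) ` (vH p \<times> (UNIV::nat set)))"
    by (intro countable_image countable_SIGMA countable_vH) auto
  ultimately show ?thesis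
    unfolding vbasis_def by (intro countable_insert) (rule countable_subset)
qed

lemma vbasis_subset: "vbasis p \<subseteq> Pow (vil p)"
  by (auto simp: vbasis_def vcoset_def)

lemma Int_stable_vbasis: "Int_stable (vbasis p)"
proof (rule Int_stableI)
  fix a b assume "a \<in> vbasis p" "b \<in> vbasis p"
  show "a \<inter> b \<in> vbasis p"
  proof (cases "a \<inter> b = {}")
    case False
    then obtain z where z: "z \<in> a" "z \<in> b" by blast
    then obtain x n y m where *: "a = vcoset p x (int n)" "b = vcoset p y (int m)"
      using \<open>a \<in> vbasis p\<close> \<open>b \<in> vbasis p\<close> by (auto simp: vbasis_def)
    have "z \<in> vil p" using z * by (simp add: vcoset_def)
    have "a = vcoset p z (int n)" "b = vcoset p z (int m)"
      using z * vcoset_eq by blast+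
    then have "a \<inter> b = vcoset p z (int (max n m))"
      by (auto simp: vcoset_def max_def)
    with \<open>z \<in> vil p\<close> show ?thesis unfolding vbasis_def by blast
  qed (simp add: vbasis_def)
qed

lemma sigma_sets_vbasis:
  "sigma_sets (vil p) {S. openin (vtop p) S} = sigma_sets (vil p) (vbasis p)"
proof (rule sigma_sets_eqI)
  fix S assume "S \<in> {S. openin (vtop p) S}"
  then have S: "S \<subseteq> vil p" "\<And>x. x \<in> S \<Longrightarrow> \<exists>l. vcoset p x l \<subseteq> S"
    by (auto simp: openin_vtop_iff)
  have "S = \<Union> {B \<in> vbasis p. B \<subseteq> S}"
  proof (intro equalityI subsetI)
    fix x assume x: "x \<in> S"
    then obtain l where "vcoset p x l \<subseteq> S" using S by blast
    moreover have "vcoset p x (int (nat l)) \<subseteq> vcoset p x l" by (rule vcoset_antimono) simp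
    ultimately have "vcoset p x (int (nat l)) \<subseteq> S" by (rule subset_trans[rotated])
    moreover have "vcoset p x (int (nat l)) \<in> vbasis p"
      unfolding vbasis_def using x S(1) by blast
    moreover have "x \<in> vcoset p x (int (nat l))"
      using x S(1) by (auto simp: vcoset_def)
    ultimately show "x \<in> \<Union> {B \<in> vbasis p. B \<subseteq> S}" by blast
  qed auto
  moreover have "countable {B \<in> vbasis p. B \<subseteq> S}"
    by (rule countable_subset[OF _ countable_vbasis]) auto
  then have "\<Union> {B \<in> vbasis p. B \<subseteq> S} \<in> sigma_sets (vil p) (vbasis p)"
    by (rule sigma_sets_UNION) (auto intro: sigma_sets.Basic)
  ultimately show "S \<in> sigma_sets (vil p) (vbasis p)" by simp
next
  fix b assume "b \<in> vbasis p"
  then have "openin (vtop p) b" by (auto simp: vbasis_def intro: openin_vcoset)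
  then show "b \<in> sigma_sets (vil p) {S. openin (vtop p) S}" by (auto intro: sigma_sets.Basic)
qed

lemma measure_eq_on_vcosets:
  assumes "sets M = sigma_sets (vil p) (vbasis p)" "sets N = sigma_sets (vil p) (vbasis p)"
    and M: "\<And>x n. x \<in> vil p \<Longrightarrow> of_nat (p ^ n) * emeasure M (vcoset p x (int n)) = 1"
    and N: "\<And>x n. x \<in> vil p \<Longrightarrow> of_nat (p ^ n) * emeasure N (vcoset p x (int n)) = 1"
  shows "M = N"
proof -
  have cancel: "a = b" if "c * a = 1" "c * b = 1" for a b c :: ennreal
  proof -
    have "a = (c * b) * a" by (simp add: that(2))
    also have "\<dots> = (c * a) * b" by (simp only: mult_ac)
    also have "\<dots> = b" by (simp add: that(1))
    finally show ?thesis .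
  qed
  have finite: "a \<noteq> \<infinity>" if "c * a = 1" for a c :: ennreal
  proof
    assume "a = \<infinity>"
    with that show False by (cases "c = 0") auto
  qed
  have ex: "\<exists>x n. x \<in> vil p \<and> X = vcoset p x (int n)" if "X \<in> vbasis p" "X \<noteq> {}" for X
    using that unfolding vbasis_def by blast
  have eq: "emeasure M X = emeasure N X" if X: "X \<in> vbasis p" for X
  proof (cases "X = {}")
    case False
    then obtain x n where x: "x \<in> vil p" "X = vcoset p x (int n)"
      using ex X by blast
    show ?thesis unfolding x(2) using M[OF x(1)] N[OF x(1)] by (rule cancel)
  qed simp
  have fin: "emeasure M X \<noteq> \<infinity>" if X: "X \<in> vbasis p" for X
  proof (cases "X = {}")
    case False
    then obtain x n where x: "x \<in> vil p" "X = vcoset p x (int n)"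
      using ex X by blast
    show ?thesis unfolding x(2) using M[OF x(1)] by (rule finite)
  qed simp
  have Un: "\<Union> (vbasis p) = vil p"
    by (auto simp: vbasis_def vcoset_def)
  show ?thesis
    by (rule measure_eqI_generator_eq_countable[OF Int_stable_vbasis vbasis_subset eq assms(1,2)
          subset_refl Un countable_vbasis fin])
qed

lemma is_haar_vcoset:
  assumes "is_haar p \<mu>" "x \<in> vil p"
  shows "of_nat (p ^ n) * emeasure \<mu> (vcoset p x (int n)) = 1"
proof -
  have p: "p > 0" using assms(2) by (auto simp: vil_def)
  have sets: "vcoset p y l \<in> sets \<mu>" if "y \<in> vil p" for y l
    using assms(1) openin_vcoset[OF that] by (auto simp: is_haar_def intro: sigma_sets.Basic)
  have inv: "emeasure \<mu> (vcoset p y l) = emeasure \<mu> (vU p l)" if "y \<in> vil p" for y l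
    using assms(1) image_vadd_vU[OF that, of l] sets[OF vzero_in_vil[OF p], of l] that
    unfolding is_haar_def vU_eq_vcoset by metis
  have "of_nat (p ^ n) * emeasure \<mu> (vU p (int n)) = 1"
  proof (induction n)
    case 0
    then show ?case using assms(1) by (simp add: is_haar_def)
  next
    case (Suc n)
    define e where "e d = (\<lambda>j. if j = int (Suc n) then d else 0 :: nat)" for d
    have e: "e d \<in> vil p" if "d < p" for d
    proof -
      have "{j. j < 0 \<and> e d j \<noteq> 0} = {}" by (auto simp: e_def)
      then show ?thesis using that by (simp add: vil_def) (simp add: e_def)
    qed
    have "vU p (int n) = (\<Union>d<p. vcoset p (e d) (int (Suc n)))"
    proof (intro equalityI subsetI)
      fix y assume y: "y \<in> vU p (int n)"
      then have "y \<in> vcoset p (e (y (int (Suc n)))) (int (Suc n))"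
        by (auto simp: vU_def vcoset_def e_def)
      moreover have "y (int (Suc n)) < p" using y by (auto simp: vU_def vil_def)
      ultimately show "y \<in> (\<Union>d<p. vcoset p (e d) (int (Suc n)))" by blast
    next
      fix y assume "y \<in> (\<Union>d<p. vcoset p (e d) (int (Suc n)))"
      then show "y \<in> vU p (int n)" by (auto simp: vU_def vcoset_def e_def)
    qed
    also have "emeasure \<mu> \<dots> = (\<Sum>d<p. emeasure \<mu> (vcoset p (e d) (int (Suc n))))"
    proof (rule sum_emeasure[symmetric])
      show "(\<lambda>d. vcoset p (e d) (int (Suc n))) ` {..<p} \<subseteq> sets \<mu>" using sets e by blast
      show "disjoint_family_on (\<lambda>d. vcoset p (e d) (int (Suc n))) {..<p}"
        by (auto simp: disjoint_family_on_def vcoset_def e_def)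
    qed simp
    also have "\<dots> = of_nat p * emeasure \<mu> (vU p (int (Suc n)))"
      using e by (simp add: inv)
    finally show ?case using Suc by (simp add: mult_ac)
  qed
  then show ?thesis using inv[OF assms(2)] by simp
qed

definition vmerge :: "(int \<Rightarrow> nat) \<times> (int \<Rightarrow> nat) \<Rightarrow> (int \<Rightarrow> nat)" where
  "vmerge = (\<lambda>(h, u) j. if j \<le> 0 then h j else u j)"

lemma ex_measure_on_vcosets:
  assumes "p \<ge> 2"
  shows "\<exists>\<mu>. sets \<mu> = sigma_sets (vil p) (vbasis p) \<and>
    (\<forall>x\<in>vil p. \<forall>n. of_nat (p ^ n) * emeasure \<mu> (vcoset p x (int n)) = 1)"
proof -
  define D where "D = uniform_count_measure {..<p}"
  define P where "P = PiM {1::int..} (\<lambda>_. D)"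
  define N where "N = count_space (vH p) \<Otimes>\<^sub>M P"
  have D: "prob_space D"
    unfolding D_def using assms by (intro prob_space_uniform_count_measure) (auto simp: lessThan_empty_iff)
  interpret D: prob_space D by (rule D)
  interpret PP: product_prob_space "\<lambda>_. D" "{1::int..}" by standard
  interpret P: prob_space P unfolding P_def by (rule PP.P.prob_space_axioms)
  have spD: "space D = {..<p}" "sets D = Pow {..<p}"
    by (auto simp: D_def space_uniform_count_measure sets_uniform_count_measure)
  have spP: "space P = (\<Pi>\<^sub>E i\<in>{1..}. {..<p})" by (simp add: P_def space_PiM spD)
  have T: "vmerge \<in> space N \<rightarrow> vil p"
  proof
    fix z assume z: "z \<in> space N"
    obtain h u where hu: "z = (h, u)" by fastforce
    have h: "h \<in> vil p" and u: "u \<in> (\<Pi>\<^sub>E i\<in>{1..}. {..<p})"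
      using z by (auto simp: N_def space_pair_measure hu spP vH_def)
    have "{j. j < 0 \<and> vmerge z j \<noteq> 0} = {j. j < 0 \<and> h j \<noteq> 0}"
      by (auto simp: vmerge_def hu)
    moreover have "vmerge z j < p" for j
      using h u by (auto simp: vmerge_def hu vil_def PiE_iff)
    ultimately show "vmerge z \<in> vil p" using h by (simp add: vil_def)
  qed
  define t where "t x = (\<lambda>j::int. if j \<le> 0 then x j else 0 :: nat)" for x
  have pre: "vmerge -` vcoset p x (int n) \<inter> space N
      = {t x} \<times> prod_emb {1..} (\<lambda>_. D) {1..int n} (\<Pi>\<^sub>E i\<in>{1..int n}. {x i})"
    and tH: "t x \<in> vH p" if x: "x \<in> vil p" for x n
  proof -
    have "{j. j < 0 \<and> t x j \<noteq> 0} = {j. j < 0 \<and> x j \<noteq> 0}" by (auto simp: t_def)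
    moreover have "t x j < p" for j using x assms by (auto simp: vil_def t_def)
    ultimately show tH: "t x \<in> vH p" using x by (auto simp: vH_def vil_def t_def)
    show "vmerge -` vcoset p x (int n) \<inter> space N
      = {t x} \<times> prod_emb {1..} (\<lambda>_. D) {1..int n} (\<Pi>\<^sub>E i\<in>{1..int n}. {x i})"
    proof (intro equalityI subsetI)
      fix z assume z: "z \<in> vmerge -` vcoset p x (int n) \<inter> space N"
      obtain h u where hu: "z = (h, u)" by fastforce
      have h: "h \<in> vH p" and u: "u \<in> space P"
        using z by (auto simp: N_def space_pair_measure hu)
      have eq: "vmerge z j = x j" if "j \<le> int n" for j using z that by (auto simp: vcoset_def)
      have "h j = t x j" for j
        using eq[of j] h by (cases "j \<le> 0") (auto simp: vmerge_def hu t_def vH_def)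
      then have "h = t x" by blast
      moreover have "u i = x i" if "i \<in> {1..int n}" for i
        using eq[of i] that by (auto simp: vmerge_def hu)
      ultimately show "z \<in> {t x} \<times> prod_emb {1..} (\<lambda>_. D) {1..int n} (\<Pi>\<^sub>E i\<in>{1..int n}. {x i})"
        using u by (auto simp: hu prod_emb_def spP spD)
    next
      fix z assume z: "z \<in> {t x} \<times> prod_emb {1..} (\<lambda>_. D) {1..int n} (\<Pi>\<^sub>E i\<in>{1..int n}. {x i})"
      obtain h u where hu: "z = (h, u)" by fastforce
      have h: "h = t x" using z hu by auto
      have u: "u \<in> (\<Pi>\<^sub>E i\<in>{1..}. {..<p})" "restrict u {1..int n} \<in> (\<Pi>\<^sub>E i\<in>{1..int n}. {x i})"
        using z by (auto simp: hu prod_emb_def spD)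
      have ui: "u i = x i" if "i \<in> {1..int n}" for i
        using u(2) that by (auto simp: PiE_iff)
      have zN: "z \<in> space N" using h u tH by (auto simp: N_def space_pair_measure hu spP)
      moreover have "vmerge z j = x j" if "j \<le> int n" for j
        using that ui by (auto simp: vmerge_def hu h t_def)
      moreover have "vmerge z \<in> vil p" using T zN by blast
      ultimately show "z \<in> vmerge -` vcoset p x (int n) \<inter> space N"
        by (simp add: vcoset_def)
    qed
  qed
  have emb: "prod_emb {1..} (\<lambda>_. D) {1..int n} (\<Pi>\<^sub>E i\<in>{1..int n}. {x i}) \<in> sets P" if "x \<in> vil p" for x n
    unfolding P_def using that by (intro sets_PiM_I) (auto simp: spD vil_def)
  have rect: "{t x} \<in> sets (count_space (vH p))" if "x \<in> vil p" for x using tH[OF that] by simp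
  define B where "B = sigma (vil p) (vbasis p)"
  have setsB: "sets B = sigma_sets (vil p) (vbasis p)" and spB: "space B = vil p"
    using vbasis_subset by (simp_all add: B_def)
  have meas: "vmerge \<in> measurable N B"
    unfolding B_def
  proof (rule measurable_measure_of[OF vbasis_subset T])
    fix y assume "y \<in> vbasis p"
    then show "vmerge -` y \<inter> space N \<in> sets N"
    proof (unfold vbasis_def, safe)
      fix x n assume x: "x \<in> vil p"
      show "vmerge -` vcoset p x (int n) \<inter> space N \<in> sets N"
        unfolding pre[OF x] unfolding N_def using rect[OF x] emb[OF x] by (rule pair_measureI)
    qed simp
  qed
  define \<mu> where "\<mu> = distr N B vmerge"
  have "of_nat (p ^ n) * emeasure \<mu> (vcoset p x (int n)) = 1" if x: "x \<in> vil p" for x n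
  proof -
    have "vcoset p x (int n) \<in> sets B"
      using x by (auto simp: setsB vbasis_def intro!: sigma_sets.Basic)
    then have "emeasure \<mu> (vcoset p x (int n)) = emeasure N (vmerge -` vcoset p x (int n) \<inter> space N)"
      unfolding \<mu>_def using meas by (rule emeasure_distr[rotated])
    also have "\<dots> = emeasure (count_space (vH p)) {t x}
        * emeasure P (prod_emb {1..} (\<lambda>_. D) {1..int n} (\<Pi>\<^sub>E i\<in>{1..int n}. {x i}))"
      unfolding pre[OF x] unfolding N_def using rect[OF x] emb[OF x] by (rule P.emeasure_pair_measure_Times)
    also have "emeasure (count_space (vH p)) {t x} = 1" using tH[OF x] by simp
    also have "emeasure P (prod_emb {1..} (\<lambda>_. D) {1..int n} (\<Pi>\<^sub>E i\<in>{1..int n}. {x i}))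
        = (\<Prod>i\<in>{1..int n}. emeasure D {x i})"
      unfolding P_def using x by (intro PP.emeasure_PiM_emb) (auto simp: spD vil_def)
    also have "\<dots> = (\<Prod>i\<in>{1..int n}. ennreal (1 / real p))"
    proof (rule prod.cong[OF refl])
      fix i
      have "x i < p" using x by (auto simp: vil_def)
      then show "emeasure D {x i} = ennreal (1 / real p)"
        unfolding D_def by (subst emeasure_uniform_count_measure) auto
    qed
    also have "\<dots> = ennreal ((1 / real p) ^ n)" by (simp add: ennreal_power)
    finally have "of_nat (p ^ n) * emeasure \<mu> (vcoset p x (int n))
        = ennreal (real (p ^ n)) * ennreal ((1 / real p) ^ n)"
      by (simp only: mult_1 ennreal_of_nat_eq_real_of_nat)
    also have "\<dots> = ennreal (real (p ^ n) * (1 / real p) ^ n)"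
      by (simp add: ennreal_mult)
    also have "real (p ^ n) * (1 / real p) ^ n = 1"
      using assms by (simp add: power_one_over)
    finally show ?thesis by simp
  qed
  moreover have "sets \<mu> = sigma_sets (vil p) (vbasis p)" by (simp add: \<mu>_def setsB)
  ultimately show ?thesis by blast
qed

lemma vadd_measurable:
  assumes "sets \<mu> = sigma_sets (vil p) (vbasis p)" "y \<in> vil p"
  shows "vadd p y \<in> measurable \<mu> \<mu>"
    and "x \<in> vil p \<Longrightarrow> vadd p y -` vcoset p x l \<inter> vil p = vcoset p (vadd p (vneg p y) x) l"
proof -
  have sp: "space \<mu> = vil p"
    using assms(1) vbasis_subset by (metis sets_eq_imp_space_eq sets_measure_of space_measure_of)
  show pre: "vadd p y -` vcoset p x l \<inter> vil p = vcoset p (vadd p (vneg p y) x) l"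
    if x: "x \<in> vil p" for x l
  proof -
    have "vcoset p (vadd p (vneg p y) x) l = vadd p (vneg p y) ` vcoset p x l"
      using image_vadd_vcoset vneg_closed assms(2) x by metis
    also have "\<dots> = vadd p y -` vcoset p x l \<inter> vil p"
    proof (intro equalityI subsetI)
      fix w assume "w \<in> vadd p (vneg p y) ` vcoset p x l"
      then show "w \<in> vadd p y -` vcoset p x l \<inter> vil p"
        using assms(2) by (auto simp: vcoset_def vadd_vneg_cancel intro!: vadd_closed vneg_closed)
    next
      fix w assume "w \<in> vadd p y -` vcoset p x l \<inter> vil p"
      then show "w \<in> vadd p (vneg p y) ` vcoset p x l"
        using assms(2) by (intro image_eqI[of _ _ "vadd p y w"]) (auto simp: vadd_vneg_cancel)
    qed
    finally show ?thesis by simp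
  qed
  show "vadd p y \<in> measurable \<mu> \<mu>"
  proof (rule measurable_sigma_sets[OF assms(1) vbasis_subset])
    show "vadd p y \<in> space \<mu> \<rightarrow> vil p" using assms(2) by (auto simp: sp vadd_closed)
    fix b assume "b \<in> vbasis p"
    then show "vadd p y -` b \<inter> space \<mu> \<in> sets \<mu>"
    proof (unfold vbasis_def, safe)
      fix x n assume x: "x \<in> vil p"
      have "vadd p (vneg p y) x \<in> vil p" using x assms(2) by (intro vadd_closed vneg_closed)
      then show "vadd p y -` vcoset p x (int n) \<inter> space \<mu> \<in> sets \<mu>"
        unfolding sp pre[OF x] assms(1) by (auto simp: vbasis_def intro!: sigma_sets.Basic)
    qed simp
  qed
qed

lemma ex1_haar:
  assumes "p \<ge> 2"
  shows "\<exists>!\<mu>. is_haar p \<mu>"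
proof -
  obtain \<mu> where \<mu>: "sets \<mu> = sigma_sets (vil p) (vbasis p)"
    and em: "\<And>x n. x \<in> vil p \<Longrightarrow> of_nat (p ^ n) * emeasure \<mu> (vcoset p x (int n)) = 1"
    using ex_measure_on_vcosets[OF assms] by blast
  have sp: "space \<mu> = vil p"
    using \<mu> vbasis_subset by (metis sets_eq_imp_space_eq sets_measure_of space_measure_of)
  have "is_haar p \<mu>"
    unfolding is_haar_def
  proof (intro conjI ballI)
    show "sets \<mu> = sigma_sets (vil p) {S. openin (vtop p) S}" by (simp add: \<mu> sigma_sets_vbasis)
    show "emeasure \<mu> (vU p 0) = 1"
      using em[of vzero 0] assms by (simp add: vU_eq_vcoset vzero_in_vil)
    fix y S assume y: "y \<in> vil p" and S: "S \<in> sets \<mu>"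
    note meas = vadd_measurable(1)[OF \<mu> y] and pre = vadd_measurable(2)[OF \<mu> y]
    have ny: "vneg p y \<in> vil p" using y by (rule vneg_closed)
    have distr: "distr \<mu> \<mu> (vadd p y) = \<mu>"
    proof (rule measure_eq_on_vcosets[where p = p])
      fix x n assume x: "x \<in> vil p"
      have "vcoset p x (int n) \<in> sets \<mu>"
        using x by (auto simp: \<mu> vbasis_def intro!: sigma_sets.Basic)
      then have "emeasure (distr \<mu> \<mu> (vadd p y)) (vcoset p x (int n))
          = emeasure \<mu> (vcoset p (vadd p (vneg p y) x) (int n))"
        using meas by (simp add: emeasure_distr sp pre[OF x])
      then show "of_nat (p ^ n) * emeasure (distr \<mu> \<mu> (vadd p y)) (vcoset p x (int n)) = 1"
        using em[OF vadd_closed[OF ny x]] by simp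
    next
      fix x n assume "x \<in> vil p"
      then show "of_nat (p ^ n) * emeasure \<mu> (vcoset p x (int n)) = 1" by (rule em)
    qed (simp_all add: \<mu>)
    have Ssub: "S \<subseteq> vil p" using S sets.sets_into_space sp by blast
    have img: "vadd p y ` S = vadd p (vneg p y) -` S \<inter> space \<mu>"
    proof (intro equalityI subsetI)
      fix w assume "w \<in> vadd p y ` S"
      then show "w \<in> vadd p (vneg p y) -` S \<inter> space \<mu>"
        using y Ssub by (force simp: sp vadd_vneg_cancel intro!: vadd_closed)
    next
      fix w assume "w \<in> vadd p (vneg p y) -` S \<inter> space \<mu>"
      then show "w \<in> vadd p y ` S"
        using y by (intro image_eqI[of _ _ "vadd p (vneg p y) w"]) (auto simp: sp vadd_vneg_cancel)
    qed
    have "vadd p y ` S \<in> sets \<mu>"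
      unfolding img using vadd_measurable(1)[OF \<mu> ny] S by (rule measurable_sets)
    then have *: "emeasure (distr \<mu> \<mu> (vadd p y)) (vadd p y ` S)
        = emeasure \<mu> (vadd p y -` (vadd p y ` S) \<inter> space \<mu>)"
      using meas by (simp add: emeasure_distr)
    have "vadd p y -` (vadd p y ` S) \<inter> space \<mu> = S"
    proof (intro equalityI subsetI)
      fix w assume w: "w \<in> vadd p y -` (vadd p y ` S) \<inter> space \<mu>"
      then obtain s where s: "s \<in> S" "vadd p y w = vadd p y s" by auto
      have "w = s"
        using vadd_vneg_cancel(2)[OF y, of w] vadd_vneg_cancel(2)[OF y, of s] s w Ssub
        by (auto simp: sp)
      with s show "w \<in> S" by simp
    qed (use Ssub sp in auto)
    with * show "emeasure \<mu> (vadd p y ` S) = emeasure \<mu> S" unfolding distr by simp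
  qed
  moreover have "\<nu> = \<mu>" if \<nu>: "is_haar p \<nu>" for \<nu>
  proof -
    have "sets \<nu> = sigma_sets (vil p) (vbasis p)"
      using \<nu> by (simp add: is_haar_def sigma_sets_vbasis)
    then show ?thesis
      using \<mu> is_haar_vcoset[OF \<nu>] em by (rule measure_eq_on_vcosets)
  qed
  ultimately show ?thesis by (rule ex1I)
qed

lemma is_haar_haar: "p \<ge> 2 \<Longrightarrow> is_haar p (haar p)"
  unfolding haar_def by (rule theI'[OF ex1_haar])

end

theory Submission
  imports Defs
begin

text \<open>
  A function of \<open>\<omega>\<^sub>1, \<dots>, \<omega>\<^sub>n\<close> alone is a Walsh polynomial, so no Fejer-Riesz factorisation is
  needed: \<open>m\<^sub>0\<close> is completed to a matrix with orthonormal rows fibre by fibre, and this is possible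
  iff the columns \<open>(m\<^sub>0(\<omega> \<oplus> \<delta>\<^sub>l))\<^sub>l\<close> have norm at most 1.

  The tight frame property is the unitary extension principle, carried out in the time domain.
  Let \<open>E\<^sub>j(f)\<close> be the sum of \<open>\<bar>\<langle>f, \<phi>\<^sub>j\<^sub>,\<^sub>h\<rangle>\<bar>\<^sup>2\<close> over \<open>h\<close>. The orthonormality of the rows of the mask
  matrix says that the details at level \<open>j\<close> contribute exactly \<open>E\<^sub>j\<^sub>+\<^sub>1(f) - E\<^sub>j(f)\<close>. For a step function \<open>f\<close>,
  \<open>E\<^sub>j(f)\<close> equals \<open>\<bar>\<integral>\<phi>\<bar>\<^sup>2 \<parallel>f\<parallel>\<^sup>2\<close> for all large \<open>j\<close>, because \<open>f\<close> is constant on the support of \<open>\<phi>\<^sub>j\<^sub>,\<^sub>h\<close>, and it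
  tends to 0 as \<open>j \<rightarrow> -\<infinity>\<close>. Telescoping and density of the step functions give the frame identity. The
  constant \<open>\<bar>\<integral>\<phi>\<bar>\<^sup>2\<close> is positive, and \<open>m\<^sub>0(\<theta>) = 1\<close> holds automatically: if \<open>\<integral>\<phi> = 0\<close>, the refinement
  equation would force all coset integrals of \<open>\<phi>\<close> to vanish.
\<close>

section \<open>The group and its characters\<close>

text \<open>Addition in the group has no carries. The elements whose nonzero coordinates lie in a
  given window therefore form a finite group (\<open>vbox\<close>), and \<open>vh\<close> identifies
  the indices below p^n with the window of the n last places of H. All finite index sets of the
  proof are such windows, on which character sums are evaluated exactly. Within H, a step function
  has nonzero coefficients against the translates at one level only on a single window; this turns
  the passage between two consecutive levels into an identity on a finite group, and no Plancherel
  theorem on the whole group is invoked. The Fourier transform enters to certify that the functions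
  \<open>psi\<close> are the wavelet functions of the constructed masks, and there compact support
  makes it an honest integral, locally constant in the frequency. Since \<open>vdelta p l\<close>
  alters coordinate 1 alone, a fibre arises by letting that coordinate vary. The square root of I -
  v v* contributes p further columns, whence p wavelets.\<close>

lemma borel_measurable_cnj [measurable (raw)]:
  "f \<in> borel_measurable M \<Longrightarrow> (\<lambda>x. cnj (f x)) \<in> borel_measurable M"
  by (rule measurable_compose[OF _ borel_measurable_continuous_onI]) (auto intro: continuous_intros)

locale vilenkin =
  fixes p :: nat
  assumes p_ge_2: "p \<ge> 2"
begin

lemma p_pos: "p > 0"
  using p_ge_2 by simp

lemma vil_less: "x \<in> vil p \<Longrightarrow> x j < p"
  by (simp add: vil_def)

text \<open>Over the integers the truncated subtraction in \<open>vneg\<close> becomes an honest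
  one, so that the group laws below are settled by simplification modulo p.\<close>

lemma int_vadd: "int (vadd p x y j) = (int (x j) + int (y j)) mod int p"
  by (simp add: vadd_def zmod_int)

lemma int_vneg: "x \<in> vil p \<Longrightarrow> int (vneg p x j) = (- int (x j)) mod int p"
  using vil_less[of x j] by (simp add: vneg_def zmod_int of_nat_diff less_imp_le)

lemma int_vsub: "y \<in> vil p \<Longrightarrow> int (vsub p x y j) = (int (x j) - int (y j)) mod int p"
  by (simp add: vsub_def int_vadd int_vneg mod_add_right_eq)

lemma vil_mod: "x \<in> vil p \<Longrightarrow> int (x j) mod int p = int (x j)"
  using vil_less[of x j] by simp

lemma vil_eqI:
  assumes "\<And>j. int (x j) = int (y j)"
  shows "x = (y :: int \<Rightarrow> nat)"
  using assms by (intro ext) (metis of_nat_eq_iff)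

lemma vadd_comm: "vadd p x y = vadd p y x"
  by (simp add: vadd_def add.commute)

lemma vsub_closed: "x \<in> vil p \<Longrightarrow> y \<in> vil p \<Longrightarrow> vsub p x y \<in> vil p"
  by (simp add: vsub_def vadd_closed vneg_closed)

lemma vadd_vsub_cancel:
  assumes "x \<in> vil p" "y \<in> vil p"
  shows "vadd p (vsub p x y) y = x" "vsub p (vadd p x y) y = x"
  using assms by (auto intro!: vil_eqI simp: int_vadd int_vsub mod_simps vil_mod)

lemma vsub_vadd:
  assumes "x \<in> vil p" "y \<in> vil p" "z \<in> vil p"
  shows "vsub p x (vadd p y z) = vsub p (vsub p x y) z"
  using assms by (auto intro!: vil_eqI simp: int_vadd int_vsub mod_simps vil_mod vadd_closed algebra_simps)

lemma dil_closed:
  assumes "x \<in> vil p"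
  shows "dil j x \<in> vil p"
proof -
  have "finite {i. i < 0 \<and> x i \<noteq> 0}" using assms by (simp add: vil_def)
  then have "finite ((\<lambda>i. i - j) ` ({i. i < 0 \<and> x i \<noteq> 0} \<union> {0..j}))" by simp
  moreover have "{i. i < 0 \<and> dil j x i \<noteq> 0} \<subseteq> (\<lambda>i. i - j) ` ({i. i < 0 \<and> x i \<noteq> 0} \<union> {0..j})"
  proof
    fix i assume "i \<in> {i. i < 0 \<and> dil j x i \<noteq> 0}"
    then show "i \<in> (\<lambda>i. i - j) ` ({i. i < 0 \<and> x i \<noteq> 0} \<union> {0..j})"
      by (intro image_eqI[of _ _ "i + j"]) (auto simp: dil_def)
  qed
  ultimately have "finite {i. i < 0 \<and> dil j x i \<noteq> 0}" by (rule rev_finite_subset)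
  then show ?thesis using assms by (simp add: vil_def) (simp add: dil_def)
qed

lemma dil_vadd: "dil j (vadd p x y) = vadd p (dil j x) (dil j y)"
  by (simp add: dil_def vadd_def)

lemma dil_vneg: "dil j (vneg p x) = vneg p (dil j x)"
  by (simp add: dil_def vneg_def)

lemma dil_vsub: "dil j (vsub p x y) = vsub p (dil j x) (dil j y)"
  by (simp add: vsub_def dil_vadd dil_vneg)

lemma dil_dil: "dil i (dil j x) = dil (i + j) x"
  by (simp add: dil_def add.assoc)

lemma dil_0: "dil 0 x = x"
  by (simp add: dil_def)

section \<open>Characters as p-th roots of unity\<close>

definition vroot :: "nat \<Rightarrow> complex" where
  "vroot n = exp (2 * of_real pi * \<i> / of_nat p * of_nat n)"

lemma vroot_0: "vroot 0 = 1"
  by (simp add: vroot_def)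

lemma vroot_add: "vroot (m + n) = vroot m * vroot n"
  by (simp add: vroot_def exp_add[symmetric] add_divide_distrib ring_distribs)

lemma exp_2pi_nat: "exp (2 * of_nat k * of_real pi * \<i>) = 1"
  using exp_integer_2pi[of "of_nat k"] by simp

lemma vroot_mult_p: "vroot (p * k) = 1"
proof -
  have "2 * of_real pi * \<i> / of_nat p * of_nat (p * k) = 2 * of_nat k * of_real pi * \<i>"
    using p_pos by simp
  also have "exp \<dots> = 1" by (rule exp_2pi_nat)
  finally show ?thesis unfolding vroot_def .
qed

lemma vroot_mod: "vroot (n mod p) = vroot n"
proof -
  have "vroot n = vroot (p * (n div p) + n mod p)" by simp
  also have "\<dots> = vroot (n mod p)" by (simp only: vroot_add vroot_mult_p mult_1)
  finally show ?thesis by simp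
qed

lemma vroot_cong: "m mod p = n mod p \<Longrightarrow> vroot m = vroot n"
  by (metis vroot_mod)

lemma norm_vroot: "cmod (vroot n) = 1"
  by (simp add: vroot_def norm_exp_eq_Re)

lemma vroot_neq_1:
  assumes "0 < n" "n < p"
  shows "vroot n \<noteq> 1"
proof
  assume "vroot n = 1"
  then have "exp (2 * of_real pi * \<i> / of_nat p * of_nat n) = (1::complex)" by (simp add: vroot_def)
  then obtain k :: int where "Im (2 * of_real pi * \<i> / of_nat p * of_nat n) = of_int (2 * k) * pi"
    by (auto simp: exp_eq_1)
  moreover have "2 * of_real pi * \<i> / of_nat p * of_nat n = complex_of_real (2 * pi / real p * real n) * \<i>"
    by simp
  then have "Im (2 * of_real pi * \<i> / of_nat p * of_nat n) = 2 * pi / real p * real n"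
    by (simp only:) simp
  ultimately have "2 * pi / real p * real n = of_int (2 * k) * pi" by simp
  then have "real n = of_int k * real p"
    using p_pos by (simp add: field_simps)
  then have "int n = k * int p" by (metis of_int_eq_iff of_int_mult of_int_of_nat_eq)
  with assms show False
    by (metis assms(1) assms(2) dvd_triv_right nat_dvd_not_less int_dvd_int_iff)
qed

definition csupp :: "(int \<Rightarrow> nat) \<Rightarrow> (int \<Rightarrow> nat) \<Rightarrow> int set" where
  "csupp x \<omega> = {j. x j \<noteq> 0 \<and> \<omega> (1 - j) \<noteq> 0}"

text \<open>The vanishing of \<open>x\<close> far to the left bounds the index from below; that of
  \<omega> bounds it from above through the reflection \<open>1 - j\<close>.\<close>

lemma finite_csupp:
  assumes "x \<in> vil p" "\<omega> \<in> vil p"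
  shows "finite (csupp x \<omega>)"
proof (rule finite_subset)
  show "csupp x \<omega> \<subseteq> {j. j < 0 \<and> x j \<noteq> 0} \<union> {0, 1} \<union> (\<lambda>i. 1 - i) ` {i. i < 0 \<and> \<omega> i \<noteq> 0}"
  proof
    fix j assume j: "j \<in> csupp x \<omega>"
    show "j \<in> {j. j < 0 \<and> x j \<noteq> 0} \<union> {0, 1} \<union> (\<lambda>i. 1 - i) ` {i. i < 0 \<and> \<omega> i \<noteq> 0}"
    proof (cases "j > 1")
      case True
      with j have "1 - j \<in> {i. i < 0 \<and> \<omega> i \<noteq> 0}" by (auto simp: csupp_def)
      then have "1 - (1 - j) \<in> (\<lambda>i. 1 - i) ` {i. i < 0 \<and> \<omega> i \<noteq> 0}" by (rule imageI)
      then show ?thesis by simp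
    qed (use j in \<open>auto simp: csupp_def\<close>)
  qed
qed (use assms in \<open>auto simp: vil_def\<close>)

text \<open>Permits the pairing to be summed over any finite superset of its support, so that
  several characters can share one index set.\<close>

lemma vchi_eq:
  assumes "finite J" "csupp x \<omega> \<subseteq> J"
  shows "vchi p x \<omega> = vroot (\<Sum>j\<in>J. x j * \<omega> (1 - j))"
proof -
  have "(\<Sum>j\<in>csupp x \<omega>. x j * \<omega> (1 - j)) = (\<Sum>j\<in>J. x j * \<omega> (1 - j))"
    using assms by (intro sum.mono_neutral_left) (auto simp: csupp_def)
  then show ?thesis by (simp add: vchi_def vroot_def csupp_def)
qed

lemma vchi_cong:
  assumes "\<And>j. x j \<noteq> 0 \<Longrightarrow> \<omega> (1 - j) = \<omega>' (1 - j)"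
  shows "vchi p x \<omega> = vchi p x \<omega>'"
proof -
  have "(\<Sum>j | x j \<noteq> 0 \<and> \<omega> (1 - j) \<noteq> 0. x j * \<omega> (1 - j)) = (\<Sum>j | x j \<noteq> 0 \<and> \<omega>' (1 - j) \<noteq> 0. x j * \<omega>' (1 - j))"
    using assms by (intro sum.cong) auto
  then show ?thesis by (simp add: vchi_def)
qed

lemma vchi_comm: "vchi p x \<omega> = vchi p \<omega> x"
proof -
  have "(\<Sum>j\<in>csupp x \<omega>. x j * \<omega> (1 - j)) = (\<Sum>j\<in>csupp \<omega> x. \<omega> j * x (1 - j))"
    by (rule sum.reindex_bij_witness[of _ "\<lambda>j. 1 - j" "\<lambda>j. 1 - j"]) (auto simp: csupp_def)
  then show ?thesis by (simp add: vchi_def csupp_def)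
qed

lemma vchi_vadd_left:
  assumes "x \<in> vil p" "y \<in> vil p" "\<omega> \<in> vil p"
  shows "vchi p (vadd p x y) \<omega> = vchi p x \<omega> * vchi p y \<omega>"
proof -
  define J where "J = csupp x \<omega> \<union> csupp y \<omega>"
  have J: "finite J" using assms by (simp add: J_def finite_csupp)
  have sub: "csupp (vadd p x y) \<omega> \<subseteq> J"
  proof
    fix j assume j: "j \<in> csupp (vadd p x y) \<omega>"
    then have "x j \<noteq> 0 \<or> y j \<noteq> 0" by (auto simp: csupp_def vadd_def intro!: gr0I)
    with j show "j \<in> J" by (auto simp: J_def csupp_def)
  qed
  have "(\<Sum>j\<in>J. vadd p x y j * \<omega> (1 - j)) mod p = (\<Sum>j\<in>J. (vadd p x y j * \<omega> (1 - j)) mod p) mod p"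
    by (rule mod_sum_eq[symmetric])
  also have "\<dots> = (\<Sum>j\<in>J. ((x j + y j) * \<omega> (1 - j)) mod p) mod p"
    by (simp only: vadd_def mod_mult_left_eq)
  also have "\<dots> = (\<Sum>j\<in>J. (x j + y j) * \<omega> (1 - j)) mod p" by (rule mod_sum_eq)
  also have "(\<Sum>j\<in>J. (x j + y j) * \<omega> (1 - j)) = (\<Sum>j\<in>J. x j * \<omega> (1 - j)) + (\<Sum>j\<in>J. y j * \<omega> (1 - j))"
    by (simp add: sum.distrib algebra_simps)
  finally have "vroot (\<Sum>j\<in>J. vadd p x y j * \<omega> (1 - j)) = vroot (\<Sum>j\<in>J. x j * \<omega> (1 - j)) * vroot (\<Sum>j\<in>J. y j * \<omega> (1 - j))"
    by (metis vroot_cong vroot_add)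
  moreover have "csupp x \<omega> \<subseteq> J" "csupp y \<omega> \<subseteq> J" by (auto simp: J_def)
  ultimately show ?thesis using vchi_eq[OF J] sub by metis
qed

lemma norm_vchi: "cmod (vchi p x \<omega>) = 1"
  unfolding vchi_def using norm_vroot unfolding vroot_def by blast

lemma vchi_vzero_left: "vchi p vzero \<omega> = 1"
  by (simp add: vchi_def vzero_def)

lemma vchi_cnj_self: "vchi p x \<omega> * cnj (vchi p x \<omega>) = 1"
  using complex_norm_square[of "vchi p x \<omega>"] by (simp add: norm_vchi)

lemma vneg_vadd: "x \<in> vil p \<Longrightarrow> vadd p x (vneg p x) = vzero"
  by (auto intro!: vil_eqI simp: int_vadd int_vneg mod_simps vzero_def)

lemma vchi_vneg:
  assumes "x \<in> vil p" "\<omega> \<in> vil p"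
  shows "vchi p (vneg p x) \<omega> = cnj (vchi p x \<omega>)"
proof -
  have "vchi p x \<omega> * vchi p (vneg p x) \<omega> = 1"
    using assms vchi_vadd_left[of x "vneg p x" \<omega>] by (simp add: vneg_closed vneg_vadd vchi_vzero_left)
  then show ?thesis using vchi_cnj_self[of x \<omega>]
    by (metis mult.commute mult.left_commute mult_1)
qed

lemma vchi_vsub_left:
  assumes "x \<in> vil p" "y \<in> vil p" "\<omega> \<in> vil p"
  shows "vchi p (vsub p x y) \<omega> = vchi p x \<omega> * cnj (vchi p y \<omega>)"
  using assms by (simp add: vsub_def vchi_vadd_left vneg_closed vchi_vneg)

lemma vchi_vsub_right:
  assumes "x \<in> vil p" "y \<in> vil p" "\<omega> \<in> vil p"
  shows "vchi p \<omega> (vsub p x y) = vchi p \<omega> x * cnj (vchi p \<omega> y)"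
  using vchi_vsub_left[OF assms] by (simp add: vchi_comm)

text \<open>A shift of the summation index moves the dilation to the other argument. The reflection
  \<open>1 - j\<close> reverses the direction of the shift, so that the exponent keeps its
  sign.\<close>

lemma vchi_dil: "vchi p (dil i x) \<omega> = vchi p x (dil i \<omega>)"
proof -
  have "(\<Sum>j\<in>csupp (dil i x) \<omega>. dil i x j * \<omega> (1 - j)) = (\<Sum>j\<in>csupp x (dil i \<omega>). x j * dil i \<omega> (1 - j))"
    by (rule sum.reindex_bij_witness[of _ "\<lambda>j. j - i" "\<lambda>j. j + i"])
      (auto simp: csupp_def dil_def algebra_simps)
  then show ?thesis by (simp add: vchi_def csupp_def)
qed

lemma vchi_eq_1: "(\<And>j. x j = 0 \<or> \<omega> (1 - j) = 0) \<Longrightarrow> vchi p x \<omega> = 1"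
  using vchi_eq[of "{}" x \<omega>] by (auto simp: csupp_def vroot_0)

text \<open>Supplies a translation on which a given nontrivial character differs from 1; the
  orthogonality relations rest on it.\<close>

definition vunit :: "int \<Rightarrow> (int \<Rightarrow> nat)" where
  "vunit i = (\<lambda>j. if j = i then 1 else 0)"

lemma vunit_closed: "vunit i \<in> vil p"
proof -
  have "finite {j. j < 0 \<and> vunit i j \<noteq> 0}"
    by (rule finite_subset[of _ "{i}"]) (auto simp: vunit_def)
  then show ?thesis using p_ge_2 by (simp add: vil_def) (simp add: vunit_def)
qed

lemma vchi_vunit_neq_1:
  assumes "\<omega> \<in> vil p" "\<omega> (1 - i) \<noteq> 0"
  shows "vchi p (vunit i) \<omega> \<noteq> 1"
  using vchi_eq[of "{i}" "vunit i" \<omega>] vroot_neq_1 vil_less assms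
  by (auto simp: csupp_def vunit_def)

section \<open>Finite coordinate windows\<close>

definition vbox :: "int \<Rightarrow> int \<Rightarrow> (int \<Rightarrow> nat) set" where
  "vbox a b = {x \<in> vil p. \<forall>j. x j \<noteq> 0 \<longrightarrow> a < j \<and> j \<le> b}"

lemma vbox_vil: "x \<in> vbox a b \<Longrightarrow> x \<in> vil p"
  by (simp add: vbox_def)

lemma vbox_eq_0: "x \<in> vbox a b \<Longrightarrow> j \<le> a \<or> b < j \<Longrightarrow> x j = 0"
  by (auto simp: vbox_def)

lemma vbox_mono:
  assumes "a' \<le> a" "b \<le> b'"
  shows "vbox a b \<subseteq> vbox a' b'"
proof
  fix x assume x: "x \<in> vbox a b"
  have "a' < j \<and> j \<le> b'" if "x j \<noteq> 0" for j
  proof -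
    have "a < j \<and> j \<le> b" using x that by (simp add: vbox_def)
    with assms show ?thesis by linarith
  qed
  with x show "x \<in> vbox a' b'" by (simp add: vbox_def)
qed

lemma vadd_vbox:
  assumes "x \<in> vbox a b" "y \<in> vbox a b"
  shows "vadd p x y \<in> vbox a b"
proof -
  have "a < j \<and> j \<le> b" if "vadd p x y j \<noteq> 0" for j
  proof -
    have "x j \<noteq> 0 \<or> y j \<noteq> 0" using that by (auto simp: vadd_def intro!: gr0I)
    then show ?thesis using assms by (auto simp: vbox_def)
  qed
  then show ?thesis using assms by (simp add: vbox_def vadd_closed)
qed

lemma vneg_vbox:
  assumes "x \<in> vbox a b"
  shows "vneg p x \<in> vbox a b"
proof -
  have "a < j \<and> j \<le> b" if "vneg p x j \<noteq> 0" for j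
  proof -
    have "x j \<noteq> 0" using that by (auto simp: vneg_def intro!: gr0I)
    then show ?thesis using assms by (auto simp: vbox_def)
  qed
  then show ?thesis using assms by (simp add: vbox_def vneg_closed)
qed

lemma dil_vbox:
  assumes "x \<in> vbox a b"
  shows "dil i x \<in> vbox (a - i) (b - i)"
proof -
  have "dil i x \<in> vil p" using assms by (simp add: dil_closed vbox_vil)
  moreover have "a - i < j \<and> j \<le> b - i" if "dil i x j \<noteq> 0" for j
  proof -
    have "a < j + i \<and> j + i \<le> b" using assms that by (simp add: vbox_def dil_def)
    then show ?thesis by linarith
  qed
  ultimately show ?thesis by (simp add: vbox_def)
qed

lemma vil_boundedI:
  fixes a :: int
  assumes "\<And>j. x j < p" "\<And>j. j \<le> a \<Longrightarrow> x j = 0"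
  shows "x \<in> vil p"
proof -
  have "{j. j < 0 \<and> x j \<noteq> 0} \<subseteq> {a..0}"
  proof
    fix j assume "j \<in> {j. j < 0 \<and> x j \<noteq> 0}"
    then show "j \<in> {a..0}" using assms(2)[of j] by (cases "j \<le> a") auto
  qed
  then have "finite {j. j < 0 \<and> x j \<noteq> 0}" by (rule finite_subset) simp
  then show ?thesis using assms by (simp add: vil_def)
qed

lemma bij_betw_vbox_PiE: "bij_betw (\<lambda>x. restrict x {a<..b}) (vbox a b) ({a<..b} \<rightarrow>\<^sub>E {..<p})"
proof (rule bij_betw_byWitness[where f' = "\<lambda>f j. if j \<in> {a<..b} then f j else 0"])
  show "\<forall>x\<in>vbox a b. (\<lambda>j. if j \<in> {a<..b} then restrict x {a<..b} j else 0) = x"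
  proof (intro ballI ext)
    fix x j assume "x \<in> vbox a b"
    then show "(if j \<in> {a<..b} then restrict x {a<..b} j else 0) = x j"
      using vbox_eq_0[of x a b j] by auto
  qed
  show "\<forall>f\<in>{a<..b} \<rightarrow>\<^sub>E {..<p}. restrict (\<lambda>j. if j \<in> {a<..b} then f j else 0) {a<..b} = f"
    by (auto simp: fun_eq_iff PiE_iff extensional_def)
  show "(\<lambda>x. restrict x {a<..b}) ` vbox a b \<subseteq> {a<..b} \<rightarrow>\<^sub>E {..<p}"
    by (auto simp: vil_less vbox_vil)
  show "(\<lambda>f j. if j \<in> {a<..b} then f j else 0) ` ({a<..b} \<rightarrow>\<^sub>E {..<p}) \<subseteq> vbox a b"
  proof clarify
    fix f assume f: "f \<in> {a<..b} \<rightarrow>\<^sub>E {..<p}"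
    have "(\<lambda>j. if j \<in> {a<..b} then f j else 0) \<in> vil p"
      by (rule vil_boundedI[where a = a]) (use f p_pos in \<open>auto simp: PiE_iff\<close>)
    then show "(\<lambda>j. if j \<in> {a<..b} then f j else 0) \<in> vbox a b"
      by (auto simp: vbox_def)
  qed
qed

text \<open>The truncated exponent is also right for an empty window, where the box consists of zero
  alone.\<close>

lemma card_vbox: "card (vbox a b) = p ^ nat (b - a)"
  using bij_betw_same_card[OF bij_betw_vbox_PiE[of a b]] by (simp add: card_PiE)

lemma finite_vbox: "finite (vbox a b)"
  using bij_betw_finite[OF bij_betw_vbox_PiE[of a b]] by (simp add: finite_PiE)

lemma bij_betw_vadd_vbox:
  assumes "z \<in> vbox a b"
  shows "bij_betw (vadd p z) (vbox a b) (vbox a b)"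
proof (rule bij_betw_byWitness[where f' = "vadd p (vneg p z)"])
  show "\<forall>x\<in>vbox a b. vadd p (vneg p z) (vadd p z x) = x"
    "\<forall>x\<in>vbox a b. vadd p z (vadd p (vneg p z) x) = x"
    using assms by (auto simp: vbox_vil vadd_vneg_cancel)
qed (use assms in \<open>auto intro: vadd_vbox vneg_vbox\<close>)

text \<open>Orthogonality of characters: if \<omega> is visible from the window at some
  \<open>j\<close>, translation by \<open>vunit j\<close> permutes the box and multiplies the sum by
  a number other than 1, which forces the sum to be 0.\<close>

lemma sum_vchi_vbox:
  assumes "\<omega> \<in> vil p"
  shows "(\<Sum>x\<in>vbox a b. vchi p x \<omega>) =
    (if \<forall>j. a < j \<and> j \<le> b \<longrightarrow> \<omega> (1 - j) = 0 then of_nat (p ^ nat (b - a)) else 0)"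
proof (cases "\<forall>j. a < j \<and> j \<le> b \<longrightarrow> \<omega> (1 - j) = 0")
  case True
  then have "(\<Sum>x\<in>vbox a b. vchi p x \<omega>) = (\<Sum>x\<in>vbox a b. 1)"
    by (intro sum.cong refl vchi_eq_1) (metis vbox_eq_0 not_le)
  then show ?thesis unfolding if_P[OF True] by (simp add: card_vbox)
next
  case False
  then obtain j where j: "a < j" "j \<le> b" "\<omega> (1 - j) \<noteq> 0" by blast
  have u: "vunit j \<in> vbox a b" using j by (auto simp: vbox_def vunit_closed) (auto simp: vunit_def split: if_splits)
  have "(\<Sum>x\<in>vbox a b. vchi p x \<omega>) = (\<Sum>x\<in>vbox a b. vchi p (vadd p (vunit j) x) \<omega>)"
    by (rule sum.reindex_bij_betw[OF bij_betw_vadd_vbox[OF u], symmetric])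
  also have "\<dots> = vchi p (vunit j) \<omega> * (\<Sum>x\<in>vbox a b. vchi p x \<omega>)"
    using assms by (simp add: sum_distrib_left vchi_vadd_left vunit_closed vbox_vil)
  finally have "(\<Sum>x\<in>vbox a b. vchi p x \<omega>) * (1 - vchi p (vunit j) \<omega>) = 0"
    by (simp add: algebra_simps)
  then show ?thesis unfolding if_not_P[OF False] using vchi_vunit_neq_1[of \<omega> j] assms j by auto
qed

lemma vh_in_vH: "vh p k \<in> vH p"
  using p_ge_2 by (simp add: vh_eq_vdig vdig_in_vH)

lemma vH_vil: "h \<in> vH p \<Longrightarrow> h \<in> vil p"
  by (simp add: vH_def)

lemma vh_vil: "vh p k \<in> vil p"
  using vh_in_vH vH_vil by blast

lemma bij_betw_vh: "bij_betw (vh p) UNIV (vH p)"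
proof -
  have "inj (vh p)"
  proof (rule injI)
    fix k l assume "vh p k = vh p l"
    then have "vlam p (vdig p k) = vlam p (vdig p l)" using p_ge_2 by (simp add: vh_eq_vdig)
    then show "k = l" using p_ge_2 by (simp add: vlam_vdig)
  qed
  moreover have "range (vh p) = vH p"
    using vh_in_vH vH_vdig p_ge_2 by (auto simp: vh_eq_vdig) (metis rangeI)
  ultimately show ?thesis by (simp add: bij_betw_def)
qed

lemma vbox_subset_vH: "vbox a 0 \<subseteq> vH p"
  by (auto simp: vbox_def vH_def)

text \<open>A number below p^n has digits in n places only, so the image lies in the window.
  Surjectivity follows by counting, since both sides have p^n elements.\<close>

lemma bij_betw_vh_vbox: "bij_betw (vh p) {..<p ^ n} (vbox (- int n) 0)"
proof -
  have inj: "inj_on (vh p) {..<p ^ n}"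
    using bij_betw_vh by (auto simp: bij_betw_def intro: inj_on_subset)
  have "vh p ` {..<p ^ n} \<subseteq> vbox (- int n) 0"
  proof clarify
    fix k assume k: "k < p ^ n"
    have "- int n < j \<and> j \<le> 0" if "vdig p k j \<noteq> 0" for j
    proof -
      have j: "j \<le> 0" "k div p ^ nat (- j) \<noteq> 0" using that by (auto simp: vdig_def intro!: gr0I split: if_splits)
      have "\<not> n \<le> nat (- j)"
      proof
        assume "n \<le> nat (- j)"
        then have "p ^ n \<le> p ^ nat (- j)" using p_pos by (intro power_increasing) auto
        with j k show False by simp
      qed
      with j show ?thesis by simp
    qed
    then show "vh p k \<in> vbox (- int n) 0"
      using vh_vil[of k] p_ge_2 by (simp add: vbox_def vh_eq_vdig)
  qed
  moreover have "card (vh p ` {..<p ^ n}) = card (vbox (- int n) 0)"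
    using inj by (simp add: card_image card_vbox)
  ultimately show ?thesis
    using inj finite_vbox by (simp add: bij_betw_def card_subset_eq)
qed

section \<open>Haar measure and square integrable functions\<close>

lemma sets_haar: "sets (haar p) = sigma_sets (vil p) (vbasis p)"
  using is_haar_haar[OF p_ge_2] by (simp add: is_haar_def sigma_sets_vbasis)

lemma space_haar: "space (haar p) = vil p"
  using sets_haar vbasis_subset by (metis sets_eq_imp_space_eq sets_measure_of space_measure_of)

lemma openin_sets_haar: "openin (vtop p) S \<Longrightarrow> S \<in> sets (haar p)"
  using is_haar_haar[OF p_ge_2] by (auto simp: is_haar_def intro: sigma_sets.Basic)

lemma vcoset_sets: "x \<in> vil p \<Longrightarrow> vcoset p x l \<in> sets (haar p)"
  by (intro openin_sets_haar openin_vcoset)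

definition vtrunc :: "int \<Rightarrow> int \<Rightarrow> (int \<Rightarrow> nat) \<Rightarrow> (int \<Rightarrow> nat)" where
  "vtrunc a b x = (\<lambda>j. if a < j \<and> j \<le> b then x j else 0)"

lemma vtrunc_vbox:
  assumes "x \<in> vil p"
  shows "vtrunc a b x \<in> vbox a b"
proof -
  have "vtrunc a b x \<in> vil p"
    by (rule vil_boundedI[where a = a]) (use assms p_pos in \<open>auto simp: vtrunc_def vil_less\<close>)
  then show ?thesis by (auto simp: vbox_def vtrunc_def)
qed

lemma vU_decomp:
  assumes "l \<le> L"
  shows "vU p l = (\<Union>e\<in>vbox l L. vcoset p e L)"
proof (intro equalityI subsetI)
  fix y assume y: "y \<in> vU p l"
  then have "y \<in> vcoset p (vtrunc l L y) L"
    by (auto simp: vU_def vcoset_def vtrunc_def)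
  moreover have "vtrunc l L y \<in> vbox l L" using y by (simp add: vU_def vtrunc_vbox)
  ultimately show "y \<in> (\<Union>e\<in>vbox l L. vcoset p e L)" by blast
next
  fix y assume "y \<in> (\<Union>e\<in>vbox l L. vcoset p e L)"
  then obtain e where e: "e \<in> vbox l L" "y \<in> vcoset p e L" by blast
  have "y j = 0" if "j \<le> l" for j
    using e vbox_eq_0[of e l L j] that assms by (simp add: vcoset_def)
  then show "y \<in> vU p l" using e by (simp add: vcoset_def vU_def)
qed

lemma disjoint_vcosets: "disjoint_family_on (\<lambda>e. vcoset p e L) (vbox l L)"
  unfolding disjoint_family_on_def
proof (intro ballI impI)
  fix d e assume de: "d \<in> vbox l L" "e \<in> vbox l L" "d \<noteq> e"
  show "vcoset p d L \<inter> vcoset p e L = {}"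
  proof (rule ccontr)
    assume "vcoset p d L \<inter> vcoset p e L \<noteq> {}"
    then have "d j = e j" if "j \<le> L" for j using that by (fastforce simp: vcoset_def)
    moreover have "d j = e j" if "\<not> j \<le> L" for j using that de by (simp add: vbox_eq_0)
    ultimately show False using de by blast
  qed
qed

lemma emeasure_vcoset_nat:
  assumes "x \<in> vil p"
  shows "emeasure (haar p) (vcoset p x (int n)) = ennreal (real p powi (- int n))"
proof -
  have "ennreal (real (p ^ n)) * emeasure (haar p) (vcoset p x (int n)) = 1"
    using is_haar_vcoset[OF is_haar_haar[OF p_ge_2] assms, of n] by (simp add: ennreal_of_nat_eq_real_of_nat)
  then have "ennreal (1 / real (p ^ n)) * (ennreal (real (p ^ n)) * emeasure (haar p) (vcoset p x (int n)))
      = ennreal (1 / real (p ^ n))"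
    by simp
  moreover have "ennreal (1 / real (p ^ n)) * ennreal (real (p ^ n)) = 1"
    using p_pos by (subst ennreal_mult[symmetric]) auto
  ultimately have "emeasure (haar p) (vcoset p x (int n)) = ennreal (1 / real (p ^ n))"
    by (metis mult.assoc mult_1)
  then show ?thesis by (simp add: power_int_minus divide_inverse)
qed

text \<open>The invariance argument of \<open>is_haar_vcoset\<close> covers the levels
  \<open>l \<ge> 0\<close>. For \<open>l < 0\<close> the coset is a translate of
  \<open>vU p l\<close>, which splits into p^(-l) cosets of the unit neighbourhood.\<close>

lemma emeasure_vcoset:
  assumes "x \<in> vil p"
  shows "emeasure (haar p) (vcoset p x l) = ennreal (real p powi (- l))"
proof (cases "l \<ge> 0")
  case True
  then show ?thesis using emeasure_vcoset_nat[OF assms, of "nat l"] by simp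
next
  case False
  have z: "vzero \<in> vil p" using p_pos by (rule vzero_in_vil)
  have "vcoset p x l = vadd p x ` vcoset p vzero l"
    using image_vadd_vU[OF assms] by (simp add: vU_eq_vcoset)
  then have "emeasure (haar p) (vcoset p x l) = emeasure (haar p) (vU p l)"
    using is_haar_haar[OF p_ge_2] assms vcoset_sets[OF z] by (simp add: is_haar_def vU_eq_vcoset)
  also have "vU p l = (\<Union>e\<in>vbox l 0. vcoset p e 0)"
    using False by (intro vU_decomp) simp
  also have "emeasure (haar p) \<dots> = (\<Sum>e\<in>vbox l 0. emeasure (haar p) (vcoset p e 0))"
    by (rule sum_emeasure[symmetric]) (auto simp: vcoset_sets vbox_vil disjoint_vcosets finite_vbox)
  also have "\<dots> = (\<Sum>e\<in>vbox l 0. 1)"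
    by (rule sum.cong) (use emeasure_vcoset_nat[of _ 0] in \<open>auto simp: vbox_vil\<close>)
  also have "\<dots> = ennreal (real (p ^ nat (- l)))"
    by (simp add: card_vbox ennreal_of_nat_eq_real_of_nat)
  also have "real (p ^ nat (- l)) = real p powi (- l)"
    using False by (simp add: power_int_def)
  finally show ?thesis .
qed

lemma measure_vcoset: "x \<in> vil p \<Longrightarrow> measure (haar p) (vcoset p x l) = real p powi (- l)"
  by (simp add: measure_def emeasure_vcoset)

lemma integrable_indicator_vcoset:
  assumes "x \<in> vil p"
  shows "integrable (haar p) (\<lambda>y. indicator (vcoset p x l) y :: complex)"
proof -
  have "integrable (haar p) (indicator (vcoset p x l) :: _ \<Rightarrow> real)"
    using assms by (intro integrable_real_indicator) (simp_all add: vcoset_sets emeasure_vcoset)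
  then have "integrable (haar p) (\<lambda>y. complex_of_real (indicator (vcoset p x l) y))"
    by (rule integrable_of_real)
  then show ?thesis by (simp add: of_real_indicator)
qed

section \<open>Change of variables under dilation and translation\<close>

definition vmove :: "int \<Rightarrow> (int \<Rightarrow> nat) \<Rightarrow> (int \<Rightarrow> nat) \<Rightarrow> (int \<Rightarrow> nat)" where
  "vmove j h x = vsub p (dil j x) h"

lemma vmove_closed: "h \<in> vil p \<Longrightarrow> x \<in> vil p \<Longrightarrow> vmove j h x \<in> vil p"
  by (simp add: vmove_def vsub_closed dil_closed)

lemma vsub_coord_iff:
  assumes "x \<in> vil p" "h \<in> vil p" "z \<in> vil p"
  shows "vsub p x h i = z i \<longleftrightarrow> x i = vadd p z h i"
proof
  assume "vsub p x h i = z i"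
  then have "vadd p (vsub p x h) h i = vadd p z h i" by (simp add: vadd_def)
  then show "x i = vadd p z h i" using assms by (simp add: vadd_vsub_cancel)
next
  assume "x i = vadd p z h i"
  then have "vsub p x h i = vsub p (vadd p z h) h i" by (simp add: vsub_def vadd_def)
  then show "vsub p x h i = z i" using assms by (simp add: vadd_vsub_cancel)
qed

text \<open>The preimage of a coset is again a coset, with its level raised by \<open>j\<close>.
  Both the measurability of \<open>vmove\<close> and its Jacobian are read off from this.\<close>

lemma vmove_in_vcoset_iff:
  assumes "x \<in> vil p" "h \<in> vil p" "z \<in> vil p"
  shows "vmove j h x \<in> vcoset p z l \<longleftrightarrow> x \<in> vcoset p (dil (- j) (vadd p z h)) (l + j)"
proof -
  have "vmove j h x \<in> vcoset p z l \<longleftrightarrow> (\<forall>i\<le>l. dil j x i = vadd p z h i)"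
    using assms by (simp add: vcoset_def vmove_closed)
      (simp add: vmove_def vsub_coord_iff dil_closed)
  also have "\<dots> \<longleftrightarrow> (\<forall>i\<le>l + j. x i = vadd p z h (i - j))"
  proof safe
    fix i assume "\<forall>i\<le>l. dil j x i = vadd p z h i" "i \<le> l + j"
    then have "dil j x (i - j) = vadd p z h (i - j)" by simp
    then show "x i = vadd p z h (i - j)" by (simp add: dil_def)
  next
    fix i assume *: "\<forall>i\<le>l + j. x i = vadd p z h (i - j)" "i \<le> l"
    then have "x (i + j) = vadd p z h (i + j - j)" by (metis add_le_cancel_right)
    then show "dil j x i = vadd p z h i" by (simp add: dil_def)
  qed
  also have "\<dots> \<longleftrightarrow> x \<in> vcoset p (dil (- j) (vadd p z h)) (l + j)"
    using assms by (simp add: vcoset_def dil_def)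
  finally show ?thesis .
qed

lemma vmove_measurable:
  assumes "h \<in> vil p"
  shows "vmove j h \<in> measurable (haar p) (haar p)"
proof (rule measurable_sigma_sets[OF sets_haar vbasis_subset])
  show "vmove j h \<in> space (haar p) \<rightarrow> vil p" using assms by (auto simp: space_haar vmove_closed)
  fix b assume b: "b \<in> vbasis p"
  show "vmove j h -` b \<inter> space (haar p) \<in> sets (haar p)"
  proof (cases "b = {}")
    case False
    with b obtain z n where z: "z \<in> vil p" "b = vcoset p z (int n)" by (auto simp: vbasis_def)
    have "vmove j h -` b \<inter> space (haar p) = vcoset p (dil (- j) (vadd p z h)) (int n + j)"
      unfolding z(2) using vmove_in_vcoset_iff[OF _ assms z(1)] by (auto simp: space_haar) (auto simp: vcoset_def)
    then show ?thesis using z assms by (simp add: vcoset_sets dil_closed vadd_closed)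
  qed simp
qed

text \<open>The two measures agree on cosets, which determine a measure: raising the level by
  \<open>j\<close> costs a factor p^(-j), and the density restores it. Stated as an equality of
  measures, the change of variables serves integrals, integrability and null sets alike.\<close>

lemma density_distr_vmove:
  assumes h: "h \<in> vil p"
  shows "density (distr (haar p) (haar p) (vmove j h)) (\<lambda>_. ennreal (real p powi j)) = haar p"
proof (rule measure_eq_on_vcosets[where p = p])
  fix x n assume x: "x \<in> vil p"
  show "of_nat (p ^ n) * emeasure (haar p) (vcoset p x (int n)) = 1"
    using x by (rule is_haar_vcoset[OF is_haar_haar[OF p_ge_2]])
  have "vmove j h -` vcoset p x (int n) \<inter> space (haar p) = vcoset p (dil (- j) (vadd p x h)) (int n + j)"
    using vmove_in_vcoset_iff[OF _ h x] by (auto simp: space_haar) (auto simp: vcoset_def)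
  then have "emeasure (density (distr (haar p) (haar p) (vmove j h)) (\<lambda>_. ennreal (real p powi j))) (vcoset p x (int n))
      = ennreal (real p powi j) * emeasure (haar p) (vcoset p (dil (- j) (vadd p x h)) (int n + j))"
    using x h by (simp add: emeasure_density_const vcoset_sets emeasure_distr vmove_measurable)
  also have "\<dots> = ennreal (real p powi j * real p powi (- (int n + j)))"
    using x h by (simp add: emeasure_vcoset dil_closed vadd_closed ennreal_mult)
  also have "real p powi j * real p powi (- (int n + j)) = real p powi (- int n)"
    using p_pos by (simp add: power_int_add[symmetric])
  also have "ennreal (real p powi (- int n)) = emeasure (haar p) (vcoset p x (int n))"
    using x by (rule emeasure_vcoset[symmetric])
  finally show "of_nat (p ^ n) * emeasure (density (distr (haar p) (haar p) (vmove j h)) (\<lambda>_. ennreal (real p powi j))) (vcoset p x (int n)) = 1"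
    using is_haar_vcoset[OF is_haar_haar[OF p_ge_2] x] by simp
qed (simp_all add: sets_haar)

lemma integral_vmove:
  fixes g :: "(int \<Rightarrow> nat) \<Rightarrow> 'a::{banach,second_countable_topology}"
  assumes h: "h \<in> vil p" and g: "g \<in> borel_measurable (haar p)"
  shows "(\<integral>x. g (vmove j h x) \<partial>haar p) = (real p powi (- j)) *\<^sub>R (\<integral>x. g x \<partial>haar p)"
proof -
  have "(\<integral>x. g x \<partial>haar p) = (\<integral>x. g x \<partial>density (distr (haar p) (haar p) (vmove j h)) (\<lambda>_. ennreal (real p powi j)))"
    using h by (simp add: density_distr_vmove)
  also have "\<dots> = (\<integral>x. (real p powi j) *\<^sub>R g x \<partial>distr (haar p) (haar p) (vmove j h))"
    using g p_pos by (intro integral_density) auto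
  also have "\<dots> = (\<integral>x. (real p powi j) *\<^sub>R g (vmove j h x) \<partial>haar p)"
    using g vmove_measurable[OF h] by (intro integral_distr) auto
  finally show ?thesis using p_pos by (simp add: power_int_minus)
qed

lemma integrable_vmove_iff:
  fixes g :: "(int \<Rightarrow> nat) \<Rightarrow> 'a::{banach,second_countable_topology}"
  assumes h: "h \<in> vil p" and g: "g \<in> borel_measurable (haar p)"
  shows "integrable (haar p) (\<lambda>x. g (vmove j h x)) \<longleftrightarrow> integrable (haar p) g"
proof -
  have "integrable (haar p) g \<longleftrightarrow> integrable (density (distr (haar p) (haar p) (vmove j h)) (\<lambda>_. ennreal (real p powi j))) g"
    using h by (simp add: density_distr_vmove)
  also have "\<dots> \<longleftrightarrow> integrable (distr (haar p) (haar p) (vmove j h)) (\<lambda>x. (real p powi j) *\<^sub>R g x)"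
    using g p_pos by (intro integrable_density) auto
  also have "\<dots> \<longleftrightarrow> integrable (haar p) (\<lambda>x. (real p powi j) *\<^sub>R g (vmove j h x))"
    using g vmove_measurable[OF h] by (intro integrable_distr_eq) auto
  also have "\<dots> \<longleftrightarrow> integrable (haar p) (\<lambda>x. g (vmove j h x))"
  proof
    assume *: "integrable (haar p) (\<lambda>x. (real p powi j) *\<^sub>R g (vmove j h x))"
    have "integrable (haar p) (\<lambda>x. inverse (real p powi j) *\<^sub>R ((real p powi j) *\<^sub>R g (vmove j h x)))"
      by (rule integrable_scaleR_right) (rule *)
    then show "integrable (haar p) (\<lambda>x. g (vmove j h x))" using p_pos by simp
  qed (intro integrable_scaleR_right)
  finally show ?thesis by simp
qed

lemma AE_vmove:
  assumes h: "h \<in> vil p" and P: "AE x in haar p. P x"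
  shows "AE x in haar p. P (vmove j h x)"
proof -
  have "AE x in density (distr (haar p) (haar p) (vmove j h)) (\<lambda>_. ennreal (real p powi j)). P x"
    unfolding density_distr_vmove[OF h] by (rule P)
  then have "AE x in distr (haar p) (haar p) (vmove j h). P x"
    using p_pos by (subst (asm) AE_density) auto
  then show ?thesis by (rule AE_distrD[OF vmove_measurable[OF h]])
qed

section \<open>Inner product and norm of square integrable functions\<close>

lemma vL2_measurable: "f \<in> vL2 p \<Longrightarrow> f \<in> borel_measurable (haar p)"
  by (simp add: vL2_def)

lemma vL2_integrable: "f \<in> vL2 p \<Longrightarrow> integrable (haar p) (\<lambda>x. (cmod (f x))\<^sup>2)"
  by (simp add: vL2_def)

lemma vL2_I:
  assumes "f \<in> borel_measurable (haar p)" "integrable (haar p) g" "\<And>x. x \<in> vil p \<Longrightarrow> (cmod (f x))\<^sup>2 \<le> g x"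
  shows "f \<in> vL2 p"
proof -
  have "integrable (haar p) (\<lambda>x. (cmod (f x))\<^sup>2)"
    using assms(2)
  proof (rule Bochner_Integration.integrable_bound)
    show "(\<lambda>x. (cmod (f x))\<^sup>2) \<in> borel_measurable (haar p)" using assms(1) by measurable
    show "AE x in haar p. norm ((cmod (f x))\<^sup>2) \<le> norm (g x)"
      using assms(3) by (intro AE_I2) (auto simp: space_haar intro: order_trans[OF _ abs_ge_self])
  qed
  then show ?thesis using assms(1) by (simp add: vL2_def)
qed

lemma norm_add_sq_le: "(cmod (a + b))\<^sup>2 \<le> 2 * (cmod a)\<^sup>2 + 2 * (cmod b)\<^sup>2"
proof -
  have "(cmod (a + b))\<^sup>2 \<le> (cmod a + cmod b)\<^sup>2" by (intro power_mono norm_triangle_ineq) simp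
  also have "\<dots> \<le> 2 * (cmod a)\<^sup>2 + 2 * (cmod b)\<^sup>2"
    using zero_le_power2[of "cmod a - cmod b"] by (simp add: power2_sum power2_diff)
  finally show ?thesis .
qed

lemma vL2_add:
  assumes "f \<in> vL2 p" "g \<in> vL2 p"
  shows "(\<lambda>x. f x + g x) \<in> vL2 p"
proof (rule vL2_I)
  show "(\<lambda>x. f x + g x) \<in> borel_measurable (haar p)"
    using assms by (intro borel_measurable_add vL2_measurable)
  show "integrable (haar p) (\<lambda>x. 2 * (cmod (f x))\<^sup>2 + 2 * (cmod (g x))\<^sup>2)"
    using assms by (simp add: vL2_integrable)
qed (rule norm_add_sq_le)

lemma vL2_cmult:
  assumes "f \<in> vL2 p"
  shows "(\<lambda>x. c * f x) \<in> vL2 p"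
proof (rule vL2_I)
  show "(\<lambda>x. c * f x) \<in> borel_measurable (haar p)"
    using vL2_measurable[OF assms] by measurable
  show "integrable (haar p) (\<lambda>x. (cmod c)\<^sup>2 * (cmod (f x))\<^sup>2)"
    using assms by (simp add: vL2_integrable)
qed (simp add: norm_mult power_mult_distrib)

lemma vL2_diff: "f \<in> vL2 p \<Longrightarrow> g \<in> vL2 p \<Longrightarrow> (\<lambda>x. f x - g x) \<in> vL2 p"
  using vL2_add[OF _ vL2_cmult[of g "-1"]] by simp

lemma vL2_zero: "(\<lambda>x. 0) \<in> vL2 p"
  by (simp add: vL2_def)

lemma vL2_sum: "(\<And>i. i \<in> I \<Longrightarrow> f i \<in> vL2 p) \<Longrightarrow> (\<lambda>x. \<Sum>i\<in>I. f i x) \<in> vL2 p"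
  by (induction I rule: infinite_finite_induct) (auto simp: vL2_zero intro!: vL2_add)

lemma vL2_mult_bounded:
  assumes "f \<in> vL2 p" "g \<in> borel_measurable (haar p)" "\<And>x. x \<in> vil p \<Longrightarrow> cmod (g x) \<le> 1"
  shows "(\<lambda>x. g x * f x) \<in> vL2 p"
proof (rule vL2_I)
  show "(\<lambda>x. g x * f x) \<in> borel_measurable (haar p)"
    using vL2_measurable[OF assms(1)] assms(2) by measurable
  show "integrable (haar p) (\<lambda>x. (cmod (f x))\<^sup>2)" using assms(1) by (rule vL2_integrable)
  fix x assume "x \<in> vil p"
  then show "(cmod (g x * f x))\<^sup>2 \<le> (cmod (f x))\<^sup>2"
    using assms(3) by (intro power_mono) (auto simp: norm_mult mult_left_le_one_le)
qed

lemma integrable_vinner: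
  assumes "f \<in> vL2 p" "g \<in> vL2 p"
  shows "integrable (haar p) (\<lambda>x. f x * cnj (g x))"
proof (rule Bochner_Integration.integrable_bound)
  show "integrable (haar p) (\<lambda>x. (cmod (f x))\<^sup>2 + (cmod (g x))\<^sup>2)"
    using assms by (simp add: vL2_integrable)
  show "(\<lambda>x. f x * cnj (g x)) \<in> borel_measurable (haar p)"
    using assms[THEN vL2_measurable] by measurable
  show "AE x in haar p. norm (f x * cnj (g x)) \<le> norm ((cmod (f x))\<^sup>2 + (cmod (g x))\<^sup>2)"
  proof (intro AE_I2)
    fix x
    have "0 \<le> cmod (f x) * cmod (g x)" by simp
    moreover have "2 * (cmod (f x) * cmod (g x)) \<le> (cmod (f x))\<^sup>2 + (cmod (g x))\<^sup>2"
      using zero_le_power2[of "cmod (f x) - cmod (g x)"] by (simp add: power2_diff)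
    ultimately have "cmod (f x) * cmod (g x) \<le> (cmod (f x))\<^sup>2 + (cmod (g x))\<^sup>2" by linarith
    then show "norm (f x * cnj (g x)) \<le> norm ((cmod (f x))\<^sup>2 + (cmod (g x))\<^sup>2)"
      by (simp add: norm_mult)
  qed
qed

lemma vinner_diff_left:
  "f \<in> vL2 p \<Longrightarrow> g \<in> vL2 p \<Longrightarrow> u \<in> vL2 p \<Longrightarrow> vinner p (\<lambda>x. f x - g x) u = vinner p f u - vinner p g u"
  by (simp add: vinner_def left_diff_distrib integrable_vinner)

lemma vinner_cmult_right: "vinner p f (\<lambda>x. c * g x) = cnj c * vinner p f g"
  by (simp add: vinner_def mult.left_commute)

lemma vinner_cnj: "cnj (vinner p f g) = vinner p g f"
  by (simp add: vinner_def Bochner_Integration.integral_cnj[symmetric] mult.commute)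

lemma vinner_sum_right:
  assumes "f \<in> vL2 p" "\<And>i. i \<in> I \<Longrightarrow> g i \<in> vL2 p"
  shows "vinner p f (\<lambda>x. \<Sum>i\<in>I. c i * g i x) = (\<Sum>i\<in>I. cnj (c i) * vinner p f (g i))"
proof -
  have "vinner p f (\<lambda>x. \<Sum>i\<in>I. c i * g i x) = (\<integral>x. (\<Sum>i\<in>I. f x * cnj (c i * g i x)) \<partial>haar p)"
    by (simp add: vinner_def sum_distrib_left)
  also have "\<dots> = (\<Sum>i\<in>I. \<integral>x. f x * cnj (c i * g i x) \<partial>haar p)"
    using assms by (intro Bochner_Integration.integral_sum integrable_vinner vL2_cmult) auto
  also have "\<dots> = (\<Sum>i\<in>I. cnj (c i) * vinner p f (g i))"
    using vinner_cmult_right by (simp add: vinner_def)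
  finally show ?thesis .
qed

lemma vnorm_sq: "(vnorm p f)\<^sup>2 = (\<integral>x. (cmod (f x))\<^sup>2 \<partial>haar p)"
  by (simp add: vnorm_def integral_nonneg_AE)

lemma vnorm_nonneg: "vnorm p f \<ge> 0"
  by (simp add: vnorm_def integral_nonneg_AE)

lemma vinner_self: "vinner p f f = of_real ((vnorm p f)\<^sup>2)"
proof -
  have "f x * cnj (f x) = of_real ((cmod (f x))\<^sup>2)" for x by (rule complex_norm_square[symmetric])
  then show ?thesis unfolding vinner_def vnorm_sq by (simp only: integral_complex_of_real)
qed

lemma vnorm_diff_sq:
  assumes "f \<in> vL2 p" "g \<in> vL2 p"
  shows "(vnorm p (\<lambda>x. f x - g x))\<^sup>2 = (vnorm p f)\<^sup>2 + (vnorm p g)\<^sup>2 - 2 * Re (vinner p f g)"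
proof -
  have fg: "(\<lambda>x. f x - g x) \<in> vL2 p" using assms by (rule vL2_diff)
  have "complex_of_real ((vnorm p (\<lambda>x. f x - g x))\<^sup>2) = vinner p f (\<lambda>x. f x - g x) - vinner p g (\<lambda>x. f x - g x)"
    by (simp only: vinner_self[symmetric] vinner_diff_left[OF assms fg])
  also have "\<dots> = cnj (vinner p (\<lambda>x. f x - g x) f) - cnj (vinner p (\<lambda>x. f x - g x) g)"
    by (simp add: vinner_cnj)
  also have "\<dots> = cnj (vinner p f f - vinner p g f) - cnj (vinner p f g - vinner p g g)"
    using assms by (simp only: vinner_diff_left)
  also have "\<dots> = of_real ((vnorm p f)\<^sup>2) + of_real ((vnorm p g)\<^sup>2) - (vinner p f g + cnj (vinner p f g))"
    by (simp add: vinner_cnj vinner_self)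
  also have "vinner p f g + cnj (vinner p f g) = of_real (2 * Re (vinner p f g))"
    by (rule complex_add_cnj)
  finally show ?thesis by (simp only: of_real_add[symmetric] of_real_diff[symmetric] of_real_eq_iff)
qed

lemma vnorm_minus: "vnorm p (\<lambda>x. - f x) = vnorm p f"
  by (simp add: vnorm_def)

text \<open>The square distance from \<open>f\<close> to its projection \<open>s\<close> onto the
  span is nonnegative. Admitting an arbitrary common square norm \<open>q\<close> spares the
  normalisation both of truncated characters and of the single vector in the Cauchy-Schwarz
  inequality.\<close>

lemma bessel:
  assumes "finite I" "f \<in> vL2 p" "\<And>i. i \<in> I \<Longrightarrow> g i \<in> vL2 p" "q > 0"
    and orth: "\<And>i k. i \<in> I \<Longrightarrow> k \<in> I \<Longrightarrow> vinner p (g i) (g k) = (if i = k then of_real q else 0)"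
  shows "(\<Sum>i\<in>I. (cmod (vinner p f (g i)))\<^sup>2) \<le> q * (vnorm p f)\<^sup>2"
proof -
  define a where "a i = vinner p f (g i) / of_real q" for i
  define s where "s = (\<lambda>x. \<Sum>i\<in>I. a i * g i x)"
  define B where "B = (\<Sum>i\<in>I. (cmod (vinner p f (g i)))\<^sup>2)"
  have s: "s \<in> vL2 p" unfolding s_def using assms by (intro vL2_sum vL2_cmult)
  have a1: "cnj (a i) * vinner p f (g i) = of_real ((cmod (vinner p f (g i)))\<^sup>2 / q)" for i
  proof -
    have "cnj (a i) * vinner p f (g i) = (vinner p f (g i) * cnj (vinner p f (g i))) / of_real q"
      by (simp add: a_def)
    then show ?thesis by (simp only: complex_norm_square of_real_divide)
  qed
  have a2: "cnj (a i) * (a i * of_real q) = of_real ((cmod (vinner p f (g i)))\<^sup>2 / q)" for i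
    using a1[of i] \<open>q > 0\<close> by (simp add: a_def)
  have "vinner p f s = (\<Sum>i\<in>I. cnj (a i) * vinner p f (g i))"
    unfolding s_def using assms by (simp add: vinner_sum_right)
  also have "\<dots> = of_real (B / q)"
    by (simp only: a1 B_def sum_divide_distrib of_real_sum)
  finally have fs: "vinner p f s = of_real (B / q)" .
  have gs: "vinner p (g k) s = cnj (a k) * of_real q" if "k \<in> I" for k
  proof -
    have "vinner p (g k) s = (\<Sum>i\<in>I. cnj (a i) * vinner p (g k) (g i))"
      unfolding s_def using assms that by (simp add: vinner_sum_right)
    also have "\<dots> = (\<Sum>i\<in>I. if k = i then cnj (a i) * of_real q else 0)"
      using that by (intro sum.cong) (auto simp: orth)
    also have "\<dots> = cnj (a k) * of_real q" using that \<open>finite I\<close> by simp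
    finally show ?thesis .
  qed
  have "vinner p s s = (\<Sum>i\<in>I. cnj (a i) * vinner p s (g i))"
    using vinner_sum_right[OF s assms(3), where I = I and c = a] by (simp add: s_def)
  also have "\<dots> = (\<Sum>i\<in>I. cnj (a i) * (a i * of_real q))"
  proof (rule sum.cong[OF refl])
    fix i assume "i \<in> I"
    then have "vinner p s (g i) = a i * of_real q"
      using arg_cong[OF gs[of i], of cnj] by (simp add: vinner_cnj)
    then show "cnj (a i) * vinner p s (g i) = cnj (a i) * (a i * of_real q)" by simp
  qed
  also have "\<dots> = (\<Sum>i\<in>I. of_real ((cmod (vinner p f (g i)))\<^sup>2 / q))"
    by (simp only: a2)
  also have "\<dots> = of_real (B / q)" by (simp only: B_def sum_divide_distrib of_real_sum)
  finally have "(vnorm p s)\<^sup>2 = B / q" by (simp add: vinner_self del: of_real_power of_real_divide)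
  then have "0 \<le> (vnorm p f)\<^sup>2 - B / q"
    using vnorm_diff_sq[OF assms(2) s] zero_le_power2[of "vnorm p (\<lambda>x. f x - s x)"] by (simp add: fs del: of_real_divide)
  then show ?thesis using \<open>q > 0\<close> by (simp add: B_def field_simps)
qed

lemma vinner_cong_AE:
  assumes "AE x in haar p. f x = f' x" "AE x in haar p. g x = g' x"
    "f \<in> borel_measurable (haar p)" "f' \<in> borel_measurable (haar p)"
    "g \<in> borel_measurable (haar p)" "g' \<in> borel_measurable (haar p)"
  shows "vinner p f g = vinner p f' g'"
  unfolding vinner_def using assms by (intro integral_cong_AE) (auto, measurable)

lemma vnorm_eq_0:
  assumes "f \<in> vL2 p" "vnorm p f = 0"
  shows "AE x in haar p. f x = 0"
proof -
  have "(\<integral>x. (cmod (f x))\<^sup>2 \<partial>haar p) = 0" using assms vnorm_sq[of f] by simp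
  then have "AE x in haar p. (cmod (f x))\<^sup>2 = 0"
    using vL2_integrable[OF assms(1)] by (subst (asm) integral_nonneg_eq_0_iff_AE) auto
  then show ?thesis by simp
qed

text \<open>Bessel's inequality for the one-element family \<open>g\<close>. A function of norm zero
  vanishes almost everywhere and is treated apart, because \<open>bessel\<close> asks for
  \<open>q > 0\<close>.\<close>

lemma cauchy_schwarz:
  assumes "f \<in> vL2 p" "g \<in> vL2 p"
  shows "cmod (vinner p f g) \<le> vnorm p f * vnorm p g"
proof (cases "vnorm p g = 0")
  case True
  have "AE x in haar p. f x * cnj (g x) = 0"
    by (rule AE_mp[OF vnorm_eq_0[OF assms(2) True]]) simp
  then have "vinner p f g = 0"
    unfolding vinner_def by (rule integral_eq_zero_AE)
  with True show ?thesis by simp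
next
  case False
  then have "(cmod (vinner p f g))\<^sup>2 \<le> (vnorm p g)\<^sup>2 * (vnorm p f)\<^sup>2"
    using bessel[of "{()}" f "\<lambda>_. g" "(vnorm p g)\<^sup>2"] assms by (simp add: vinner_self)
  then have "(cmod (vinner p f g))\<^sup>2 \<le> (vnorm p f * vnorm p g)\<^sup>2"
    by (simp add: power_mult_distrib mult.commute)
  then show ?thesis by (rule power2_le_imp_le) (simp add: vnorm_nonneg)
qed

lemma vnorm_diff_triangle:
  assumes "f \<in> vL2 p" "g \<in> vL2 p"
  shows "vnorm p (\<lambda>x. f x - g x) \<le> vnorm p f + vnorm p g"
proof (rule power2_le_imp_le)
  have "- Re (vinner p f g) \<le> vnorm p f * vnorm p g"
    using cauchy_schwarz[OF assms] abs_Re_le_cmod[of "vinner p f g"] by linarith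
  then show "(vnorm p (\<lambda>x. f x - g x))\<^sup>2 \<le> (vnorm p f + vnorm p g)\<^sup>2"
    using vnorm_diff_sq[OF assms] by (simp add: power2_sum)
qed (simp add: vnorm_nonneg)

lemma vnorm_triangle:
  assumes "f \<in> vL2 p" "g \<in> vL2 p"
  shows "vnorm p (\<lambda>x. f x + g x) \<le> vnorm p f + vnorm p g"
proof -
  have "(\<lambda>x. - g x) \<in> vL2 p" using vL2_cmult[OF assms(2), of "-1"] by simp
  from vnorm_diff_triangle[OF assms(1) this] show ?thesis by (simp add: vnorm_minus)
qed

lemma vnorm_cmult: "vnorm p (\<lambda>x. c * f x) = cmod c * vnorm p f"
  by (simp add: vnorm_def norm_mult power_mult_distrib real_sqrt_mult)


section \<open>Step functions\<close>

definition vstep :: "int \<Rightarrow> int \<Rightarrow> ((int \<Rightarrow> nat) \<Rightarrow> complex) \<Rightarrow> bool" where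
  "vstep M L f \<longleftrightarrow> (\<forall>x\<in>vil p. x \<notin> vU p M \<longrightarrow> f x = 0) \<and>
    (\<forall>x\<in>vil p. \<forall>y\<in>vcoset p x L. f y = f x)"

lemma vstep_mono:
  assumes "vstep M L f" "M' \<le> M" "L \<le> L'"
  shows "vstep M' L' f"
  unfolding vstep_def
proof (intro conjI ballI impI)
  fix x assume "x \<in> vil p" "x \<notin> vU p M'"
  then show "f x = 0" using assms by (fastforce simp: vstep_def vU_def)
next
  fix x y assume "x \<in> vil p" "y \<in> vcoset p x L'"
  then show "f y = f x" using assms vcoset_antimono[of L L' p x] by (auto simp: vstep_def)
qed

lemma vstep_add:
  assumes "vstep M L f" "vstep M' L' g"
  shows "vstep (min M M') (max L L') (\<lambda>x. f x + g x)"
  using vstep_mono[OF assms(1), of "min M M'" "max L L'"] vstep_mono[OF assms(2), of "min M M'" "max L L'"]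
  by (simp add: vstep_def)

lemma vstep_cmult: "vstep M L f \<Longrightarrow> vstep M L (\<lambda>x. c * f x)"
  by (simp add: vstep_def)

lemma in_vcoset_self: "x \<in> vil p \<Longrightarrow> x \<in> vcoset p x L"
  by (simp add: vcoset_def)

lemma vstep_repr:
  assumes "vstep M L f" "M \<le> L" "x \<in> vil p"
  shows "f x = (\<Sum>e\<in>vbox M L. f e * indicator (vcoset p e L) x)"
proof (cases "x \<in> vU p M")
  case True
  then obtain e where e: "e \<in> vbox M L" "x \<in> vcoset p e L" using vU_decomp[OF assms(2)] by blast
  have "indicator (vcoset p d L) x = (if d = e then 1 else 0 :: complex)" if "d \<in> vbox M L" for d
  proof (cases "d = e")
    case False
    with disjoint_vcosets[of L M] that e have "vcoset p d L \<inter> vcoset p e L = {}"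
      by (auto simp: disjoint_family_on_def)
    with e False show ?thesis by (auto simp: indicator_def)
  qed (use e in simp)
  then have "(\<Sum>d\<in>vbox M L. f d * indicator (vcoset p d L) x) = (\<Sum>d\<in>vbox M L. if d = e then f d else 0)"
    by (intro sum.cong) auto
  also have "\<dots> = f e" using e finite_vbox by simp
  also have "f e = f x" using e assms(1) vbox_vil unfolding vstep_def by metis
  finally show ?thesis by simp
next
  case False
  then have "f x = 0" using assms by (simp add: vstep_def)
  moreover have "x \<notin> vcoset p e L" if "e \<in> vbox M L" for e
    using False that vU_decomp[OF assms(2)] by blast
  ultimately show ?thesis by (auto intro!: sum.neutral[symmetric])
qed

text \<open>The preimage of any set whatsoever is a union of cosets of the fixed level
  \<open>L\<close>, hence open.\<close>

lemma locally_constant_measurable: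
  assumes "\<And>x y. x \<in> vil p \<Longrightarrow> y \<in> vcoset p x L \<Longrightarrow> f y = f x"
  shows "f \<in> borel_measurable (haar p)"
proof (rule measurableI)
  fix A
  have "openin (vtop p) (f -` A \<inter> space (haar p))"
    unfolding openin_vtop_iff
  proof (intro conjI ballI exI[of _ L] subsetI)
    fix x y assume x: "x \<in> f -` A \<inter> space (haar p)" and y: "y \<in> vcoset p x L"
    then have "f y = f x" using assms[of x y] by (simp add: space_haar)
    with x y show "y \<in> f -` A \<inter> space (haar p)" by (simp add: space_haar vcoset_def)
  qed (simp add: space_haar)
  then show "f -` A \<inter> space (haar p) \<in> sets (haar p)" by (rule openin_sets_haar)
qed simp

lemma vstep_measurable: "vstep M L f \<Longrightarrow> f \<in> borel_measurable (haar p)"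
  by (rule locally_constant_measurable[where L = L]) (auto simp: vstep_def)

lemma vstep_integral:
  assumes "vstep M L f" "M \<le> L"
  shows "integrable (haar p) f"
    and "(\<integral>x. f x \<partial>haar p) = (\<Sum>e\<in>vbox M L. f e) * of_real (real p powi (- L))"
proof -
  let ?g = "\<lambda>x. \<Sum>e\<in>vbox M L. f e * indicator (vcoset p e L) x"
  have i: "integrable (haar p) (\<lambda>x. f e * indicator (vcoset p e L) x)" if "e \<in> vbox M L" for e
    using that by (intro integrable_mult_right integrable_indicator_vcoset) (simp add: vbox_vil)
  then have "integrable (haar p) ?g" by (intro Bochner_Integration.integrable_sum)
  then show "integrable (haar p) f"
    by (rule iffD2[OF Bochner_Integration.integrable_cong, rotated -1])
      (use vstep_repr[OF assms] in \<open>auto simp: space_haar\<close>)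
  have "(\<integral>x. f x \<partial>haar p) = (\<integral>x. ?g x \<partial>haar p)"
    using vstep_repr[OF assms] by (intro Bochner_Integration.integral_cong) (auto simp: space_haar)
  also have "\<dots> = (\<Sum>e\<in>vbox M L. \<integral>x. f e * indicator (vcoset p e L) x \<partial>haar p)"
    using i by (intro Bochner_Integration.integral_sum)
  also have "\<dots> = (\<Sum>e\<in>vbox M L. f e * of_real (real p powi (- L)))"
  proof (rule sum.cong[OF refl])
    fix e assume e: "e \<in> vbox M L"
    have "vcoset p e L \<inter> space (haar p) = vcoset p e L" by (auto simp: vcoset_def space_haar)
    then have "(\<integral>x. complex_of_real (indicator (vcoset p e L) x) \<partial>haar p) = of_real (real p powi (- L))"
      using e by (subst integral_complex_of_real) (simp add: measure_vcoset vbox_vil)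
    then show "(\<integral>x. f e * indicator (vcoset p e L) x \<partial>haar p) = f e * of_real (real p powi (- L))"
      by (simp add: of_real_indicator)
  qed
  finally show "(\<integral>x. f x \<partial>haar p) = (\<Sum>e\<in>vbox M L. f e) * of_real (real p powi (- L))"
    by (simp add: sum_distrib_right)
qed

lemma vstep_norm_sq: "vstep M L f \<Longrightarrow> vstep M L (\<lambda>x. of_real ((cmod (f x))\<^sup>2))"
  by (simp add: vstep_def)

lemma vstep_vL2:
  assumes "vstep M L f"
  shows "f \<in> vL2 p"
proof -
  have "vstep (min M L) L f" using assms by (rule vstep_mono) auto
  then have "integrable (haar p) (\<lambda>x. complex_of_real ((cmod (f x))\<^sup>2))"
    by (intro vstep_integral(1)[OF vstep_norm_sq]) auto
  then have "integrable (haar p) (\<lambda>x. Re (complex_of_real ((cmod (f x))\<^sup>2)))" by (rule integrable_Re)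
  then show ?thesis using vstep_measurable[OF assms] by (simp add: vL2_def)
qed

lemma vstep_vnorm:
  assumes "vstep M L f" "M \<le> L"
  shows "(vnorm p f)\<^sup>2 = (\<Sum>e\<in>vbox M L. (cmod (f e))\<^sup>2) * real p powi (- L)"
proof -
  have "complex_of_real ((vnorm p f)\<^sup>2) = (\<integral>x. complex_of_real ((cmod (f x))\<^sup>2) \<partial>haar p)"
    unfolding vnorm_sq by (rule integral_complex_of_real[symmetric])
  also have "\<dots> = (\<Sum>e\<in>vbox M L. complex_of_real ((cmod (f e))\<^sup>2)) * of_real (real p powi (- L))"
    using vstep_integral(2)[OF vstep_norm_sq] assms by blast
  finally show ?thesis by (simp only: of_real_sum[symmetric] of_real_mult[symmetric] of_real_eq_iff)
qed

lemma vil_eventually_vU: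
  assumes "x \<in> vil p"
  shows "\<exists>n0. \<forall>n\<ge>n0. x \<in> vU p (- int n)"
proof -
  have "finite {j. j < 0 \<and> x j \<noteq> 0}" using assms by (simp add: vil_def)
  then have "bdd_below {j. j < 0 \<and> x j \<noteq> 0}" by (rule bdd_below_finite)
  then obtain m where m: "\<And>j. j < 0 \<Longrightarrow> x j \<noteq> 0 \<Longrightarrow> m \<le> j" by (auto simp: bdd_below_def)
  have "x j = 0" if "n \<ge> nat (1 - m) + 1" "j \<le> - int n" for n j
    using m[of j] that by (cases "x j = 0") auto
  then have "\<forall>n\<ge>nat (1 - m) + 1. x \<in> vU p (- int n)" using assms by (auto simp: vU_def)
  then show ?thesis by blast
qed

text \<open>The limit inherits the bound by \<open>w\<close>, so the difference is at most twice as
  large and four times the square of \<open>w\<close> dominates.\<close>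

lemma vnorm_dominated_convergence:
  assumes "f \<in> vL2 p" "w \<in> vL2 p" "\<And>i. s i \<in> borel_measurable (haar p)"
    and lim: "\<And>x. x \<in> vil p \<Longrightarrow> (\<lambda>i. s i x) \<longlonglongrightarrow> f x"
    and bound: "\<And>i x. x \<in> vil p \<Longrightarrow> cmod (s i x) \<le> cmod (w x)"
  shows "(\<lambda>i. vnorm p (\<lambda>x. f x - s i x)) \<longlonglongrightarrow> 0"
proof -
  have [measurable]: "f \<in> borel_measurable (haar p)" "w \<in> borel_measurable (haar p)" "\<And>i. s i \<in> borel_measurable (haar p)"
    using assms by (auto intro: vL2_measurable)
  have fw: "cmod (f x) \<le> cmod (w x)" if "x \<in> vil p" for x
    using tendsto_norm[OF lim[OF that]] bound[OF that] by (intro tendsto_upperbound) auto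
  have "(\<lambda>i. \<integral>x. (cmod (f x - s i x))\<^sup>2 \<partial>haar p) \<longlonglongrightarrow> (\<integral>x. 0 \<partial>haar p)"
  proof (rule integral_dominated_convergence)
    show "integrable (haar p) (\<lambda>x. 4 * (cmod (w x))\<^sup>2)"
      using assms by (simp add: vL2_integrable)
    show "AE x in haar p. (\<lambda>i. (cmod (f x - s i x))\<^sup>2) \<longlonglongrightarrow> 0"
    proof (intro AE_I2)
      fix x assume "x \<in> space (haar p)"
      then have "(\<lambda>i. (cmod (f x - s i x))\<^sup>2) \<longlonglongrightarrow> (cmod (f x - f x))\<^sup>2"
        by (intro tendsto_intros lim) (simp add: space_haar)
      then show "(\<lambda>i. (cmod (f x - s i x))\<^sup>2) \<longlonglongrightarrow> 0" by simp
    qed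
    show "AE x in haar p. norm ((cmod (f x - s i x))\<^sup>2) \<le> 4 * (cmod (w x))\<^sup>2" for i
    proof (intro AE_I2)
      fix x assume "x \<in> space (haar p)"
      then have "cmod (f x - s i x) \<le> 2 * cmod (w x)"
        using norm_triangle_ineq4[of "f x" "s i x"] fw[of x] bound[of x i] by (simp add: space_haar)
      then have "(cmod (f x - s i x))\<^sup>2 \<le> (2 * cmod (w x))\<^sup>2" by (intro power_mono) auto
      then show "norm ((cmod (f x - s i x))\<^sup>2) \<le> 4 * (cmod (w x))\<^sup>2" by (simp add: power_mult_distrib)
    qed
  qed measurable
  then have "(\<lambda>i. sqrt (\<integral>x. (cmod (f x - s i x))\<^sup>2 \<partial>haar p)) \<longlonglongrightarrow> sqrt 0"
    by (intro tendsto_real_sqrt) simp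
  then show ?thesis by (simp add: vnorm_def)
qed

section \<open>Density of step functions\<close>

definition vapprox :: "((int \<Rightarrow> nat) \<Rightarrow> complex) \<Rightarrow> bool" where
  "vapprox f \<longleftrightarrow> f \<in> vL2 p \<and> (\<forall>\<epsilon>>0. \<exists>M L s. vstep M L s \<and> vnorm p (\<lambda>x. f x - s x) < \<epsilon>)"

lemma vapprox_step: "vstep M L f \<Longrightarrow> vapprox f"
  unfolding vapprox_def by (intro conjI allI impI vstep_vL2 exI[of _ M] exI[of _ L] exI[of _ f]) (auto simp: vnorm_def)

lemma vapprox_add:
  assumes "vapprox f" "vapprox g"
  shows "vapprox (\<lambda>x. f x + g x)"
  unfolding vapprox_def
proof (intro conjI allI impI)
  show "(\<lambda>x. f x + g x) \<in> vL2 p" using assms by (auto simp: vapprox_def intro: vL2_add)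
  fix \<epsilon> :: real assume "\<epsilon> > 0"
  then obtain M L s M' L' t where s: "vstep M L s" "vnorm p (\<lambda>x. f x - s x) < \<epsilon> / 2"
    and t: "vstep M' L' t" "vnorm p (\<lambda>x. g x - t x) < \<epsilon> / 2"
    using assms unfolding vapprox_def by (meson half_gt_zero)
  have "vnorm p (\<lambda>x. (f x - s x) + (g x - t x)) \<le> vnorm p (\<lambda>x. f x - s x) + vnorm p (\<lambda>x. g x - t x)"
    using assms s t by (intro vnorm_triangle vL2_diff) (auto simp: vapprox_def intro: vstep_vL2)
  also have "\<dots> < \<epsilon>" using s t by simp
  finally have "vnorm p (\<lambda>x. f x + g x - (s x + t x)) < \<epsilon>" by (simp add: algebra_simps)
  then show "\<exists>M L u. vstep M L u \<and> vnorm p (\<lambda>x. f x + g x - u x) < \<epsilon>"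
    using vstep_add[OF s(1) t(1)] by (intro exI conjI)
qed

lemma vapprox_cmult:
  assumes "vapprox f"
  shows "vapprox (\<lambda>x. c * f x)"
proof (cases "c = 0")
  case True
  have "vstep 0 0 (\<lambda>x. 0)" by (simp add: vstep_def)
  then show ?thesis using vapprox_step True by simp
next
  case False
  show ?thesis unfolding vapprox_def
  proof (intro conjI allI impI)
    show "(\<lambda>x. c * f x) \<in> vL2 p" using assms by (auto simp: vapprox_def intro: vL2_cmult)
    fix \<epsilon> :: real assume "\<epsilon> > 0"
    then have "\<epsilon> / cmod c > 0" using False by simp
    then obtain M L s where s: "vstep M L s" "vnorm p (\<lambda>x. f x - s x) < \<epsilon> / cmod c"
      using assms unfolding vapprox_def by blast
    have "vnorm p (\<lambda>x. c * f x - c * s x) = cmod c * vnorm p (\<lambda>x. f x - s x)"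
      unfolding vnorm_cmult[symmetric] by (simp add: right_diff_distrib)
    also have "\<dots> < \<epsilon>" using s(2) False by (simp add: field_simps)
    finally show "\<exists>M L u. vstep M L u \<and> vnorm p (\<lambda>x. c * f x - u x) < \<epsilon>"
      using vstep_cmult[OF s(1)] by (intro exI conjI)
  qed
qed

lemma vapprox_sum: "(\<And>i. i \<in> I \<Longrightarrow> vapprox (f i)) \<Longrightarrow> vapprox (\<lambda>x. \<Sum>i\<in>I. f i x)"
proof (induction I rule: infinite_finite_induct)
  case (insert i I)
  then show ?case by (simp add: vapprox_add)
qed (use vapprox_step[of 0 0 "\<lambda>x. 0"] in \<open>simp_all add: vstep_def\<close>)

lemma vapprox_limit:
  assumes f: "f \<in> vL2 p" and s: "\<And>i. vapprox (s i)" and lim: "(\<lambda>i. vnorm p (\<lambda>x. f x - s i x)) \<longlonglongrightarrow> 0"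
  shows "vapprox f"
  unfolding vapprox_def
proof (intro conjI allI impI f)
  fix \<epsilon> :: real assume "\<epsilon> > 0"
  then have "\<forall>\<^sub>F i in sequentially. vnorm p (\<lambda>x. f x - s i x) < \<epsilon> / 2"
    using lim by (intro order_tendstoD) auto
  then obtain i where i: "vnorm p (\<lambda>x. f x - s i x) < \<epsilon> / 2"
    by (auto simp: eventually_sequentially)
  obtain M L t where t: "vstep M L t" "vnorm p (\<lambda>x. s i x - t x) < \<epsilon> / 2"
    using s[of i] \<open>\<epsilon> > 0\<close> unfolding vapprox_def by (meson half_gt_zero)
  have "vnorm p (\<lambda>x. (f x - s i x) + (s i x - t x)) \<le> vnorm p (\<lambda>x. f x - s i x) + vnorm p (\<lambda>x. s i x - t x)"
    using s[of i] t f by (intro vnorm_triangle vL2_diff) (auto simp: vapprox_def intro: vstep_vL2)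
  then have "vnorm p (\<lambda>x. f x - t x) < \<epsilon>" using i t(2) by simp
  then show "\<exists>M L u. vstep M L u \<and> vnorm p (\<lambda>x. f x - u x) < \<epsilon>"
    using t(1) by blast
qed

lemma vstep_indicator_vU: "vstep m m (indicator (vU p m))"
  by (auto simp: vstep_def vU_def vcoset_def indicator_def)

lemma vU_sets: "vU p m \<in> sets (haar p)"
  unfolding vU_eq_vcoset by (rule vcoset_sets[OF vzero_in_vil[OF p_pos]])

lemma vL2_indicator:
  assumes "A \<in> sets (haar p)"
  shows "indicator (A \<inter> vU p m) \<in> vL2 p"
proof -
  have "(\<lambda>x. indicator A x * indicator (vU p m) x) \<in> vL2 p"
    using assms vstep_vL2[OF vstep_indicator_vU[of m]]
    by (intro vL2_mult_bounded) (auto simp: indicator_def[abs_def] intro!: measurable_If)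
  then show ?thesis by (simp add: indicator_inter_arith[symmetric])
qed

text \<open>Induction over the sets generated by the intersection-stable family
  \<open>vbasis\<close>. Cutting with \<open>vU p m\<close> keeps all measures finite, so that
  complements and countable disjoint unions remain within the square integrable functions.\<close>

lemma vapprox_indicator:
  assumes "A \<in> sets (haar p)"
  shows "vapprox (indicator (A \<inter> vU p m))"
proof -
  have "A \<in> sigma_sets (vil p) (vbasis p)" using assms by (simp add: sets_haar)
  then show ?thesis
  proof (induction A rule: sigma_sets_induct_disjoint[OF Int_stable_vbasis vbasis_subset, consumes 1, case_names basic empty compl union])
    case (basic A)
    show ?case
    proof (cases "A = {}")
      case True
      then show ?thesis using vapprox_step[of 0 0 "\<lambda>x. 0"] by (simp add: vstep_def)
    next
      case False
      with basic obtain x n where "A = vcoset p x (int n)" by (auto simp: vbasis_def)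
      then have "vstep m (max m (int n)) (indicator (A \<inter> vU p m))"
        by (auto simp: vstep_def vU_def vcoset_def indicator_def)
      then show ?thesis by (rule vapprox_step)
    qed
  next
    case empty
    show ?case using vapprox_step[of 0 0 "\<lambda>x. 0"] by (simp add: vstep_def)
  next
    case (compl A)
    have "vapprox (\<lambda>x. indicator (vU p m) x + (- 1) * indicator (A \<inter> vU p m) x)"
      by (rule vapprox_add[OF vapprox_step[OF vstep_indicator_vU] vapprox_cmult[OF compl(2)]])
    also have "(\<lambda>x. indicator (vU p m) x + (- 1) * indicator (A \<inter> vU p m) x :: complex) = indicator ((vil p - A) \<inter> vU p m)"
      by (auto simp: fun_eq_iff indicator_def vU_def)
    finally show ?case .
  next
    case (union A)
    have A: "A i \<in> sets (haar p)" for i using union(2) unfolding sets_haar by blast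
    define s where "s n = (\<lambda>x. \<Sum>i<n. indicator (A i \<inter> vU p m) x :: complex)" for n :: nat
    have disj: "disjoint_family (\<lambda>i. A i \<inter> vU p m)"
      using union by (auto simp: disjoint_family_on_def)
    have s: "s n x = indicator (\<Union>i<n. A i \<inter> vU p m) x" for n x
      unfolding s_def using disj by (intro indicator_UN_disjoint[symmetric]) (auto simp: disjoint_family_on_def)
    show ?case
    proof (rule vapprox_limit)
      show "indicator (\<Union> (range A) \<inter> vU p m) \<in> vL2 p" using A by (intro vL2_indicator) auto
      show "vapprox (s n)" for n unfolding s_def using union by (intro vapprox_sum) auto
      then have "s n \<in> borel_measurable (haar p)" for n by (auto simp: vapprox_def intro: vL2_measurable)
      then show "(\<lambda>i. vnorm p (\<lambda>x. indicator (\<Union> (range A) \<inter> vU p m) x - s i x)) \<longlonglongrightarrow> 0"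
      proof (rule vnorm_dominated_convergence[rotated 2])
        show "indicator (\<Union> (range A) \<inter> vU p m) \<in> vL2 p" using A by (intro vL2_indicator) auto
        show "indicator (vU p m) \<in> vL2 p" by (rule vstep_vL2[OF vstep_indicator_vU])
        fix x
        show "(\<lambda>i. s i x) \<longlonglongrightarrow> indicator (\<Union> (range A) \<inter> vU p m) x"
          unfolding s using LIMSEQ_indicator_UN[of "\<lambda>i. A i \<inter> vU p m" x] by simp
        show "cmod (s i x) \<le> cmod (indicator (vU p m) x)" for i
          unfolding s by (auto simp: indicator_def)
      qed
    qed
  qed
qed

text \<open>Simple functions converging to \<open>f\<close> are dominated by twice \<open>f\<close>.
  Cutting the i-th one off to \<open>vU p (- int i)\<close> makes it a combination of indicators
  covered by \<open>vapprox_indicator\<close>, and it does not disturb the limit, as each point lies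
  in these sets for all large i.\<close>

proposition step_functions_dense:
  assumes f: "f \<in> vL2 p"
  shows "vapprox f"
proof -
  obtain s where s: "\<And>i. simple_function (haar p) (s i)" "\<And>x. x \<in> vil p \<Longrightarrow> (\<lambda>i. s i x) \<longlonglongrightarrow> f x"
    "\<And>i x. x \<in> vil p \<Longrightarrow> cmod (s i x) \<le> 2 * cmod (f x)"
    using borel_measurable_implies_sequence_metric[OF vL2_measurable[OF f], of 0] by (simp add: space_haar) metis
  define t where "t i = (\<lambda>x. indicator (vU p (- int i)) x * s i x)" for i
  have t_eq: "t i x = (\<Sum>y\<in>s i ` space (haar p). y * indicator ((s i -` {y} \<inter> space (haar p)) \<inter> vU p (- int i)) x)"
    if "x \<in> vil p" for i x
  proof -
    have "(\<Sum>y\<in>s i ` space (haar p). y * indicator ((s i -` {y} \<inter> space (haar p)) \<inter> vU p (- int i)) x)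
        = (\<Sum>y\<in>s i ` space (haar p). if y = s i x then t i x else 0)"
      using that by (intro sum.cong) (auto simp: t_def indicator_def space_haar)
    also have "\<dots> = t i x"
      using that s(1)[of i] by (auto simp: simple_function_def space_haar)
    finally show ?thesis by simp
  qed
  have ap: "vapprox (\<lambda>x. \<Sum>y\<in>s i ` space (haar p). y * indicator ((s i -` {y} \<inter> space (haar p)) \<inter> vU p (- int i)) x)" for i
    using s(1)[of i] by (intro vapprox_sum vapprox_cmult vapprox_indicator) (auto simp: simple_function_def)
  define u where "u i = (\<lambda>x. \<Sum>y\<in>s i ` space (haar p). y * indicator ((s i -` {y} \<inter> space (haar p)) \<inter> vU p (- int i)) x)" for i
  have tu: "u i x = t i x" if "x \<in> vil p" for i x
    by (simp only: t_eq[OF that] u_def)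
  show ?thesis
  proof (rule vapprox_limit[OF f])
    show "vapprox (u i)" for i unfolding u_def by (rule ap)
    then have um: "u i \<in> borel_measurable (haar p)" for i by (auto simp: vapprox_def intro: vL2_measurable)
    show "(\<lambda>i. vnorm p (\<lambda>x. f x - u i x)) \<longlonglongrightarrow> 0"
    proof (rule vnorm_dominated_convergence[OF f vL2_cmult[OF f, of 2] um])
      fix x assume x: "x \<in> vil p"
      then obtain n0 where n0: "\<And>n. n \<ge> n0 \<Longrightarrow> x \<in> vU p (- int n)" using vil_eventually_vU by blast
      have "\<forall>\<^sub>F i in sequentially. s i x = u i x"
        unfolding eventually_sequentially using n0 by (intro exI[of _ n0]) (simp add: tu[OF x] t_def)
      then show "(\<lambda>i. u i x) \<longlonglongrightarrow> f x" by (rule Lim_transform_eventually[OF s(2)[OF x]])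
      show "cmod (u i x) \<le> cmod (2 * f x)" for i
        using s(3)[OF x, of i] by (simp add: tu[OF x] t_def norm_mult indicator_def)
    qed
  qed
qed

text \<open>By Pythagoras, a step function orthogonal to \<open>f\<close> cannot be closer to
  \<open>f\<close> than zero is; density then leaves only norm zero.\<close>

lemma vL2_orthogonal_steps_eq_0:
  assumes f: "f \<in> vL2 p" and orth: "\<And>M L s. vstep M L s \<Longrightarrow> vinner p f s = 0"
  shows "AE x in haar p. f x = 0"
proof (rule vnorm_eq_0[OF f])
  show "vnorm p f = 0"
  proof (rule ccontr)
    assume "vnorm p f \<noteq> 0"
    then have "vnorm p f > 0" using vnorm_nonneg[of f] by simp
    then obtain M L s where s: "vstep M L s" "vnorm p (\<lambda>x. f x - s x) < vnorm p f"
      using step_functions_dense[OF f] unfolding vapprox_def by blast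
    then have "(vnorm p (\<lambda>x. f x - s x))\<^sup>2 < (vnorm p f)\<^sup>2"
      using vnorm_nonneg by (intro power_strict_mono) auto
    moreover have "(vnorm p (\<lambda>x. f x - s x))\<^sup>2 = (vnorm p f)\<^sup>2 + (vnorm p s)\<^sup>2"
      using vnorm_diff_sq[OF f vstep_vL2[OF s(1)]] orth[OF s(1)] by simp
    ultimately show False by simp
  qed
qed

text \<open>The open sets \<open>vU p (- int n)\<close> increase and exhaust the group, so the
  largest member of a finite subcover contains \<open>K\<close>.\<close>

lemma compactin_subset_vU:
  assumes "compactin (vtop p) K"
  obtains N where "K \<subseteq> vU p (- int N)"
proof -
  have "topspace (vtop p) \<subseteq> vil p"
    by (rule conjunct1[OF iffD1[OF openin_vtop_iff openin_topspace]])
  then have K: "K \<subseteq> vil p" using compactin_subset_topspace[OF assms] by simp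
  have "\<forall>U\<in>range (\<lambda>n. vU p (- int n)). openin (vtop p) U"
    unfolding vU_eq_vcoset using openin_vcoset vzero_in_vil[OF p_pos] by blast
  moreover have "K \<subseteq> \<Union> (range (\<lambda>n. vU p (- int n)))"
    using K vil_eventually_vU by blast
  ultimately obtain F where F: "finite F" "F \<subseteq> range (\<lambda>n. vU p (- int n))" "K \<subseteq> \<Union> F"
    using assms unfolding compactin_def by meson
  then obtain I where I: "finite I" "F = (\<lambda>n. vU p (- int n)) ` I" by (metis finite_subset_image)
  have "K \<subseteq> vU p (- int (Max (insert 0 I)))"
  proof
    fix x assume "x \<in> K"
    then obtain n where n: "n \<in> I" "x \<in> vU p (- int n)" using F I by blast
    then have "n \<le> Max (insert 0 I)" using I by simp
    with n show "x \<in> vU p (- int (Max (insert 0 I)))" by (auto simp: vU_def)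
  qed
  then show ?thesis by (rule that)
qed


lemma vadd_vzero_left: "x \<in> vil p \<Longrightarrow> vadd p vzero x = x"
  using vadd_vzero[of x p] by (simp add: vadd_comm)

lemma vsub_eq_0_iff: "x \<in> vil p \<Longrightarrow> y \<in> vil p \<Longrightarrow> vsub p x y i = 0 \<longleftrightarrow> x i = y i"
  using vsub_coord_iff[of x y vzero i] vzero_in_vil[OF p_pos]
  by (simp add: vadd_vzero_left) (simp add: vzero_def)

section \<open>Walsh polynomials and filter banks\<close>

text \<open>The coordinates 1, ..., n are those that the pairing matches with the window
  \<open>vbox (- int n) 0\<close>. By the next two lemmas these functions are precisely the
  combinations of characters from that window.\<close>

definition local_on :: "nat \<Rightarrow> ((int \<Rightarrow> nat) \<Rightarrow> complex) \<Rightarrow> bool" where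
  "local_on n g \<longleftrightarrow> (\<forall>\<omega>\<in>vil p. \<forall>\<omega>'\<in>vil p. (\<forall>i. 0 < i \<and> i \<le> int n \<longrightarrow> \<omega> i = \<omega>' i) \<longrightarrow> g \<omega> = g \<omega>')"

lemma local_onD:
  assumes "local_on n g" "\<omega> \<in> vil p" "\<omega>' \<in> vil p" "\<And>i. 0 < i \<Longrightarrow> i \<le> int n \<Longrightarrow> \<omega> i = \<omega>' i"
  shows "g \<omega> = g \<omega>'"
  using assms(1)[unfolded local_on_def, rule_format, OF assms(2,3)] assms(4) by blast

lemma local_on_character_sum:
  assumes "\<And>\<omega>. \<omega> \<in> vil p \<Longrightarrow> g \<omega> = (\<Sum>\<alpha>\<in>vbox (- int n) 0. b \<alpha> * cnj (vchi p \<alpha> \<omega>))"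
  shows "local_on n g"
  unfolding local_on_def
proof (intro ballI impI)
  fix \<omega> \<omega>' assume w: "\<omega> \<in> vil p" "\<omega>' \<in> vil p" "\<forall>i. 0 < i \<and> i \<le> int n \<longrightarrow> \<omega> i = \<omega>' i"
  have "vchi p \<alpha> \<omega> = vchi p \<alpha> \<omega>'" if "\<alpha> \<in> vbox (- int n) 0" for \<alpha>
  proof (rule vchi_cong)
    fix j assume "\<alpha> j \<noteq> 0"
    then have "- int n < j" "j \<le> 0" using that by (auto simp: vbox_def)
    then show "\<omega> (1 - j) = \<omega>' (1 - j)" using w(3) by simp
  qed
  then show "g \<omega> = g \<omega>'" using assms w by (simp cong: sum.cong)
qed

text \<open>Fourier inversion on the finite group of coordinates 1, ..., n: orthogonality singles
  out the truncation of \<omega> to these coordinates, where \<open>g\<close> has the same value as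
  at \<omega>.\<close>

lemma local_on_expansion:
  assumes "local_on n g"
  obtains b where "\<And>\<omega>. \<omega> \<in> vil p \<Longrightarrow> g \<omega> = (\<Sum>\<alpha>\<in>vbox (- int n) 0. b \<alpha> * cnj (vchi p \<alpha> \<omega>))"
proof
  define b where "b \<alpha> = (\<Sum>e\<in>vbox 0 (int n). g e * vchi p \<alpha> e) / of_nat p ^ n" for \<alpha>
  fix \<omega> assume w: "\<omega> \<in> vil p"
  let ?t = "vtrunc 0 (int n) \<omega>"
  have t: "?t \<in> vbox 0 (int n)" using w by (rule vtrunc_vbox)
  have inner: "(\<Sum>\<alpha>\<in>vbox (- int n) 0. vchi p \<alpha> e * cnj (vchi p \<alpha> \<omega>)) = (if e = ?t then of_nat p ^ n else 0)"
    if e: "e \<in> vbox 0 (int n)" for e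
  proof -
    have "(\<Sum>\<alpha>\<in>vbox (- int n) 0. vchi p \<alpha> e * cnj (vchi p \<alpha> \<omega>)) = (\<Sum>\<alpha>\<in>vbox (- int n) 0. vchi p \<alpha> (vsub p e \<omega>))"
      using e w by (intro sum.cong) (auto simp: vchi_vsub_right vbox_vil)
    also have "\<dots> = (if \<forall>j. - int n < j \<and> j \<le> 0 \<longrightarrow> vsub p e \<omega> (1 - j) = 0 then of_nat (p ^ nat (0 - - int n)) else 0)"
      using e w by (intro sum_vchi_vbox vsub_closed) (auto simp: vbox_vil)
    also have "(\<forall>j. - int n < j \<and> j \<le> 0 \<longrightarrow> vsub p e \<omega> (1 - j) = 0) \<longleftrightarrow> e = ?t"
    proof
      assume *: "\<forall>j. - int n < j \<and> j \<le> 0 \<longrightarrow> vsub p e \<omega> (1 - j) = 0"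
      show "e = ?t"
      proof
        fix i show "e i = ?t i"
        proof (cases "0 < i \<and> i \<le> int n")
          case True
          then have "vsub p e \<omega> i = 0" using *[rule_format, of "1 - i"] by simp
          then show ?thesis using True e w by (simp add: vsub_eq_0_iff vbox_vil vtrunc_def)
        next
          case False
          then show ?thesis using e vbox_eq_0[of e 0 "int n" i] by (auto simp: vtrunc_def)
        qed
      qed
    next
      assume "e = ?t"
      then show "\<forall>j. - int n < j \<and> j \<le> 0 \<longrightarrow> vsub p e \<omega> (1 - j) = 0"
        using e w by (simp add: vsub_eq_0_iff vbox_vil) (simp add: vtrunc_def)
    qed
    finally show ?thesis by simp
  qed
  have "(\<Sum>\<alpha>\<in>vbox (- int n) 0. b \<alpha> * cnj (vchi p \<alpha> \<omega>))
      = (\<Sum>\<alpha>\<in>vbox (- int n) 0. \<Sum>e\<in>vbox 0 (int n). g e * (vchi p \<alpha> e * cnj (vchi p \<alpha> \<omega>)) / of_nat p ^ n)"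
    unfolding b_def sum_divide_distrib sum_distrib_right
    by (intro sum.cong refl) (simp add: mult_ac)
  also have "\<dots> = (\<Sum>e\<in>vbox 0 (int n). \<Sum>\<alpha>\<in>vbox (- int n) 0. g e * (vchi p \<alpha> e * cnj (vchi p \<alpha> \<omega>)) / of_nat p ^ n)"
    by (rule sum.swap)
  also have "\<dots> = (\<Sum>e\<in>vbox 0 (int n). if e = ?t then g e else 0)"
    using p_pos by (intro sum.cong refl) (simp add: sum_divide_distrib[symmetric] sum_distrib_left[symmetric] inner)
  also have "\<dots> = g ?t" using t finite_vbox by simp
  also have "\<dots> = g \<omega>"
    by (rule local_onD[OF assms vbox_vil[OF t] w]) (simp add: vtrunc_def)
  finally show "g \<omega> = (\<Sum>\<alpha>\<in>vbox (- int n) 0. b \<alpha> * cnj (vchi p \<alpha> \<omega>))" by simp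
qed

lemma local_on_walsh_polynomial:
  assumes "local_on n g"
  shows "walsh_polynomial p g"
proof -
  \<comment> \<open>The expansion uses conjugate characters, whereas Walsh polynomials are
    combinations of the characters themselves; expanding the conjugate of \<open>g\<close> switches
    between the two.\<close>
  have "local_on n (\<lambda>\<omega>. cnj (g \<omega>))" using assms unfolding local_on_def by metis
  then obtain b where b: "\<And>\<omega>. \<omega> \<in> vil p \<Longrightarrow> cnj (g \<omega>) = (\<Sum>\<alpha>\<in>vbox (- int n) 0. b \<alpha> * cnj (vchi p \<alpha> \<omega>))"
    using local_on_expansion by blast
  have "g \<omega> = (\<Sum>k<p ^ n. cnj (b (vh p k)) * walsh p k \<omega>)" if w: "\<omega> \<in> vil p" for \<omega>
  proof -
    have "g \<omega> = (\<Sum>\<alpha>\<in>vbox (- int n) 0. cnj (b \<alpha>) * vchi p \<alpha> \<omega>)"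
      using arg_cong[OF b[OF w], of cnj] by simp
    also have "\<dots> = (\<Sum>k<p ^ n. cnj (b (vh p k)) * vchi p (vh p k) \<omega>)"
      by (rule sum.reindex_bij_betw[OF bij_betw_vh_vbox, symmetric])
    finally show ?thesis by (simp add: walsh_def vchi_comm)
  qed
  then show ?thesis
    unfolding walsh_polynomial_def by (intro exI[of _ "{..<p ^ n}"] exI[of _ "\<lambda>k. cnj (b (vh p k))"]) auto
qed

section \<open>Finite Fourier transform and the filter bank identity\<close>

definition vdft :: "nat \<Rightarrow> ((int \<Rightarrow> nat) \<Rightarrow> complex) \<Rightarrow> (int \<Rightarrow> nat) \<Rightarrow> complex" where
  "vdft N c e = (\<Sum>\<gamma>\<in>vbox (- int N) 0. c \<gamma> * cnj (vchi p \<gamma> e))"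

text \<open>Characters with frequencies in the dual window \<open>vbox 0 (int N)\<close> separate
  the points of \<open>vbox (- int N) 0\<close>; the factor p^N is the order of the group.\<close>

lemma vdft_inversion:
  assumes g: "\<gamma> \<in> vbox (- int N) 0"
  shows "(\<Sum>e\<in>vbox 0 (int N). vdft N c e * vchi p \<gamma> e) = of_nat p ^ N * c \<gamma>"
proof -
  have inner: "(\<Sum>e\<in>vbox 0 (int N). cnj (vchi p \<delta> e) * vchi p \<gamma> e) = (if \<delta> = \<gamma> then of_nat p ^ N else 0)"
    if d: "\<delta> \<in> vbox (- int N) 0" for \<delta>
  proof -
    have "(\<Sum>e\<in>vbox 0 (int N). cnj (vchi p \<delta> e) * vchi p \<gamma> e) = (\<Sum>e\<in>vbox 0 (int N). vchi p e (vsub p \<gamma> \<delta>))"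
      using d g by (intro sum.cong refl) (auto simp: vchi_vsub_right vbox_vil vchi_comm[of \<gamma>] vchi_comm[of \<delta>])
    also have "\<dots> = (if \<forall>j. 0 < j \<and> j \<le> int N \<longrightarrow> vsub p \<gamma> \<delta> (1 - j) = 0 then of_nat (p ^ nat (int N - 0)) else 0)"
      using d g by (intro sum_vchi_vbox vsub_closed) (auto simp: vbox_vil)
    also have "(\<forall>j. 0 < j \<and> j \<le> int N \<longrightarrow> vsub p \<gamma> \<delta> (1 - j) = 0) \<longleftrightarrow> \<delta> = \<gamma>"
    proof
      assume *: "\<forall>j. 0 < j \<and> j \<le> int N \<longrightarrow> vsub p \<gamma> \<delta> (1 - j) = 0"
      show "\<delta> = \<gamma>"
      proof
        fix i show "\<delta> i = \<gamma> i"
        proof (cases "- int N < i \<and> i \<le> 0")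
          case True
          then have "vsub p \<gamma> \<delta> i = 0" using *[rule_format, of "1 - i"] by simp
          then show ?thesis using d g by (simp add: vsub_eq_0_iff vbox_vil)
        next
          case False
          then show ?thesis using vbox_eq_0[OF d, of i] vbox_eq_0[OF g, of i] by auto
        qed
      qed
    next
      assume "\<delta> = \<gamma>"
      then show "\<forall>j. 0 < j \<and> j \<le> int N \<longrightarrow> vsub p \<gamma> \<delta> (1 - j) = 0"
        using d g by (simp add: vsub_eq_0_iff vbox_vil)
    qed
    finally show ?thesis by simp
  qed
  have "(\<Sum>e\<in>vbox 0 (int N). vdft N c e * vchi p \<gamma> e)
      = (\<Sum>e\<in>vbox 0 (int N). \<Sum>\<delta>\<in>vbox (- int N) 0. c \<delta> * (cnj (vchi p \<delta> e) * vchi p \<gamma> e))"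
    by (simp add: vdft_def sum_distrib_right mult.assoc)
  also have "\<dots> = (\<Sum>\<delta>\<in>vbox (- int N) 0. \<Sum>e\<in>vbox 0 (int N). c \<delta> * (cnj (vchi p \<delta> e) * vchi p \<gamma> e))"
    by (rule sum.swap)
  also have "\<dots> = (\<Sum>\<delta>\<in>vbox (- int N) 0. if \<delta> = \<gamma> then of_nat p ^ N * c \<delta> else 0)"
    by (intro sum.cong refl) (simp add: sum_distrib_left[symmetric] inner)
  also have "\<dots> = of_nat p ^ N * c \<gamma>" using g finite_vbox by simp
  finally show ?thesis .
qed

lemma vdft_parseval:
  "(\<Sum>e\<in>vbox 0 (int N). vdft N c e * cnj (vdft N c e)) = of_nat p ^ N * (\<Sum>\<gamma>\<in>vbox (- int N) 0. c \<gamma> * cnj (c \<gamma>))"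
proof -
  have "(\<Sum>e\<in>vbox 0 (int N). vdft N c e * cnj (vdft N c e))
      = (\<Sum>e\<in>vbox 0 (int N). \<Sum>\<gamma>\<in>vbox (- int N) 0. cnj (c \<gamma>) * (vdft N c e * vchi p \<gamma> e))"
    by (intro sum.cong refl) (subst (2) vdft_def, simp add: sum_distrib_left mult_ac)
  also have "\<dots> = (\<Sum>\<gamma>\<in>vbox (- int N) 0. \<Sum>e\<in>vbox 0 (int N). cnj (c \<gamma>) * (vdft N c e * vchi p \<gamma> e))"
    by (rule sum.swap)
  also have "\<dots> = (\<Sum>\<gamma>\<in>vbox (- int N) 0. of_nat p ^ N * (c \<gamma> * cnj (c \<gamma>)))"
    by (rule sum.cong[OF refl], simp only: sum_distrib_left[symmetric] vdft_inversion, simp only: mult_ac)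
  finally show ?thesis by (simp add: sum_distrib_left)
qed

text \<open>The unitarity of the mask matrix, with its rows indexed by the points
  of a coset of \<open>{\<delta>\<^sub>0, \<dots>, \<delta>\<^sub>p\<^sub>-\<^sub>1}\<close>.\<close>

definition mask_orthonormal :: "'i set \<Rightarrow> ('i \<Rightarrow> (int \<Rightarrow> nat) \<Rightarrow> complex) \<Rightarrow> bool" where
  "mask_orthonormal I m \<longleftrightarrow> (\<forall>\<omega>\<in>vil p. \<forall>\<omega>'\<in>vil p. (\<forall>i. i \<noteq> 1 \<longrightarrow> \<omega> i = \<omega>' i) \<longrightarrow>
    (\<Sum>\<nu>\<in>I. m \<nu> \<omega> * cnj (m \<nu> \<omega>')) = (if \<omega> = \<omega>' then 1 else 0))"

lemma mask_orthonormalD: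
  assumes "mask_orthonormal I m" "\<omega> \<in> vil p" "\<omega>' \<in> vil p" "\<And>i. i \<noteq> 1 \<Longrightarrow> \<omega> i = \<omega>' i"
  shows "(\<Sum>\<nu>\<in>I. m \<nu> \<omega> * cnj (m \<nu> \<omega>')) = (if \<omega> = \<omega>' then 1 else 0)"
  using assms(1)[unfolded mask_orthonormal_def, rule_format, OF assms(2,3)] assms(4) by blast

text \<open>For \<open>k\<close> in H the dilate \<open>dil 1 k\<close> vanishes at index 0, so its
  pairing does not see coordinate 1. These characters therefore cannot separate points of one fibre,
  and they do separate points of different fibres.\<close>

lemma sum_vchi_dil:
  assumes "e \<in> vbox 0 (int N)" "e' \<in> vbox 0 (int N)" "N > 0"
  shows "(\<Sum>k\<in>vbox (1 - int N) 0. vchi p (dil 1 k) e * cnj (vchi p (dil 1 k) e'))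
    = (if \<forall>i. i \<noteq> 1 \<longrightarrow> e i = e' i then of_nat p ^ (N - 1) else 0)"
proof -
  have "(\<Sum>k\<in>vbox (1 - int N) 0. vchi p (dil 1 k) e * cnj (vchi p (dil 1 k) e'))
      = (\<Sum>k\<in>vbox (1 - int N) 0. vchi p k (dil 1 (vsub p e e')))"
    using assms by (intro sum.cong refl) (simp add: vchi_dil[symmetric] vchi_vsub_right vbox_vil dil_closed)
  also have "\<dots> = (if \<forall>j. 1 - int N < j \<and> j \<le> 0 \<longrightarrow> dil 1 (vsub p e e') (1 - j) = 0 then of_nat (p ^ nat (0 - (1 - int N))) else 0)"
    using assms by (intro sum_vchi_vbox dil_closed vsub_closed) (auto simp: vbox_vil)
  also have "(\<forall>j. 1 - int N < j \<and> j \<le> 0 \<longrightarrow> dil 1 (vsub p e e') (1 - j) = 0) \<longleftrightarrow> (\<forall>i. i \<noteq> 1 \<longrightarrow> e i = e' i)"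
  proof
    assume *: "\<forall>j. 1 - int N < j \<and> j \<le> 0 \<longrightarrow> dil 1 (vsub p e e') (1 - j) = 0"
    show "\<forall>i. i \<noteq> 1 \<longrightarrow> e i = e' i"
    proof (intro allI impI)
      fix i :: int assume "i \<noteq> 1"
      show "e i = e' i"
      proof (cases "1 < i \<and> i \<le> int N")
        case True
        then have "vsub p e e' i = 0" using *[rule_format, of "2 - i"] by (simp add: dil_def)
        then show ?thesis using assms by (simp add: dil_def vsub_eq_0_iff vbox_vil)
      next
        case False
        with \<open>i \<noteq> 1\<close> show ?thesis using vbox_eq_0[OF assms(1), of i] vbox_eq_0[OF assms(2), of i] by auto
      qed
    qed
  next
    assume "\<forall>i. i \<noteq> 1 \<longrightarrow> e i = e' i"
    then show "\<forall>j. 1 - int N < j \<and> j \<le> 0 \<longrightarrow> dil 1 (vsub p e e') (1 - j) = 0"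
      using assms by (simp add: dil_def vsub_eq_0_iff vbox_vil)
  qed
  also have "nat (0 - (1 - int N)) = N - 1" using assms by simp
  finally show ?thesis by (simp only: of_nat_power)
qed

text \<open>In the frequency domain \<open>d \<nu> k\<close> is a sum of \<open>F e\<close> times
  the conjugate mask value \<open>m \<nu> e\<close>. Summing the squares over \<open>k\<close>
  retains only pairs of frequencies in a common fibre; there the orthonormality of the rows removes
  all off-diagonal pairs, and Parseval finishes. The factor p reflects the one coordinate that the
  dilates cannot see.\<close>

lemma filter_bank_identity:
  assumes I: "finite I" and orth: "mask_orthonormal I m"
    and m: "\<And>\<nu> \<omega>. \<nu> \<in> I \<Longrightarrow> \<omega> \<in> vil p \<Longrightarrow> m \<nu> \<omega> = (\<Sum>\<alpha>\<in>vbox (- int n) 0. b \<nu> \<alpha> * cnj (vchi p \<alpha> \<omega>))"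
    and N: "n \<le> N" "N > 0"
    and d: "\<And>\<nu> k. d \<nu> k = (\<Sum>\<alpha>\<in>vbox (- int n) 0. cnj (b \<nu> \<alpha>) * c (vadd p (dil 1 k) \<alpha>))"
  shows "of_nat p * (\<Sum>\<nu>\<in>I. \<Sum>k\<in>vbox (1 - int N) 0. d \<nu> k * cnj (d \<nu> k)) = (\<Sum>\<gamma>\<in>vbox (- int N) 0. c \<gamma> * cnj (c \<gamma>))"
proof -
  let ?K = "vbox (1 - int N) 0" and ?E = "vbox 0 (int N)" and ?q = "of_nat p ^ N :: complex"
  define F where "F = vdft N c"
  have dk: "?q * d \<nu> k = (\<Sum>e\<in>?E. F e * vchi p (dil 1 k) e * cnj (m \<nu> e))" if "\<nu> \<in> I" "k \<in> ?K" for \<nu> k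
  proof -
    \<comment> \<open>The window of \<open>k\<close> starts one place higher than that of
      \<open>\<gamma>\<close> so that dilation does not leave the latter.\<close>
    have k: "dil 1 k \<in> vbox (- int N) 0"
      using dil_vbox[OF that(2), of 1] vbox_mono[of "- int N" "- int N" "-1" 0] by auto
    have "?q * d \<nu> k = (\<Sum>\<alpha>\<in>vbox (- int n) 0. cnj (b \<nu> \<alpha>) * (?q * c (vadd p (dil 1 k) \<alpha>)))"
      by (simp add: d sum_distrib_left mult_ac)
    also have "\<dots> = (\<Sum>\<alpha>\<in>vbox (- int n) 0. \<Sum>e\<in>?E. cnj (b \<nu> \<alpha>) * (F e * (vchi p (dil 1 k) e * vchi p \<alpha> e)))"
    proof (rule sum.cong[OF refl])
      fix \<alpha> assume a: "\<alpha> \<in> vbox (- int n) 0"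
      then have aN: "\<alpha> \<in> vbox (- int N) 0" using vbox_mono[of "- int N" "- int n" 0 0] N by auto
      have "?q * c (vadd p (dil 1 k) \<alpha>) = (\<Sum>e\<in>?E. F e * vchi p (vadd p (dil 1 k) \<alpha>) e)"
        unfolding F_def using vadd_vbox[OF k aN] by (rule vdft_inversion[symmetric])
      also have "\<dots> = (\<Sum>e\<in>?E. F e * (vchi p (dil 1 k) e * vchi p \<alpha> e))"
        using k aN by (intro sum.cong refl) (simp add: vchi_vadd_left vbox_vil)
      finally show "cnj (b \<nu> \<alpha>) * (?q * c (vadd p (dil 1 k) \<alpha>)) = (\<Sum>e\<in>?E. cnj (b \<nu> \<alpha>) * (F e * (vchi p (dil 1 k) e * vchi p \<alpha> e)))"
        by (simp add: sum_distrib_left)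
    qed
    also have "\<dots> = (\<Sum>e\<in>?E. \<Sum>\<alpha>\<in>vbox (- int n) 0. cnj (b \<nu> \<alpha>) * (F e * (vchi p (dil 1 k) e * vchi p \<alpha> e)))"
      by (rule sum.swap)
    also have "\<dots> = (\<Sum>e\<in>?E. F e * vchi p (dil 1 k) e * cnj (m \<nu> e))"
      using that by (intro sum.cong refl) (simp add: m vbox_vil sum_distrib_left mult_ac)
    finally show ?thesis .
  qed
  define T where "T \<nu> k e = F e * vchi p (dil 1 k) e * cnj (m \<nu> e)" for \<nu> k e
  have "?q * ?q * (\<Sum>\<nu>\<in>I. \<Sum>k\<in>?K. d \<nu> k * cnj (d \<nu> k)) = (\<Sum>\<nu>\<in>I. \<Sum>k\<in>?K. (?q * d \<nu> k) * cnj (?q * d \<nu> k))"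
    unfolding sum_distrib_left by (intro sum.cong refl) (simp add: mult_ac)
  also have "\<dots> = (\<Sum>\<nu>\<in>I. \<Sum>k\<in>?K. (\<Sum>e\<in>?E. T \<nu> k e) * cnj (\<Sum>e\<in>?E. T \<nu> k e))"
    by (intro sum.cong refl) (simp only: dk T_def)
  also have "\<dots> = (\<Sum>\<nu>\<in>I. \<Sum>k\<in>?K. \<Sum>e\<in>?E. \<Sum>e'\<in>?E. T \<nu> k e * cnj (T \<nu> k e'))"
    by (simp only: cnj_sum sum_product)
  also have "\<dots> = (\<Sum>\<nu>\<in>I. \<Sum>e\<in>?E. \<Sum>k\<in>?K. \<Sum>e'\<in>?E. T \<nu> k e * cnj (T \<nu> k e'))"
    by (rule sum.cong[OF refl], rule sum.swap)
  also have "\<dots> = (\<Sum>\<nu>\<in>I. \<Sum>e\<in>?E. \<Sum>e'\<in>?E. \<Sum>k\<in>?K. T \<nu> k e * cnj (T \<nu> k e'))"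
    by (rule sum.cong[OF refl], rule sum.cong[OF refl], rule sum.swap)
  also have "\<dots> = (\<Sum>e\<in>?E. \<Sum>\<nu>\<in>I. \<Sum>e'\<in>?E. \<Sum>k\<in>?K. T \<nu> k e * cnj (T \<nu> k e'))"
    by (rule sum.swap)
  also have "\<dots> = (\<Sum>e\<in>?E. \<Sum>e'\<in>?E. \<Sum>\<nu>\<in>I. \<Sum>k\<in>?K. T \<nu> k e * cnj (T \<nu> k e'))"
    by (rule sum.cong[OF refl], rule sum.swap)
  also have "\<dots> = (\<Sum>e\<in>?E. \<Sum>e'\<in>?E. if e = e' then of_nat p ^ (N - 1) * (F e * cnj (F e)) else 0)"
  proof (intro sum.cong refl)
    fix e e' assume e: "e \<in> ?E" "e' \<in> ?E"
    define S where "S = (\<Sum>k\<in>?K. vchi p (dil 1 k) e * cnj (vchi p (dil 1 k) e'))"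
    have T: "T \<nu> k e * cnj (T \<nu> k e') = F e * cnj (F e') * (m \<nu> e' * cnj (m \<nu> e)) * (vchi p (dil 1 k) e * cnj (vchi p (dil 1 k) e'))" for \<nu> k
      by (simp add: T_def mult_ac)
    have "(\<Sum>\<nu>\<in>I. \<Sum>k\<in>?K. T \<nu> k e * cnj (T \<nu> k e')) = (\<Sum>\<nu>\<in>I. F e * cnj (F e') * (m \<nu> e' * cnj (m \<nu> e)) * S)"
      by (simp only: T S_def sum_distrib_left)
    also have "\<dots> = F e * cnj (F e') * (\<Sum>\<nu>\<in>I. m \<nu> e' * cnj (m \<nu> e)) * S"
      by (simp only: sum_distrib_left sum_distrib_right)
    also have "\<dots> = (if e = e' then of_nat p ^ (N - 1) * (F e * cnj (F e)) else 0)"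
    proof (cases "\<forall>i. i \<noteq> 1 \<longrightarrow> e i = e' i")
      case True
      then have "(\<Sum>\<nu>\<in>I. m \<nu> e' * cnj (m \<nu> e)) = (if e' = e then 1 else 0)"
        using e by (intro mask_orthonormalD[OF orth]) (auto simp: vbox_vil)
      then show ?thesis unfolding S_def sum_vchi_dil[OF e N(2)] if_P[OF True] by (simp add: mult_ac)
    next
      case False
      then have "e \<noteq> e'" by blast
      then show ?thesis unfolding S_def sum_vchi_dil[OF e N(2)] if_not_P[OF False] by simp
    qed
    finally show "(\<Sum>\<nu>\<in>I. \<Sum>k\<in>?K. T \<nu> k e * cnj (T \<nu> k e')) = (if e = e' then of_nat p ^ (N - 1) * (F e * cnj (F e)) else 0)" .
  qed
  also have "\<dots> = of_nat p ^ (N - 1) * (\<Sum>e\<in>?E. F e * cnj (F e))"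
    by (simp add: finite_vbox sum_distrib_left)
  also have "\<dots> = of_nat p ^ (N - 1) * (?q * (\<Sum>\<gamma>\<in>vbox (- int N) 0. c \<gamma> * cnj (c \<gamma>)))"
    unfolding F_def by (simp only: vdft_parseval)
  finally have *: "?q * ?q * (\<Sum>\<nu>\<in>I. \<Sum>k\<in>?K. d \<nu> k * cnj (d \<nu> k))
      = of_nat p ^ (N - 1) * (?q * (\<Sum>\<gamma>\<in>vbox (- int N) 0. c \<gamma> * cnj (c \<gamma>)))" .
  have q: "?q = of_nat p * of_nat p ^ (N - 1)" using N by (cases N) auto
  have "of_nat p ^ (N - 1) * ?q * (of_nat p * (\<Sum>\<nu>\<in>I. \<Sum>k\<in>?K. d \<nu> k * cnj (d \<nu> k)))
      = of_nat p ^ (N - 1) * ?q * (\<Sum>\<gamma>\<in>vbox (- int N) 0. c \<gamma> * cnj (c \<gamma>))"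
    using * by (simp only: q mult_ac)
  moreover have "of_nat p ^ (N - 1) * ?q \<noteq> 0" using p_pos by simp
  ultimately show ?thesis using mult_left_cancel by blast
qed


section \<open>Translated dilates\<close>

text \<open>This is \<open>wavelet_shift\<close> with the translation given as a group element
  instead of its number, so that translations can be added and dilated.\<close>

definition vshift :: "((int \<Rightarrow> nat) \<Rightarrow> complex) \<Rightarrow> int \<Rightarrow> (int \<Rightarrow> nat) \<Rightarrow> (int \<Rightarrow> nat) \<Rightarrow> complex" where
  "vshift \<psi> j h x = of_real (real p powr (real_of_int j / 2)) * \<psi> (vmove j h x)"

lemma vshift_factor_sq: "(real p powr (real_of_int j / 2))\<^sup>2 = real p powi j"
proof -
  have "(real p powr (real_of_int j / 2))\<^sup>2 = real p powr (real_of_int j / 2 + real_of_int j / 2)"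
    by (simp add: power2_eq_square powr_add[symmetric])
  then show ?thesis using p_pos by (simp add: powr_real_of_int')
qed

lemma vmove_comp_vL2:
  assumes "\<psi> \<in> vL2 p" "h \<in> vil p"
  shows "(\<lambda>x. \<psi> (vmove j h x)) \<in> vL2 p"
proof -
  have m: "\<psi> \<in> borel_measurable (haar p)" using assms by (simp add: vL2_measurable)
  then have "(\<lambda>x. (cmod (\<psi> x))\<^sup>2) \<in> borel_measurable (haar p)" by measurable
  then have "integrable (haar p) (\<lambda>x. (cmod (\<psi> (vmove j h x)))\<^sup>2)"
    using integrable_vmove_iff[OF assms(2), of "\<lambda>x. (cmod (\<psi> x))\<^sup>2" j] assms by (simp add: vL2_integrable)
  moreover have "(\<lambda>x. \<psi> (vmove j h x)) \<in> borel_measurable (haar p)"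
    using vmove_measurable[OF assms(2)] m by (rule measurable_compose)
  ultimately show ?thesis by (simp add: vL2_def)
qed

lemma vshift_vL2: "\<psi> \<in> vL2 p \<Longrightarrow> h \<in> vil p \<Longrightarrow> vshift \<psi> j h \<in> vL2 p"
  unfolding vshift_def[abs_def] by (intro vL2_cmult vmove_comp_vL2)

lemma vnorm_vshift:
  assumes "\<psi> \<in> vL2 p" "h \<in> vil p"
  shows "vnorm p (vshift \<psi> j h) = vnorm p \<psi>"
proof (rule power2_eq_imp_eq)
  have m: "(\<lambda>x. (cmod (\<psi> x))\<^sup>2) \<in> borel_measurable (haar p)"
    using vL2_measurable[OF assms(1)] by measurable
  have "(vnorm p (vshift \<psi> j h))\<^sup>2 = (\<integral>x. real p powi j * (cmod (\<psi> (vmove j h x)))\<^sup>2 \<partial>haar p)"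
    unfolding vnorm_sq vshift_def norm_mult power_mult_distrib by (simp add: vshift_factor_sq)
  also have "\<dots> = real p powi j * (real p powi (- j) * (vnorm p \<psi>)\<^sup>2)"
    using integral_vmove[OF assms(2) m, of j] by (simp add: vnorm_sq)
  also have "\<dots> = (vnorm p \<psi>)\<^sup>2"
    using p_pos by (simp add: power_int_minus)
  finally show "(vnorm p (vshift \<psi> j h))\<^sup>2 = (vnorm p \<psi>)\<^sup>2" .
qed (simp_all add: vnorm_nonneg)

lemma vmove_vmove:
  assumes "x \<in> vil p" "h \<in> vil p" "\<alpha> \<in> vil p"
  shows "vmove 1 \<alpha> (vmove j h x) = vmove (j + 1) (vadd p (dil 1 h) \<alpha>) x"
  using assms by (simp add: vmove_def dil_vsub dil_dil vsub_vadd dil_closed add.commute)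

text \<open>The factor p of the refinement equation pays for the change of normalisation from level
  \<open>j\<close> to level \<open>j + 1\<close> and leaves a square root of p.\<close>

lemma p_powr_half_step: "real p * real p powr (real_of_int j / 2) = sqrt (real p) * real p powr (real_of_int (j + 1) / 2)"
proof -
  have "real p * real p powr (real_of_int j / 2) = real p powr (1 + real_of_int j / 2)"
    using p_pos by (simp add: powr_add)
  also have "1 + real_of_int j / 2 = 1 / 2 + real_of_int (j + 1) / 2" by (simp add: field_simps)
  also have "real p powr \<dots> = sqrt (real p) * real p powr (real_of_int (j + 1) / 2)"
    using p_pos by (simp only: powr_add powr_half_sqrt)
  finally show ?thesis .
qed

text \<open>One analysis step of the filter bank: the coefficients at level \<open>j\<close> come
  from those at level \<open>j + 1\<close> by filtering with the conjugate of \<open>b\<close> and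
  subsampling along \<open>dil 1 h\<close>. It applies to wavelets and, with \<psi> equal to \<phi>,
  to the scaling function itself.\<close>

lemma vinner_vshift_refine:
  assumes f: "f \<in> vL2 p" and \<phi>: "\<phi> \<in> vL2 p" and \<psi>: "\<psi> \<in> vL2 p" and h: "h \<in> vil p"
    and eq: "AE x in haar p. \<psi> x = of_nat p * (\<Sum>\<alpha>\<in>vbox (- int n) 0. b \<alpha> * \<phi> (vmove 1 \<alpha> x))"
  shows "vinner p f (vshift \<psi> j h) =
    of_real (sqrt (real p)) * (\<Sum>\<alpha>\<in>vbox (- int n) 0. cnj (b \<alpha>) * vinner p f (vshift \<phi> (j + 1) (vadd p (dil 1 h) \<alpha>)))"
proof -
  let ?B = "vbox (- int n) 0"
  let ?g = "\<lambda>x. \<Sum>\<alpha>\<in>?B. (of_real (sqrt (real p)) * b \<alpha>) * vshift \<phi> (j + 1) (vadd p (dil 1 h) \<alpha>) x"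
  have cl: "vadd p (dil 1 h) \<alpha> \<in> vil p" if "\<alpha> \<in> ?B" for \<alpha>
    using that h by (simp add: vadd_closed dil_closed vbox_vil)
  have shift: "vshift \<phi> (j + 1) (vadd p (dil 1 h) \<alpha>) \<in> vL2 p" if "\<alpha> \<in> ?B" for \<alpha>
    using cl[OF that] \<phi> by (intro vshift_vL2)
  have "?g \<in> vL2 p" using shift by (intro vL2_sum vL2_cmult)
  moreover have "AE x in haar p. vshift \<psi> j h x = ?g x"
    using AE_vmove[OF h eq, of j] AE_space
  proof eventually_elim
    case (elim x)
    then have x: "x \<in> vil p" by (simp add: space_haar)
    have c: "complex_of_real (real p powr (real_of_int j / 2)) * of_nat p =
        of_real (sqrt (real p)) * of_real (real p powr (real_of_int (j + 1) / 2))"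
      using arg_cong[OF p_powr_half_step[of j], of complex_of_real] by (simp add: mult.commute)
    have "vshift \<psi> j h x = (complex_of_real (real p powr (real_of_int j / 2)) * of_nat p) * (\<Sum>\<alpha>\<in>?B. b \<alpha> * \<phi> (vmove 1 \<alpha> (vmove j h x)))"
      using elim(1) by (simp add: vshift_def)
    also have "\<dots> = (of_real (sqrt (real p)) * of_real (real p powr (real_of_int (j + 1) / 2))) * (\<Sum>\<alpha>\<in>?B. b \<alpha> * \<phi> (vmove (j + 1) (vadd p (dil 1 h) \<alpha>) x))"
      unfolding c using x h by (simp add: vmove_vmove vbox_vil)
    also have "\<dots> = ?g x"
      unfolding sum_distrib_left by (intro sum.cong refl) (simp add: vshift_def mult_ac)
    finally show ?case .
  qed
  ultimately have "vinner p f (vshift \<psi> j h) = vinner p f ?g"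
    using f vshift_vL2[OF \<psi> h] by (intro vinner_cong_AE) (auto intro: vL2_measurable)
  also have "\<dots> = (\<Sum>\<alpha>\<in>?B. cnj (of_real (sqrt (real p)) * b \<alpha>) * vinner p f (vshift \<phi> (j + 1) (vadd p (dil 1 h) \<alpha>)))"
    by (rule vinner_sum_right[OF f shift])
  finally show ?thesis by (simp add: sum_distrib_left mult_ac)
qed

lemma AE_neq: "AE x in haar p. x \<noteq> y"
proof (cases "y \<in> vil p")
  case False
  then show ?thesis by (intro AE_I2) (auto simp: space_haar)
next
  case True
  have eq: "{y} = (\<Inter>n::nat. vcoset p y (int n))"
  proof (intro equalityI subsetI)
    fix x assume x: "x \<in> (\<Inter>n::nat. vcoset p y (int n))"
    have "x j = y j" for j
    proof -
      have "x \<in> vcoset p y (int (nat j))" using x by blast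
      then show ?thesis by (simp add: vcoset_def)
    qed
    then show "x \<in> {y}" by auto
  qed (use True in \<open>auto simp: vcoset_def\<close>)
  have sets: "{y} \<in> sets (haar p)"
    unfolding eq using True by (intro sets.countable_INT) (auto simp: vcoset_sets)
  have "emeasure (haar p) {y} = 0"
  proof -
    have "emeasure (haar p) {y} \<le> ennreal ((1 / real p) ^ n)" for n
    proof -
      have "emeasure (haar p) {y} \<le> emeasure (haar p) (vcoset p y (int n))"
        using in_vcoset_self[OF True] by (intro emeasure_mono vcoset_sets[OF True]) auto
      then show ?thesis using True by (simp add: emeasure_vcoset power_int_minus power_one_over divide_inverse power_inverse)
    qed
    moreover have "(\<lambda>n. ennreal ((1 / real p) ^ n)) \<longlonglongrightarrow> ennreal 0"
      using p_ge_2 by (intro tendsto_ennrealI LIMSEQ_realpow_zero) auto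
    ultimately have "emeasure (haar p) {y} \<le> ennreal 0" by (intro LIMSEQ_le_const) auto
    then show ?thesis by simp
  qed
  with sets have "{y} \<in> null_sets (haar p)" by blast
  from AE_not_in[OF this] show ?thesis by simp
qed

lemma vnorm_cong_AE:
  assumes "AE x in haar p. f x = g x" "f \<in> borel_measurable (haar p)" "g \<in> borel_measurable (haar p)"
  shows "vnorm p f = vnorm p g"
proof -
  have "(\<integral>x. (cmod (f x))\<^sup>2 \<partial>haar p) = (\<integral>x. (cmod (g x))\<^sup>2 \<partial>haar p)"
    using assms by (intro integral_cong_AE) (auto, measurable)
  then show ?thesis by (simp add: vnorm_def)
qed

lemma indicator_mult_vL2:
  assumes "f \<in> vL2 p" "A \<in> sets (haar p)"
  shows "(\<lambda>x. indicator A x * f x) \<in> vL2 p"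
proof (rule vL2_mult_bounded[OF assms(1)])
  show "indicator A \<in> borel_measurable (haar p)" using assms by (intro borel_measurable_indicator)
qed (simp add: indicator_def)

lemma vnorm_shrinking_cosets:
  assumes f: "f \<in> vL2 p" and y: "y \<in> vil p"
  shows "(\<lambda>i. vnorm p (\<lambda>x. indicator (vcoset p y (int i)) x * f x)) \<longlonglongrightarrow> 0"
proof -
  \<comment> \<open>The genuine pointwise limit of the restrictions; it can differ from zero only at
    \<open>y\<close>, which is a null set.\<close>
  define g where "g x = (if x = y then f x else 0)" for x
  have "AE x in haar p. 0 = g x" using AE_neq[of y] by eventually_elim (simp add: g_def)
  moreover have lim: "(\<lambda>i. indicator (vcoset p y (int i)) x * f x) \<longlonglongrightarrow> g x" if x: "x \<in> vil p" for x
  proof (cases "x = y")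
    case True
    then show ?thesis using y by (simp add: g_def in_vcoset_self)
  next
    case False
    then obtain j where j: "x j \<noteq> y j" by auto
    have "\<forall>\<^sub>F i in sequentially. indicator (vcoset p y (int i)) x * f x = 0"
      unfolding eventually_sequentially
      by (rule exI[of _ "nat j"]) (use j in \<open>auto simp: vcoset_def indicator_def intro!: exI[of _ j]\<close>)
    then show ?thesis using False by (simp add: g_def tendsto_eventually)
  qed
  have fm: "(\<lambda>x. indicator (vcoset p y (int i)) x * f x) \<in> vL2 p" for i
    using f y by (intro indicator_mult_vL2 vcoset_sets)
  have "g \<in> borel_measurable (haar p)"
    by (rule borel_measurable_LIMSEQ_metric[OF vL2_measurable[OF fm] lim]) (simp add: space_haar)
  ultimately have g0: "vnorm p (\<lambda>x. 0) = vnorm p g" by (intro vnorm_cong_AE) auto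
  have g: "g \<in> vL2 p"
    by (rule vL2_I[OF \<open>g \<in> borel_measurable (haar p)\<close> vL2_integrable[OF f]]) (simp add: g_def)
  have conv: "(\<lambda>i. vnorm p (\<lambda>x. g x - indicator (vcoset p y (int i)) x * f x)) \<longlonglongrightarrow> 0"
    by (rule vnorm_dominated_convergence[OF g f vL2_measurable[OF fm] lim]) (auto simp: indicator_def norm_mult)
  have le: "vnorm p (\<lambda>x. indicator (vcoset p y (int i)) x * f x) \<le> vnorm p (\<lambda>x. g x - indicator (vcoset p y (int i)) x * f x)" for i
    using vnorm_diff_triangle[OF g vL2_diff[OF g fm[of i]]] g0 by (simp add: vnorm_def)
  show ?thesis
    by (rule tendsto_sandwich[OF _ _ tendsto_const conv]) (auto simp: vnorm_nonneg le)
qed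

text \<open>Square sums of coefficients are continuous seminorms, so a Parseval-type identity
  extends from step functions to all of \<open>L\<^sup>2\<close>.\<close>

lemma tight_frame_from_steps:
  fixes g :: "'i \<Rightarrow> (int \<Rightarrow> nat) \<Rightarrow> complex"
  assumes g: "\<And>i. i \<in> X \<Longrightarrow> g i \<in> vL2 p" and C: "C \<ge> 0"
    and steps: "\<And>M L s. vstep M L s \<Longrightarrow> ((\<lambda>i. (cmod (vinner p s (g i)))\<^sup>2) has_sum (C * (vnorm p s)\<^sup>2)) X"
    and f: "f \<in> vL2 p"
  shows "((\<lambda>i. (cmod (vinner p f (g i)))\<^sup>2) has_sum (C * (vnorm p f)\<^sup>2)) X"
proof -
  define Q where "Q F u = L2_set (\<lambda>i. cmod (vinner p u (g i))) F" for F u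
  have Q_sq: "(Q F u)\<^sup>2 = (\<Sum>i\<in>F. (cmod (vinner p u (g i)))\<^sup>2)" for F u
    unfolding Q_def L2_set_def by (simp add: sum_nonneg)
  have Q_diff: "Q F u \<le> Q F v + Q F (\<lambda>x. u x - v x)" if "u \<in> vL2 p" "v \<in> vL2 p" "F \<subseteq> X" for F u v
  proof -
    have "Q F u \<le> L2_set (\<lambda>i. cmod (vinner p v (g i)) + cmod (vinner p (\<lambda>x. u x - v x) (g i))) F"
      unfolding Q_def
    proof (rule L2_set_mono)
      fix i assume "i \<in> F"
      then have "vinner p u (g i) = vinner p v (g i) + vinner p (\<lambda>x. u x - v x) (g i)"
        using that g by (subst vinner_diff_left) auto
      then show "cmod (vinner p u (g i)) \<le> cmod (vinner p v (g i)) + cmod (vinner p (\<lambda>x. u x - v x) (g i))"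
        by (simp add: norm_triangle_ineq)
    qed simp
    also have "\<dots> \<le> Q F v + Q F (\<lambda>x. u x - v x)" unfolding Q_def by (rule L2_set_triangle_ineq)
    finally show ?thesis .
  qed
  have Q_step: "Q F s \<le> sqrt C * vnorm p s" if "vstep M L s" "finite F" "F \<subseteq> X" for F s M L
  proof (rule power2_le_imp_le)
    have "(\<Sum>i\<in>F. (cmod (vinner p s (g i)))\<^sup>2) \<le> C * (vnorm p s)\<^sup>2"
      by (rule finite_sum_le_has_sum[OF steps[OF that(1)] that(2,3)]) simp
    then show "(Q F s)\<^sup>2 \<le> (sqrt C * vnorm p s)\<^sup>2"
      using C by (simp add: Q_sq power_mult_distrib)
  qed (simp add: C vnorm_nonneg)
  have approx: "\<exists>M L s. vstep M L s \<and> vnorm p (\<lambda>x. u x - s x) < \<epsilon>" if "u \<in> vL2 p" "\<epsilon> > 0" for u \<epsilon>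
    using step_functions_dense[OF that(1)] that(2) unfolding vapprox_def by blast
  have norm_le: "vnorm p u \<le> vnorm p v + vnorm p (\<lambda>x. u x - v x)" if "u \<in> vL2 p" "v \<in> vL2 p" for u v
    using vnorm_triangle[OF that(2) vL2_diff[OF that]] by simp
  have norm_sym: "vnorm p (\<lambda>x. u x - v x) = vnorm p (\<lambda>x. v x - u x)" for u v
    by (simp add: vnorm_def norm_minus_commute)
  have Q_bound: "Q F u \<le> sqrt C * vnorm p u" if u: "u \<in> vL2 p" and F: "finite F" "F \<subseteq> X" for F u
  proof (rule field_le_epsilon)
    fix \<epsilon> :: real assume "\<epsilon> > 0"
    \<comment> \<open>\<open>K\<close> depends on \<open>F\<close> through the norms of the
      \<open>g i\<close>. This does no harm, because the step function is chosen afterwards, within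
      distance \<epsilon> / K.\<close>
    define K where "K = sqrt C + L2_set (\<lambda>i. vnorm p (g i)) F + 1"
    have K: "K > 0" using C by (simp add: K_def add_nonneg_pos)
    then obtain M L s where s: "vstep M L s" "vnorm p (\<lambda>x. u x - s x) < \<epsilon> / K"
      using approx[OF u, of "\<epsilon> / K"] \<open>\<epsilon> > 0\<close> by auto
    let ?d = "vnorm p (\<lambda>x. u x - s x)"
    have s2: "s \<in> vL2 p" using s(1) by (rule vstep_vL2)
    have "Q F (\<lambda>x. u x - s x) \<le> L2_set (\<lambda>i. ?d * vnorm p (g i)) F"
      unfolding Q_def using F g u s2 by (intro L2_set_mono cauchy_schwarz vL2_diff) auto
    also have "\<dots> = ?d * L2_set (\<lambda>i. vnorm p (g i)) F"
      by (rule L2_set_right_distrib[symmetric]) (rule vnorm_nonneg)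
    finally have "Q F u \<le> Q F s + ?d * L2_set (\<lambda>i. vnorm p (g i)) F"
      using Q_diff[OF u s2 F(2)] by linarith
    also have "Q F s \<le> sqrt C * vnorm p s" using Q_step[OF s(1) F] .
    also have "\<dots> \<le> sqrt C * (vnorm p u + ?d)"
      using norm_le[OF s2 u] C by (intro mult_left_mono) (auto simp: norm_sym[of s u])
    finally have "Q F u \<le> sqrt C * vnorm p u + ?d * (sqrt C + L2_set (\<lambda>i. vnorm p (g i)) F)"
      by (simp add: algebra_simps)
    also have "?d * (sqrt C + L2_set (\<lambda>i. vnorm p (g i)) F) \<le> ?d * K"
      unfolding K_def by (intro mult_left_mono) (auto simp: vnorm_nonneg)
    also have "?d * K \<le> \<epsilon>" using s(2) K by (simp add: field_simps less_imp_le)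
    finally show "Q F u \<le> sqrt C * vnorm p u + \<epsilon>" by simp
  qed
  have fin: "(\<Sum>i\<in>F. (cmod (vinner p u (g i)))\<^sup>2) \<le> C * (vnorm p u)\<^sup>2" if "u \<in> vL2 p" "finite F" "F \<subseteq> X" for F u
  proof -
    have "(Q F u)\<^sup>2 \<le> (sqrt C * vnorm p u)\<^sup>2"
      using Q_bound[OF that] unfolding Q_def by (intro power_mono) auto
    then show ?thesis using C by (simp add: Q_sq power_mult_distrib)
  qed
  define V where "V = infsum (\<lambda>i. (cmod (vinner p f (g i)))\<^sup>2) X"
  have sumf: "(\<lambda>i. (cmod (vinner p f (g i)))\<^sup>2) summable_on X"
    using fin[OF f] by (intro nonneg_bdd_above_summable_on bdd_aboveI2) auto
  then have V: "((\<lambda>i. (cmod (vinner p f (g i)))\<^sup>2) has_sum V) X" unfolding V_def by (rule has_sum_infsum)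
  have "V \<ge> 0" unfolding V_def by (intro infsum_nonneg) simp
  have "V \<le> C * (vnorm p f)\<^sup>2" using fin[OF f] by (rule has_sum_le_finite_sums[OF V])
  \<comment> \<open>For the reverse inequality the identity for a nearby step function is
    transferred back to \<open>f\<close>. The distance is paid for twice, in the coefficients and in
    the norm, hence the 2 in \<open>K\<close>.\<close>
  moreover have "sqrt C * vnorm p f \<le> sqrt V"
  proof (rule field_le_epsilon)
    fix \<epsilon> :: real assume "\<epsilon> > 0"
    define K where "K = 2 * sqrt C + 1"
    have K: "K > 0" using C by (simp add: K_def add_nonneg_pos)
    then obtain M L s where s: "vstep M L s" "vnorm p (\<lambda>x. f x - s x) < \<epsilon> / K"
      using approx[OF f, of "\<epsilon> / K"] \<open>\<epsilon> > 0\<close> by auto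
    let ?d = "vnorm p (\<lambda>x. f x - s x)"
    have s2: "s \<in> vL2 p" using s(1) by (rule vstep_vL2)
    have "C * (vnorm p s)\<^sup>2 \<le> (sqrt V + sqrt C * ?d)\<^sup>2"
    proof (rule has_sum_le_finite_sums[OF steps[OF s(1)]])
      fix F assume F: "finite F" "F \<subseteq> X"
      have "Q F s \<le> Q F f + Q F (\<lambda>x. s x - f x)" by (rule Q_diff[OF s2 f F(2)])
      also have "Q F (\<lambda>x. s x - f x) \<le> sqrt C * ?d"
        using Q_bound[OF vL2_diff[OF s2 f] F] unfolding norm_sym[of s f] .
      also have "Q F f \<le> sqrt V"
      proof (rule power2_le_imp_le)
        show "(Q F f)\<^sup>2 \<le> (sqrt V)\<^sup>2"
          using finite_sum_le_has_sum[OF V F] \<open>V \<ge> 0\<close> by (simp add: Q_sq)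
      qed (use \<open>V \<ge> 0\<close> in simp)
      finally have "(Q F s)\<^sup>2 \<le> (sqrt V + sqrt C * ?d)\<^sup>2"
        unfolding Q_def by (intro power_mono) auto
      then show "(\<Sum>i\<in>F. (cmod (vinner p s (g i)))\<^sup>2) \<le> (sqrt V + sqrt C * ?d)\<^sup>2" by (simp only: Q_sq)
    qed
    then have "(sqrt C * vnorm p s)\<^sup>2 \<le> (sqrt V + sqrt C * ?d)\<^sup>2" using C by (simp add: power_mult_distrib)
    then have "sqrt C * vnorm p s \<le> sqrt V + sqrt C * ?d"
      by (rule power2_le_imp_le) (simp add: vnorm_nonneg C \<open>V \<ge> 0\<close>)
    moreover have "sqrt C * vnorm p f \<le> sqrt C * (vnorm p s + ?d)"
      using norm_le[OF f s2] C by (intro mult_left_mono) auto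
    ultimately have "sqrt C * vnorm p f \<le> sqrt V + ?d * (2 * sqrt C)" by (simp add: algebra_simps)
    also have "?d * (2 * sqrt C) \<le> ?d * K" unfolding K_def by (intro mult_left_mono) (auto simp: vnorm_nonneg)
    also have "?d * K \<le> \<epsilon>" using s(2) K by (simp add: field_simps less_imp_le)
    finally show "sqrt C * vnorm p f \<le> sqrt V + \<epsilon>" by simp
  qed
  then have "(sqrt C * vnorm p f)\<^sup>2 \<le> (sqrt V)\<^sup>2" using C by (intro power_mono) (auto simp: vnorm_nonneg)
  then have "C * (vnorm p f)\<^sup>2 \<le> V" using C \<open>V \<ge> 0\<close> by (simp add: power_mult_distrib)
  ultimately show ?thesis using V by simp
qed


text \<open>On the group \<open>f\<close> equals its product with the indicator of
  \<open>vU p K\<close>, and a product of two square integrable functions is integrable.\<close>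

lemma integrable_supported:
  assumes "f \<in> vL2 p" "\<And>x. x \<in> vil p \<Longrightarrow> x \<notin> vU p K \<Longrightarrow> f x = 0"
  shows "integrable (haar p) f"
proof -
  have "integrable (haar p) (\<lambda>x. f x * cnj (indicator (vU p K) x))"
    using assms(1) vstep_vL2[OF vstep_indicator_vU] by (rule integrable_vinner)
  then show ?thesis
    by (rule iffD1[OF Bochner_Integration.integrable_cong, rotated -1])
      (use assms(2) in \<open>auto simp: space_haar indicator_def\<close>)
qed

lemma vL2_indicator_vcoset:
  assumes "y \<in> vil p"
  shows "indicator (vcoset p y l) \<in> vL2 p"
proof (rule vL2_I)
  show "indicator (vcoset p y l) \<in> borel_measurable (haar p)"
    using assms by (intro borel_measurable_indicator vcoset_sets)
  show "integrable (haar p) (indicator (vcoset p y l) :: _ \<Rightarrow> real)"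
    using assms by (intro integrable_real_indicator) (simp_all add: vcoset_sets emeasure_vcoset)
qed (simp add: indicator_def)


section \<open>The Fourier transform of compactly supported functions\<close>

lemma vchi_locally_constant:
  assumes "\<omega> \<in> vil p"
  obtains l where "\<And>x y. x \<in> vil p \<Longrightarrow> y \<in> vcoset p x l \<Longrightarrow> vchi p y \<omega> = vchi p x \<omega>"
proof -
  obtain m where m: "\<omega> \<in> vU p (- int m)" using vil_eventually_vU[OF assms] by blast
  have "vchi p y \<omega> = vchi p x \<omega>" if "y \<in> vcoset p x (int m)" for x y
    unfolding vchi_comm[of _ \<omega>]
  proof (rule vchi_cong)
    fix i assume "\<omega> i \<noteq> 0"
    then have "\<not> i \<le> - int m" using m by (auto simp: vU_def)
    then show "y (1 - i) = x (1 - i)" using that by (simp add: vcoset_def)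
  qed
  then show ?thesis by (rule that)
qed

lemma vchi_measurable: "\<omega> \<in> vil p \<Longrightarrow> (\<lambda>x. vchi p x \<omega>) \<in> borel_measurable (haar p)"
  using vchi_locally_constant locally_constant_measurable by metis

text \<open>Cutting a character off to \<open>vU p (- K)\<close> makes it square integrable. For
  functions supported there, the Fourier integral becomes an inner product, to which Bessel's
  inequality applies.\<close>

definition char_on :: "int \<Rightarrow> (int \<Rightarrow> nat) \<Rightarrow> (int \<Rightarrow> nat) \<Rightarrow> complex" where
  "char_on K \<omega> x = indicator (vU p (- K)) x * vchi p x \<omega>"

lemma char_on_measurable: "\<omega> \<in> vil p \<Longrightarrow> char_on K \<omega> \<in> borel_measurable (haar p)"
  unfolding char_on_def[abs_def]
  by (intro borel_measurable_times borel_measurable_indicator vU_sets vchi_measurable)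

lemma char_on_vL2:
  assumes "\<omega> \<in> vil p"
  shows "char_on K \<omega> \<in> vL2 p"
proof -
  have "(\<lambda>x. vchi p x \<omega> * indicator (vU p (- K)) x) \<in> vL2 p"
    using assms by (intro vL2_mult_bounded vstep_vL2[OF vstep_indicator_vU] vchi_measurable) (simp_all add: norm_vchi)
  then show ?thesis by (simp add: char_on_def[abs_def] mult.commute)
qed

lemma vnorm_char_on: "(vnorm p (char_on K \<omega>))\<^sup>2 = real p powi K"
proof -
  have "(vnorm p (char_on K \<omega>))\<^sup>2 = (\<integral>x. indicator (vU p (- K)) x \<partial>haar p)"
    unfolding vnorm_sq by (intro Bochner_Integration.integral_cong) (auto simp: char_on_def norm_mult norm_vchi indicator_def)
  also have "\<dots> = measure (haar p) (vU p (- K) \<inter> space (haar p))" by simp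
  also have "vU p (- K) \<inter> space (haar p) = vcoset p vzero (- K)"
    by (auto simp: space_haar vU_eq_vcoset vcoset_def)
  finally show ?thesis using measure_vcoset[OF vzero_in_vil[OF p_pos], of "- K"] by simp
qed

text \<open>Since \<open>i \<le> K\<close>, translation by \<open>vunit (1 - i)\<close> preserves
  \<open>vU p (- K)\<close>. It leaves the integral unchanged but multiplies the integrand by a
  constant other than 1.\<close>

lemma vinner_char_on_neq:
  assumes w: "\<omega> \<in> vil p" "\<omega>' \<in> vil p" and i: "i \<le> K" "\<omega> i \<noteq> \<omega>' i"
  shows "vinner p (char_on K \<omega>) (char_on K \<omega>') = 0"
proof -
  let ?\<delta> = "vsub p \<omega> \<omega>'"
  define F where "F x = char_on K \<omega> x * cnj (char_on K \<omega>' x)" for x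
  have \<delta>: "?\<delta> \<in> vil p" using w by (rule vsub_closed)
  have "?\<delta> i \<noteq> 0" using w i by (simp add: vsub_eq_0_iff)
  then have c: "vchi p (vunit (1 - i)) ?\<delta> \<noteq> 1" using \<delta> by (intro vchi_vunit_neq_1) auto
  have F_eq: "F x = indicator (vU p (- K)) x * vchi p x ?\<delta>" if "x \<in> vil p" for x
    using that w by (simp add: F_def char_on_def vchi_vsub_right indicator_def)
  have Fm: "F \<in> borel_measurable (haar p)"
    unfolding F_def[abs_def] using char_on_measurable[OF w(1)] char_on_measurable[OF w(2)] by measurable
  have shift: "F (vmove 0 (vunit (1 - i)) x) = cnj (vchi p (vunit (1 - i)) ?\<delta>) * F x" if x: "x \<in> vil p" for x
  proof -
    have mv: "vmove 0 (vunit (1 - i)) x = vsub p x (vunit (1 - i))" by (simp add: vmove_def dil_0)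
    have v: "vsub p x (vunit (1 - i)) \<in> vil p" using x by (intro vsub_closed vunit_closed)
    have "vsub p x (vunit (1 - i)) j = x j" if "j \<le> - K" for j
      using that i x p_pos vil_less[OF x] by (simp add: vsub_def vadd_def vneg_def vunit_def)
    then have "vsub p x (vunit (1 - i)) \<in> vU p (- K) \<longleftrightarrow> x \<in> vU p (- K)"
      using v x by (simp add: vU_def)
    then show ?thesis unfolding mv F_eq[OF v] F_eq[OF x]
      using x \<delta> by (simp add: vchi_vsub_left vunit_closed indicator_def)
  qed
  have "(\<integral>x. F x \<partial>haar p) = (\<integral>x. F (vmove 0 (vunit (1 - i)) x) \<partial>haar p)"
    using integral_vmove[OF vunit_closed Fm, of 0 "1 - i"] by simp
  also have "\<dots> = (\<integral>x. cnj (vchi p (vunit (1 - i)) ?\<delta>) * F x \<partial>haar p)"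
    using shift by (intro Bochner_Integration.integral_cong) (auto simp: space_haar)
  also have "\<dots> = cnj (vchi p (vunit (1 - i)) ?\<delta>) * (\<integral>x. F x \<partial>haar p)" by simp
  finally have "(1 - cnj (vchi p (vunit (1 - i)) ?\<delta>)) * (\<integral>x. F x \<partial>haar p) = 0"
    by (simp add: left_diff_distrib)
  moreover have "1 - cnj (vchi p (vunit (1 - i)) ?\<delta>) \<noteq> 0"
    using c by (metis complex_cnj_cnj complex_cnj_one right_minus_eq)
  ultimately show ?thesis by (simp add: vinner_def F_def[abs_def])
qed

lemma fourier_integral_char_on:
  assumes "\<And>x. x \<in> vil p \<Longrightarrow> x \<notin> vU p (- K) \<Longrightarrow> f x = 0"
  shows "fourier_integral p f \<omega> = vinner p f (char_on K \<omega>)"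
  unfolding fourier_integral_def vinner_def using assms
  by (intro Bochner_Integration.integral_cong) (auto simp: char_on_def indicator_def space_haar)

lemma fourier_integral_locally_constant:
  assumes "\<And>x. x \<in> vil p \<Longrightarrow> x \<notin> vU p (- K) \<Longrightarrow> f x = 0" "\<omega>' \<in> vcoset p \<omega> K"
  shows "fourier_integral p f \<omega>' = fourier_integral p f \<omega>"
proof -
  have "vchi p x \<omega>' = vchi p x \<omega>" if "x \<in> vU p (- K)" for x
  proof (rule vchi_cong)
    fix j assume "x j \<noteq> 0"
    then have "\<not> j \<le> - K" using that by (auto simp: vU_def)
    then show "\<omega>' (1 - j) = \<omega> (1 - j)" using assms(2) by (simp add: vcoset_def)
  qed
  then show ?thesis unfolding fourier_integral_def using assms(1)
    by (intro Bochner_Integration.integral_cong) (auto simp: space_haar)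
qed

text \<open>The elements \<open>dil (- K) h\<close> with \<open>h\<close> in H vanish beyond index
  \<open>K\<close> and realise every pattern of coordinates up to \<open>K\<close> exactly once, so
  they represent the cosets of level \<open>K\<close>.\<close>

lemma vil_coset_partition:
  shows "disjoint_family (\<lambda>k. vcoset p (dil (- K) (vh p k)) K)"
    and "(\<Union>k. vcoset p (dil (- K) (vh p k)) K) = vil p"
proof -
  have high: "dil (- K) (vh p k) i = 0" if "i > K" for i k
    using vh_in_vH[of k] that by (simp add: vH_def dil_def)
  show "disjoint_family (\<lambda>k. vcoset p (dil (- K) (vh p k)) K)"
    unfolding disjoint_family_on_def
  proof (intro ballI impI)
    fix k l :: nat assume "k \<noteq> l"
    show "vcoset p (dil (- K) (vh p k)) K \<inter> vcoset p (dil (- K) (vh p l)) K = {}"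
    proof (rule ccontr)
      assume "vcoset p (dil (- K) (vh p k)) K \<inter> vcoset p (dil (- K) (vh p l)) K \<noteq> {}"
      then have "dil (- K) (vh p k) i = dil (- K) (vh p l) i" for i
        using high by (cases "i > K") (fastforce simp: vcoset_def)+
      then have "dil (- K) (vh p k) = dil (- K) (vh p l)" by blast
      then have "dil K (dil (- K) (vh p k)) = dil K (dil (- K) (vh p l))" by simp
      then have "vh p k = vh p l" by (simp add: dil_dil dil_0)
      then show False using bij_betw_vh \<open>k \<noteq> l\<close> by (auto simp: bij_betw_def inj_on_def)
    qed
  qed
  show "(\<Union>k. vcoset p (dil (- K) (vh p k)) K) = vil p"
  proof (intro equalityI subsetI)
    fix \<omega> assume w: "\<omega> \<in> vil p"
    obtain l where l: "\<omega> \<in> vU p (- int l)" using vil_eventually_vU[OF w] by blast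
    have "vtrunc (- int l) K \<omega> \<in> vbox (- int l) K" using w by (rule vtrunc_vbox)
    from dil_vbox[OF this, of K] have "dil K (vtrunc (- int l) K \<omega>) \<in> vH p"
      using vbox_subset_vH[of "- int l - K"] by auto
    then obtain k where k: "dil K (vtrunc (- int l) K \<omega>) = vh p k"
      using bij_betw_vh by (auto simp: bij_betw_def)
    have "\<omega> j = dil (- K) (vh p k) j" if "j \<le> K" for j
      unfolding k[symmetric] using that l by (simp add: dil_dil dil_0 vtrunc_def vU_def)
    then show "\<omega> \<in> (\<Union>k. vcoset p (dil (- K) (vh p k)) K)" using w by (auto simp: vcoset_def)
  qed (auto simp: vcoset_def)
qed

text \<open>The transform is constant on cosets of level \<open>K\<close>, so its square integral is
  a series over coset representatives. Its values there are inner products with orthogonal truncated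
  characters, and Bessel's inequality bounds the series; the square norm p^K of these characters
  cancels the measure p^(-K) of the cosets.\<close>

lemma fourier_integral_vL2:
  assumes f: "f \<in> vL2 p" and supp: "\<And>x. x \<in> vil p \<Longrightarrow> x \<notin> vU p (- K) \<Longrightarrow> f x = 0"
  shows "fourier_integral p f \<in> vL2 p"
proof -
  define e where "e k = dil (- K) (vh p k)" for k
  have e: "e k \<in> vil p" for k by (simp add: e_def dil_closed vh_vil)
  let ?\<Phi> = "fourier_integral p f"
  have m: "?\<Phi> \<in> borel_measurable (haar p)"
    by (rule locally_constant_measurable[where L = K]) (rule fourier_integral_locally_constant[OF supp])
  then have m2: "(\<lambda>\<omega>. (cmod (?\<Phi> \<omega>))\<^sup>2) \<in> borel_measurable (haar p)" by measurable
  have disj: "disjoint_family (\<lambda>k. vcoset p (e k) K)" and un: "(\<Union>k. vcoset p (e k) K) = vil p"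
    unfolding e_def by (rule vil_coset_partition)+
  have orth: "vinner p (char_on K (e k)) (char_on K (e l)) = (if k = l then of_real (real p powi K) else 0)" for k l
  proof (cases "k = l")
    case True
    then show ?thesis by (simp add: vinner_self vnorm_char_on del: of_real_power)
  next
    case False
    have "\<exists>i\<le>K. e k i \<noteq> e l i"
    proof (rule ccontr)
      assume "\<not> (\<exists>i\<le>K. e k i \<noteq> e l i)"
      then have "e k \<in> vcoset p (e k) K \<inter> vcoset p (e l) K" using e by (auto simp: vcoset_def)
      with disj False show False by (auto simp: disjoint_family_on_def)
    qed
    then show ?thesis using vinner_char_on_neq[OF e e] False by auto
  qed
  have partial: "(\<Sum>k<N. (cmod (?\<Phi> (e k)))\<^sup>2 * real p powi (- K)) \<le> (vnorm p f)\<^sup>2" for N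
  proof -
    have "(\<Sum>k<N. (cmod (?\<Phi> (e k)))\<^sup>2) = (\<Sum>k<N. (cmod (vinner p f (char_on K (e k))))\<^sup>2)"
      by (simp only: fourier_integral_char_on[OF supp])
    also have "\<dots> \<le> real p powi K * (vnorm p f)\<^sup>2"
      using p_pos by (intro bessel f char_on_vL2 e orth) auto
    finally have "(\<Sum>k<N. (cmod (?\<Phi> (e k)))\<^sup>2) * real p powi (- K) \<le> real p powi K * (vnorm p f)\<^sup>2 * real p powi (- K)"
      by (intro mult_right_mono) auto
    also have "\<dots> = (vnorm p f)\<^sup>2" using p_pos by (simp add: power_int_minus)
    finally show ?thesis by (simp add: sum_distrib_right)
  qed
  have "(\<integral>\<^sup>+\<omega>. ennreal ((cmod (?\<Phi> \<omega>))\<^sup>2) \<partial>haar p) = (\<integral>\<^sup>+\<omega>\<in>(\<Union>k. vcoset p (e k) K). ennreal ((cmod (?\<Phi> \<omega>))\<^sup>2) \<partial>haar p)"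
    unfolding un by (intro nn_integral_cong) (simp add: space_haar)
  also have "\<dots> = (\<Sum>k. \<integral>\<^sup>+\<omega>\<in>vcoset p (e k) K. ennreal ((cmod (?\<Phi> \<omega>))\<^sup>2) \<partial>haar p)"
    by (intro nn_integral_disjoint_family measurable_compose[OF m2 measurable_ennreal] vcoset_sets e disj)
  also have "\<dots> = (\<Sum>k. ennreal ((cmod (?\<Phi> (e k)))\<^sup>2 * real p powi (- K)))"
  proof (rule suminf_cong)
    fix k
    have "(\<integral>\<^sup>+\<omega>\<in>vcoset p (e k) K. ennreal ((cmod (?\<Phi> \<omega>))\<^sup>2) \<partial>haar p)
        = (\<integral>\<^sup>+\<omega>. ennreal ((cmod (?\<Phi> (e k)))\<^sup>2) * indicator (vcoset p (e k) K) \<omega> \<partial>haar p)"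
      using fourier_integral_locally_constant[of K f _ "e k", OF supp]
      by (intro nn_integral_cong) (auto simp: indicator_def)
    also have "\<dots> = ennreal ((cmod (?\<Phi> (e k)))\<^sup>2) * ennreal (real p powi (- K))"
      using e by (simp add: nn_integral_cmult_indicator vcoset_sets emeasure_vcoset)
    also have "\<dots> = ennreal ((cmod (?\<Phi> (e k)))\<^sup>2 * real p powi (- K))" by (simp add: ennreal_mult)
    finally show "(\<integral>\<^sup>+\<omega>\<in>vcoset p (e k) K. ennreal ((cmod (?\<Phi> \<omega>))\<^sup>2) \<partial>haar p) = ennreal ((cmod (?\<Phi> (e k)))\<^sup>2 * real p powi (- K))" .
  qed
  also have "\<dots> \<le> ennreal ((vnorm p f)\<^sup>2)"
  proof (rule suminf_le_const[OF summableI])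
    fix N
    have "(\<Sum>k<N. ennreal ((cmod (?\<Phi> (e k)))\<^sup>2 * real p powi (- K))) = ennreal (\<Sum>k<N. (cmod (?\<Phi> (e k)))\<^sup>2 * real p powi (- K))"
      by (intro sum_ennreal) simp
    also have "\<dots> \<le> ennreal ((vnorm p f)\<^sup>2)" by (intro ennreal_leI partial)
    finally show "(\<Sum>k<N. ennreal ((cmod (?\<Phi> (e k)))\<^sup>2 * real p powi (- K))) \<le> ennreal ((vnorm p f)\<^sup>2)" .
  qed
  also have "\<dots> < \<infinity>" by simp
  finally have "integrable (haar p) (\<lambda>\<omega>. (cmod (?\<Phi> \<omega>))\<^sup>2)"
    by (intro integrableI_nonneg m2) auto
  with m show ?thesis by (simp add: vL2_def)
qed

text \<open>The constant sequence \<open>f\<close> serves as the approximating one: it is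
  integrable, and \<open>g\<close> belongs to the same class.\<close>

lemma has_fourier_transform_compact:
  assumes f: "f \<in> vL2 p" and supp: "\<And>x. x \<in> vil p \<Longrightarrow> x \<notin> vU p (- K) \<Longrightarrow> f x = 0"
    and g: "g \<in> vL2 p" "AE x in haar p. g x = f x"
  shows "has_fourier_transform p g (fourier_integral p f)"
proof -
  have ft: "fourier_integral p f \<in> vL2 p" using f supp by (rule fourier_integral_vL2)
  have i: "integrable (haar p) f" using f supp by (rule integrable_supported)
  have "AE x in haar p. f x - g x = 0" using g(2) by eventually_elim simp
  then have "vnorm p (\<lambda>x. f x - g x) = vnorm p (\<lambda>x. 0)"
    using vL2_measurable[OF vL2_diff[OF f g(1)]] by (intro vnorm_cong_AE) auto
  then show ?thesis
    unfolding has_fourier_transform_def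
    by (intro conjI g(1) ft exI[of _ "\<lambda>_. f"]) (simp_all add: f i ft vnorm_def)
qed

lemma topspace_vtop: "topspace (vtop p) = vil p"
proof (rule equalityI)
  show "topspace (vtop p) \<subseteq> vil p"
    by (rule conjunct1[OF iffD1[OF openin_vtop_iff openin_topspace]])
  have "openin (vtop p) (vil p)"
    unfolding openin_vtop_iff by (auto simp: vcoset_def)
  then show "vil p \<subseteq> topspace (vtop p)" by (rule openin_subset)
qed

text \<open>This map inverts \<open>vmove 1 \<alpha>\<close>, as \<open>expand_vmove\<close> shows.
  It carries a compact set supporting \<phi> to one supporting a single summand of a
  wavelet.\<close>

lemma continuous_map_expand:
  assumes "\<alpha> \<in> vil p"
  shows "continuous_map (vtop p) (vtop p) (\<lambda>y. dil (-1) (vadd p y \<alpha>))"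
  unfolding continuous_map_def topspace_vtop
proof (intro conjI allI impI)
  show "(\<lambda>y. dil (-1) (vadd p y \<alpha>)) \<in> vil p \<rightarrow> vil p"
    using assms by (auto intro: dil_closed vadd_closed)
  fix S assume S: "openin (vtop p) S"
  show "openin (vtop p) {y \<in> vil p. dil (-1) (vadd p y \<alpha>) \<in> S}"
    unfolding openin_vtop_iff
  proof (intro conjI ballI)
    fix y assume y: "y \<in> {y \<in> vil p. dil (-1) (vadd p y \<alpha>) \<in> S}"
    then obtain l where l: "vcoset p (dil (-1) (vadd p y \<alpha>)) l \<subseteq> S" using S by (auto simp: openin_vtop_iff)
    have "vcoset p y l \<subseteq> {y \<in> vil p. dil (-1) (vadd p y \<alpha>) \<in> S}"
    proof
      fix z assume z: "z \<in> vcoset p y l"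
      then have "z \<in> vil p" by (simp add: vcoset_def)
      moreover have "dil (-1) (vadd p z \<alpha>) \<in> vcoset p (dil (-1) (vadd p y \<alpha>)) l"
        using z assms by (simp add: vcoset_def dil_closed vadd_closed) (simp add: dil_def vadd_def)
      ultimately show "z \<in> {y \<in> vil p. dil (-1) (vadd p y \<alpha>) \<in> S}" using l by blast
    qed
    then show "\<exists>l. vcoset p y l \<subseteq> {y \<in> vil p. dil (-1) (vadd p y \<alpha>) \<in> S}" by blast
  qed auto
qed

lemma expand_vmove:
  assumes "\<alpha> \<in> vil p" "x \<in> vil p"
  shows "dil (-1) (vadd p (vmove 1 \<alpha> x) \<alpha>) = x"
  using assms by (simp add: vmove_def vadd_vsub_cancel dil_closed dil_dil dil_0)

end

section \<open>Scaling functions\<close>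

text \<open>The support condition is pointwise and not merely almost everywhere: \<phi> is a
  representative that has been cut off to \<open>vU p (- int R)\<close>. The coefficients are
  indexed by group elements, so that sums of translations make sense.\<close>

locale scaling_function = vilenkin +
  fixes \<phi> :: "(int \<Rightarrow> nat) \<Rightarrow> complex" and R n :: nat and a :: "(int \<Rightarrow> nat) \<Rightarrow> complex"
  assumes phi_L2: "\<phi> \<in> vL2 p"
    and phi_support: "\<And>x. x \<in> vil p \<Longrightarrow> x \<notin> vU p (- int R) \<Longrightarrow> \<phi> x = 0"
    and phi_nontrivial: "\<not> (AE x in haar p. \<phi> x = 0)"
    and refinement: "AE x in haar p. \<phi> x = of_nat p * (\<Sum>\<alpha>\<in>vbox (- int n) 0. a \<alpha> * \<phi> (vmove 1 \<alpha> x))"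
begin

definition mean :: complex where "mean = (\<integral>x. \<phi> x \<partial>haar p)"

lemma phi_measurable: "\<phi> \<in> borel_measurable (haar p)"
  using phi_L2 by (rule vL2_measurable)

lemma phi_integrable: "integrable (haar p) \<phi>"
  using phi_L2 phi_support by (rule integrable_supported)

text \<open>Dilation contributes a factor 1/p to each integral, which cancels the p in front of the
  sum. The functions \<open>g \<alpha>\<close> may vary with \<alpha>, so as to cover the
  restrictions of \<phi> to cosets and its products with characters.\<close>

lemma integral_refined:
  fixes w :: "(int \<Rightarrow> nat) \<Rightarrow> complex"
  assumes G: "\<And>\<alpha>. \<alpha> \<in> vbox (- int n) 0 \<Longrightarrow> g \<alpha> \<in> borel_measurable (haar p)"
      "\<And>\<alpha>. \<alpha> \<in> vbox (- int n) 0 \<Longrightarrow> integrable (haar p) (g \<alpha>)"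
    and w: "w \<in> borel_measurable (haar p)"
    and eq: "AE x in haar p. w x = of_nat p * (\<Sum>\<alpha>\<in>vbox (- int n) 0. c \<alpha> * g \<alpha> (vmove 1 \<alpha> x))"
  shows "(\<integral>x. w x \<partial>haar p) = (\<Sum>\<alpha>\<in>vbox (- int n) 0. c \<alpha> * (\<integral>x. g \<alpha> x \<partial>haar p))"
proof -
  let ?B = "vbox (- int n) 0"
  have i: "integrable (haar p) (\<lambda>x. g \<alpha> (vmove 1 \<alpha> x))" if "\<alpha> \<in> ?B" for \<alpha>
    using integrable_vmove_iff[OF vbox_vil[OF that] G(1)[OF that], of 1] G(2)[OF that] by simp
  then have i2: "integrable (haar p) (\<lambda>x. of_nat p * (\<Sum>\<alpha>\<in>?B. c \<alpha> * g \<alpha> (vmove 1 \<alpha> x)))"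
    by (intro integrable_mult_right Bochner_Integration.integrable_sum)
  have "(\<integral>x. w x \<partial>haar p) = (\<integral>x. of_nat p * (\<Sum>\<alpha>\<in>?B. c \<alpha> * g \<alpha> (vmove 1 \<alpha> x)) \<partial>haar p)"
    using eq w borel_measurable_integrable[OF i2] by (intro integral_cong_AE) auto
  also have "\<dots> = of_nat p * (\<Sum>\<alpha>\<in>?B. c \<alpha> * (\<integral>x. g \<alpha> (vmove 1 \<alpha> x) \<partial>haar p))"
    using i by (simp add: Bochner_Integration.integral_sum)
  also have "\<dots> = of_nat p * (\<Sum>\<alpha>\<in>?B. c \<alpha> * (of_real (real p powi (- 1)) * (\<integral>x. g \<alpha> x \<partial>haar p)))"
    using integral_vmove[OF vbox_vil G(1), of _ "- int n" 0 _ 1] by (simp add: scaleR_conv_of_real cong: sum.cong)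
  also have "\<dots> = (\<Sum>\<alpha>\<in>?B. c \<alpha> * (\<integral>x. g \<alpha> x \<partial>haar p))"
    unfolding sum_distrib_left using p_pos by (intro sum.cong refl) (simp add: power_int_minus)
  finally show ?thesis .
qed

lemma mean_refinement: "mean = (\<Sum>\<alpha>\<in>vbox (- int n) 0. a \<alpha>) * mean"
  unfolding mean_def sum_distrib_right
  using integral_refined[of "\<lambda>_. \<phi>", OF phi_measurable phi_integrable phi_measurable refinement] .

lemma phi_coset_integrable: "y \<in> vil p \<Longrightarrow> integrable (haar p) (\<lambda>x. indicator (vcoset p y l) x * \<phi> x)"
  using integrable_vinner[OF phi_L2 vL2_indicator_vcoset, of y l]
  by (rule iffD1[OF Bochner_Integration.integrable_cong, rotated -1]) (auto simp: indicator_def)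

text \<open>\<open>vmove 1 \<alpha>\<close> carries the coset of \<open>y\<close> of level
  \<open>l + 1\<close> to a coset of level \<open>l\<close>; integrals over fine cosets are thus
  combinations of integrals over coarser ones.\<close>

lemma coset_integral_refinement:
  assumes y: "y \<in> vil p"
  shows "(\<integral>x. indicator (vcoset p y (l + 1)) x * \<phi> x \<partial>haar p) =
    (\<Sum>\<alpha>\<in>vbox (- int n) 0. a \<alpha> * (\<integral>x. indicator (vcoset p (vsub p (dil 1 y) \<alpha>) l) x * \<phi> x \<partial>haar p))"
proof (rule integral_refined)
  fix \<alpha> assume "\<alpha> \<in> vbox (- int n) 0"
  then have "vsub p (dil 1 y) \<alpha> \<in> vil p" using y by (simp add: vsub_closed dil_closed vbox_vil)
  then show "integrable (haar p) (\<lambda>x. indicator (vcoset p (vsub p (dil 1 y) \<alpha>) l) x * \<phi> x)"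
    by (rule phi_coset_integrable)
  then show "(\<lambda>x. indicator (vcoset p (vsub p (dil 1 y) \<alpha>) l) x * \<phi> x) \<in> borel_measurable (haar p)"
    by (rule borel_measurable_integrable)
next
  show "(\<lambda>x. indicator (vcoset p y (l + 1)) x * \<phi> x) \<in> borel_measurable (haar p)"
    using phi_coset_integrable[OF y] by (rule borel_measurable_integrable)
  show "AE x in haar p. indicator (vcoset p y (l + 1)) x * \<phi> x = of_nat p *
      (\<Sum>\<alpha>\<in>vbox (- int n) 0. a \<alpha> * (indicator (vcoset p (vsub p (dil 1 y) \<alpha>) l) (vmove 1 \<alpha> x) * \<phi> (vmove 1 \<alpha> x)))"
    using refinement AE_space
  proof eventually_elim
    case (elim x)
    then have x: "x \<in> vil p" by (simp add: space_haar)
    have ind: "indicator (vcoset p (vsub p (dil 1 y) \<alpha>) l) (vmove 1 \<alpha> x) = (indicator (vcoset p y (l + 1)) x :: complex)"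
      if "\<alpha> \<in> vbox (- int n) 0" for \<alpha>
    proof -
      have \<alpha>: "\<alpha> \<in> vil p" using that by (rule vbox_vil)
      have "vmove 1 \<alpha> x \<in> vcoset p (vsub p (dil 1 y) \<alpha>) l \<longleftrightarrow> x \<in> vcoset p y (l + 1)"
        using vmove_in_vcoset_iff[OF x \<alpha> vsub_closed[OF dil_closed[OF y] \<alpha>], of 1 1 l] \<alpha> y
        by (simp add: vadd_vsub_cancel dil_closed dil_dil dil_0)
      then show ?thesis by (simp add: indicator_def)
    qed
    have "(\<Sum>\<alpha>\<in>vbox (- int n) 0. a \<alpha> * (indicator (vcoset p (vsub p (dil 1 y) \<alpha>) l) (vmove 1 \<alpha> x) * \<phi> (vmove 1 \<alpha> x)))
        = (\<Sum>\<alpha>\<in>vbox (- int n) 0. indicator (vcoset p y (l + 1)) x * (a \<alpha> * \<phi> (vmove 1 \<alpha> x)))"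
      by (intro sum.cong refl) (simp add: ind)
    also have "\<dots> = indicator (vcoset p y (l + 1)) x * (\<Sum>\<alpha>\<in>vbox (- int n) 0. a \<alpha> * \<phi> (vmove 1 \<alpha> x))"
      by (simp add: sum_distrib_left)
    finally show ?case unfolding elim(1) by (simp only: mult.left_commute)
  qed
qed

text \<open>If the integral vanished, the refinement equation would propagate the vanishing of coset
  integrals from coarse cosets to all finer ones, and \<open>\<phi>\<close> would be orthogonal to all step functions.\<close>

lemma mean_neq_0: "mean \<noteq> 0"
proof
  assume mean: "mean = 0"
  have zero: "(\<integral>x. indicator (vcoset p y (- int R + int k)) x * \<phi> x \<partial>haar p) = 0" if "y \<in> vil p" for y k
    using that
  proof (induction k arbitrary: y)
    case 0
    \<comment> \<open>A coset of level \<open>- int R\<close> is either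
      \<open>vU p (- int R)\<close> itself, giving the full integral, or disjoint from it and hence
      from the support.\<close>
    show ?case
    proof (cases "y \<in> vU p (- int R)")
      case True
      then have "vcoset p y (- int R + int 0) = vU p (- int R)" by (auto simp: vcoset_def vU_def)
      then have "(\<integral>x. indicator (vcoset p y (- int R + int 0)) x * \<phi> x \<partial>haar p) = mean"
        unfolding mean_def using phi_support
        by (intro Bochner_Integration.integral_cong) (auto simp: space_haar indicator_def)
      then show ?thesis using mean by simp
    next
      case False
      then have "x \<notin> vU p (- int R)" if "x \<in> vcoset p y (- int R)" for x
        using that 0 by (auto simp: vcoset_def vU_def)
      then have "indicator (vcoset p y (- int R + int 0)) x * \<phi> x = 0" if "x \<in> vil p" for x
        using phi_support[OF that] by (auto simp: indicator_def)
      then show ?thesis by (intro integral_eq_zero_AE AE_I2) (simp add: space_haar)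
    qed
  next
    case (Suc k)
    have "(\<integral>x. indicator (vcoset p y ((- int R + int k) + 1)) x * \<phi> x \<partial>haar p) = 0"
      unfolding coset_integral_refinement[OF Suc.prems]
    proof (intro sum.neutral ballI)
      fix \<alpha> assume "\<alpha> \<in> vbox (- int n) 0"
      then have "vsub p (dil 1 y) \<alpha> \<in> vil p" using Suc.prems by (simp add: vsub_closed dil_closed vbox_vil)
      from Suc.IH[OF this] show "a \<alpha> * (\<integral>x. indicator (vcoset p (vsub p (dil 1 y) \<alpha>) (- int R + int k)) x * \<phi> x \<partial>haar p) = 0"
        by (simp only: mult_zero_right)
    qed
    then show ?case by (simp add: algebra_simps)
  qed
  have "vinner p \<phi> s = 0" if s: "vstep M L s" for M L s
  proof -
    define L' where "L' = max (max M L) (- int R)"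
    have "- int R \<le> L'" by (simp add: L'_def)
    then have L'_eq: "L' = - int R + int (nat (L' + int R))" by simp
    have s': "vstep M L' s" using s by (rule vstep_mono) (auto simp: L'_def)
    have "vinner p \<phi> s = vinner p \<phi> (\<lambda>x. \<Sum>e\<in>vbox M L'. s e * indicator (vcoset p e L') x)"
      unfolding vinner_def using vstep_repr[OF s'] 
      by (intro Bochner_Integration.integral_cong) (auto simp: space_haar L'_def)
    also have "\<dots> = (\<Sum>e\<in>vbox M L'. cnj (s e) * vinner p \<phi> (indicator (vcoset p e L')))"
      using vL2_indicator_vcoset vbox_vil by (intro vinner_sum_right[OF phi_L2]) auto
    also have "\<dots> = 0"
    proof (intro sum.neutral ballI)
      fix e assume e: "e \<in> vbox M L'"
      have "vinner p \<phi> (indicator (vcoset p e L')) = (\<integral>x. indicator (vcoset p e L') x * \<phi> x \<partial>haar p)"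
        unfolding vinner_def by (intro Bochner_Integration.integral_cong) (auto simp: indicator_def)
      also have "\<dots> = 0"
        using zero[OF vbox_vil[OF e], of "nat (L' + int R)"] unfolding L'_eq[symmetric] .
      finally show "cnj (s e) * vinner p \<phi> (indicator (vcoset p e L')) = 0" by simp
    qed
    finally show ?thesis .
  qed
  then have "AE x in haar p. \<phi> x = 0" by (rule vL2_orthogonal_steps_eq_0[OF phi_L2])
  with phi_nontrivial show False ..
qed

text \<open>Integrating the refinement equation gives this up to the factor \<open>mean\<close>,
  which can be cancelled. The sum is the value of the mask at zero.\<close>

lemma sum_a: "(\<Sum>\<alpha>\<in>vbox (- int n) 0. a \<alpha>) = 1"
proof -
  have "(\<Sum>\<alpha>\<in>vbox (- int n) 0. a \<alpha>) * mean = 1 * mean"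
    using mean_refinement[symmetric] by (simp only: mult_1)
  then show ?thesis using mean_neq_0 mult_right_cancel by blast
qed

section \<open>Coefficients and energies of step functions\<close>

definition coef :: "((int \<Rightarrow> nat) \<Rightarrow> complex) \<Rightarrow> int \<Rightarrow> (int \<Rightarrow> nat) \<Rightarrow> complex" where
  "coef f j h = vinner p f (vshift \<phi> j h)"

text \<open>Where \<open>f\<close> does not vanish, coordinate \<open>i\<close> of
  \<open>dil j x\<close> is 0 because \<open>i + j \<le> M\<close>; where the shifted \<phi> does
  not vanish, it equals \<open>h i\<close>. The two supports are therefore disjoint.\<close>

lemma coef_eq_0:
  assumes f: "vstep M L f" and h: "h \<in> vil p" "h i \<noteq> 0" and i: "i \<le> - int R" "i \<le> M - j"
  shows "coef f j h = 0"
proof -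
  have "f x * cnj (vshift \<phi> j h x) = 0" if x: "x \<in> vil p" for x
  proof (cases "x \<in> vU p M \<and> vmove j h x \<in> vU p (- int R)")
    case True
    then have "vmove j h x i = 0" "dil j x i = 0" using i by (auto simp: vU_def dil_def)
    then have "dil j x i = h i" "dil j x i = 0"
      using x h by (simp_all add: vmove_def vsub_eq_0_iff dil_closed)
    with h show ?thesis by simp
  next
    case False
    then have "f x = 0 \<or> \<phi> (vmove j h x) = 0"
      using f x h phi_support[OF vmove_closed[OF h(1) x]] by (auto simp: vstep_def)
    then show ?thesis by (auto simp: vshift_def)
  qed
  then show ?thesis unfolding coef_def vinner_def
    by (intro integral_eq_zero_AE AE_I2) (simp add: space_haar)
qed

lemma coef_support:
  assumes f: "vstep M L f" and h: "h \<in> vH p" "coef f j h \<noteq> 0" and Q: "Q \<ge> R" "int Q \<ge> j - M"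
  shows "h \<in> vbox (- int Q) 0"
proof -
  have "- int Q < i \<and> i \<le> 0" if "h i \<noteq> 0" for i
  proof
    show "i \<le> 0"
    proof (rule ccontr)
      assume "\<not> i \<le> 0"
      with h(1) have "h i = 0" by (simp add: vH_def)
      with that show False by simp
    qed
    show "- int Q < i" using coef_eq_0[OF f vH_vil[OF h(1)] that, of j] h Q by linarith
  qed
  then show ?thesis using h by (simp add: vbox_def vH_vil)
qed

text \<open>Restricting to nonzero coefficients makes this an ordinary finite sum for step
  functions, independent of the choice of a window. For other \<open>f\<close> the index set may be
  infinite, and the value is then the default 0.\<close>

definition energy :: "((int \<Rightarrow> nat) \<Rightarrow> complex) \<Rightarrow> int \<Rightarrow> real" where
  "energy f j = (\<Sum>h | h \<in> vH p \<and> coef f j h \<noteq> 0. (cmod (coef f j h))\<^sup>2)"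

lemma energy_eq:
  assumes f: "vstep M L f" and Q: "Q \<ge> R" "int Q \<ge> j - M"
  shows "energy f j = (\<Sum>h\<in>vbox (- int Q) 0. (cmod (coef f j h))\<^sup>2)"
  unfolding energy_def
  using coef_support[OF f _ _ Q] vbox_subset_vH finite_vbox by (intro sum.mono_neutral_left) auto

text \<open>Each coefficient reduces to the value of \<open>f\<close> at \<open>dil (- j) h\<close>,
  times p^(-j/2) and the conjugate of \<open>mean\<close>. The points \<open>dil (- j) h\<close>
  with \<open>h\<close> in \<open>vbox (M - j) 0\<close> represent the cosets of level
  \<open>j\<close> inside \<open>vU p M\<close>, so the squares add up to the norm by
  \<open>vstep_vnorm\<close>.\<close>

lemma energy_high:
  assumes f: "vstep M L f" "M \<le> L" and j: "j \<ge> L + int R"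
  shows "energy f j = (cmod mean)\<^sup>2 * (vnorm p f)\<^sup>2"
proof -
  have c: "coef f j h = f (dil (- j) h) * of_real (real p powr (real_of_int j / 2) * real p powi (- j)) * cnj mean"
    if h: "h \<in> vil p" for h
  proof -
    let ?t = "real p powr (real_of_int j / 2)"
    have "f x * cnj (vshift \<phi> j h x) = f (dil (- j) h) * of_real ?t * cnj (\<phi> (vmove j h x))" if x: "x \<in> vil p" for x
    proof (cases "vmove j h x \<in> vU p (- int R)")
      case True
      then have "x \<in> vcoset p (dil (- j) h) (- int R + j)"
        using vmove_in_vcoset_iff[OF x h vzero_in_vil[OF p_pos], of j "- int R"] h
        by (simp add: vU_eq_vcoset vadd_vzero_left)
      then have "x \<in> vcoset p (dil (- j) h) L"
        using j vcoset_antimono[of L "- int R + j" p "dil (- j) h"] by auto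
      then have "f x = f (dil (- j) h)" using f h by (simp add: vstep_def dil_closed)
      then show ?thesis by (simp add: vshift_def)
    next
      case False
      then show ?thesis using phi_support[OF vmove_closed[OF h x]] by (simp add: vshift_def)
    qed
    then have "coef f j h = (\<integral>x. f (dil (- j) h) * of_real ?t * cnj (\<phi> (vmove j h x)) \<partial>haar p)"
      unfolding coef_def vinner_def by (intro Bochner_Integration.integral_cong) (auto simp: space_haar)
    also have "\<dots> = f (dil (- j) h) * of_real ?t * cnj (\<integral>x. \<phi> (vmove j h x) \<partial>haar p)"
      by simp
    also have "(\<integral>x. \<phi> (vmove j h x) \<partial>haar p) = of_real (real p powi (- j)) * mean"
      using integral_vmove[OF h phi_measurable, of j] by (simp add: mean_def scaleR_conv_of_real)
    finally show ?thesis by (simp add: mult_ac)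
  qed
  have c2: "(cmod (coef f j h))\<^sup>2 = (cmod mean)\<^sup>2 * ((cmod (f (dil (- j) h)))\<^sup>2 * real p powi (- j))" if h: "h \<in> vil p" for h
  proof -
    have "(real p powr (real_of_int j / 2) * real p powi (- j))\<^sup>2 = real p powi j * (real p powi (- j))\<^sup>2"
      by (simp only: power_mult_distrib vshift_factor_sq)
    also have "\<dots> = real p powi (- j)"
      using p_pos by (simp add: power_int_minus power2_eq_square)
    finally show ?thesis unfolding c[OF h] by (simp add: norm_mult power_mult_distrib del: of_real_mult)
  qed
  have fj: "vstep M j f" "M \<le> j" using f j vstep_mono[OF f(1), of M j] by auto
  define Q where "Q = max R (nat (j - M))"
  have "energy f j = (\<Sum>h\<in>vbox (- int Q) 0. (cmod (coef f j h))\<^sup>2)"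
    by (rule energy_eq[OF f(1)]) (auto simp: Q_def)
  also have "\<dots> = (\<Sum>h\<in>vbox (M - j) 0. (cmod (coef f j h))\<^sup>2)"
  proof (rule sum.mono_neutral_right)
    show "vbox (M - j) 0 \<subseteq> vbox (- int Q) 0" by (rule vbox_mono) (auto simp: Q_def)
    show "\<forall>h\<in>vbox (- int Q) 0 - vbox (M - j) 0. (cmod (coef f j h))\<^sup>2 = 0"
    proof
      fix h assume h: "h \<in> vbox (- int Q) 0 - vbox (M - j) 0"
      then obtain i where i: "h i \<noteq> 0" "i \<le> M - j" by (fastforce simp: vbox_def)
      then have "dil (- j) h \<notin> vU p M" by (auto simp: vU_def dil_def intro!: exI[of _ "i + j"])
      moreover have "dil (- j) h \<in> vil p" using h by (auto intro: dil_closed vbox_vil)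
      ultimately have "f (dil (- j) h) = 0" using f(1) by (simp add: vstep_def)
      then show "(cmod (coef f j h))\<^sup>2 = 0" using h c by (auto simp: vbox_vil)
    qed
  qed (rule finite_vbox)
  also have "\<dots> = (\<Sum>h\<in>vbox (M - j) 0. (cmod mean)\<^sup>2 * ((cmod (f (dil (- j) h)))\<^sup>2 * real p powi (- j)))"
    by (intro sum.cong refl c2 vbox_vil)
  also have "\<dots> = (cmod mean)\<^sup>2 * ((\<Sum>h\<in>vbox (M - j) 0. (cmod (f (dil (- j) h)))\<^sup>2) * real p powi (- j))"
    by (simp only: sum_distrib_left sum_distrib_right)
  also have "(\<Sum>h\<in>vbox (M - j) 0. (cmod (f (dil (- j) h)))\<^sup>2) = (\<Sum>e\<in>vbox M j. (cmod (f e))\<^sup>2)"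
  proof (rule sum.reindex_bij_witness[of _ "dil j" "dil (- j)"])
    fix h assume "h \<in> vbox (M - j) 0"
    from dil_vbox[OF this, of "- j"] show "dil (- j) h \<in> vbox M j" by simp
  next
    fix e assume "e \<in> vbox M j"
    from dil_vbox[OF this, of j] show "dil j e \<in> vbox (M - j) 0" by simp
  qed (auto simp: dil_dil dil_0)
  also have "(\<Sum>e\<in>vbox M j. (cmod (f e))\<^sup>2) * real p powi (- j) = (vnorm p f)\<^sup>2"
    by (rule vstep_vnorm[OF fj, symmetric])
  finally show ?thesis .
qed

text \<open>On the support of \<open>f\<close> the dilate \<open>dil j x\<close> vanishes up to
  index \<open>M - j\<close>, so \<open>vmove j h x\<close> stays in one coset of that level, the
  one of \<open>vneg p h\<close>. Only the part of \<phi> on this coset is seen; the rest is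
  Cauchy-Schwarz and the invariance of the norm.\<close>

lemma coef_bound:
  assumes f: "vstep M L f" and h: "h \<in> vil p"
  shows "cmod (coef f j h) \<le> vnorm p f * vnorm p (\<lambda>x. indicator (vcoset p (vneg p h) (M - j)) x * \<phi> x)"
proof -
  let ?u = "\<lambda>x. indicator (vcoset p (vneg p h) (M - j)) x * \<phi> x"
  have u: "?u \<in> vL2 p" using h by (intro indicator_mult_vL2 phi_L2 vcoset_sets vneg_closed)
  have "f x * cnj (vshift \<phi> j h x) = f x * cnj (vshift ?u j h x)" if x: "x \<in> vil p" for x
  proof (cases "x \<in> vU p M")
    case True
    have "vmove j h x i = vneg p h i" if "i \<le> M - j" for i
    proof -
      have "dil j x i = 0" using True that by (simp add: vU_def dil_def)
      then show ?thesis using p_pos by (simp add: vmove_def vsub_def vadd_def vneg_def)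
    qed
    then have "vmove j h x \<in> vcoset p (vneg p h) (M - j)"
      using x h by (simp add: vcoset_def vmove_closed)
    then show ?thesis by (simp add: vshift_def)
  next
    case False
    then show ?thesis using f x by (simp add: vstep_def)
  qed
  then have "coef f j h = vinner p f (vshift ?u j h)"
    unfolding coef_def vinner_def by (intro Bochner_Integration.integral_cong) (auto simp: space_haar)
  also have "cmod \<dots> \<le> vnorm p f * vnorm p (vshift ?u j h)"
    using vstep_vL2[OF f] vshift_vL2[OF u h] by (rule cauchy_schwarz)
  finally show ?thesis using vnorm_vshift[OF u h] by simp
qed

lemma energy_nonneg: "energy f j \<ge> 0"
  unfolding energy_def by (intro sum_nonneg) simp

text \<open>At the levels \<open>M - int i\<close> the window of translations no longer grows:
  \<open>vbox (- int R) 0\<close> serves for all of them. There remain finitely many terms, each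
  bounded by the norm of \<phi> on a coset shrinking to a point.\<close>

lemma energy_low:
  assumes f: "vstep M L f"
  shows "(\<lambda>i. energy f (M - int i)) \<longlonglongrightarrow> 0"
proof -
  let ?B = "\<lambda>i. \<Sum>h\<in>vbox (- int R) 0. (vnorm p f * vnorm p (\<lambda>x. indicator (vcoset p (vneg p h) (int i)) x * \<phi> x))\<^sup>2"
  have le: "energy f (M - int i) \<le> ?B i" for i
  proof -
    have "energy f (M - int i) = (\<Sum>h\<in>vbox (- int R) 0. (cmod (coef f (M - int i) h))\<^sup>2)"
      by (rule energy_eq[OF f]) auto
    also have "\<dots> \<le> ?B i"
    proof (rule sum_mono)
      fix h assume "h \<in> vbox (- int R) 0"
      then have "cmod (coef f (M - int i) h) \<le> vnorm p f * vnorm p (\<lambda>x. indicator (vcoset p (vneg p h) (int i)) x * \<phi> x)"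
        using coef_bound[OF f vbox_vil, of h "- int R" 0 "M - int i"] by simp
      then show "(cmod (coef f (M - int i) h))\<^sup>2 \<le> (vnorm p f * vnorm p (\<lambda>x. indicator (vcoset p (vneg p h) (int i)) x * \<phi> x))\<^sup>2"
        by (intro power_mono) auto
    qed
    finally show ?thesis .
  qed
  have "?B \<longlonglongrightarrow> (\<Sum>h\<in>vbox (- int R) 0. (vnorm p f * 0)\<^sup>2)"
    by (intro tendsto_intros vnorm_shrinking_cosets phi_L2 vneg_closed vbox_vil)
  then have lim: "?B \<longlonglongrightarrow> 0" by simp
  show ?thesis
  proof (rule tendsto_sandwich[where f = "\<lambda>_. 0" and h = ?B])
    show "\<forall>\<^sub>F i in sequentially. 0 \<le> energy f (M - int i)" by (rule always_eventually) (simp add: energy_nonneg)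
    show "\<forall>\<^sub>F i in sequentially. energy f (M - int i) \<le> ?B i" by (rule always_eventually) (rule allI, rule le)
  qed (rule tendsto_const lim)+
qed

end

section \<open>The unitary extension principle\<close>

locale wavelet_filters = scaling_function +
  fixes r :: nat and m :: "nat \<Rightarrow> (int \<Rightarrow> nat) \<Rightarrow> complex" and b :: "nat \<Rightarrow> (int \<Rightarrow> nat) \<Rightarrow> complex"
  assumes b_0: "b 0 = a"
    and mask_expansion: "\<And>\<nu> \<omega>. \<nu> \<le> r \<Longrightarrow> \<omega> \<in> vil p \<Longrightarrow>
      m \<nu> \<omega> = (\<Sum>\<alpha>\<in>vbox (- int n) 0. b \<nu> \<alpha> * cnj (vchi p \<alpha> \<omega>))"
    and orthonormal: "mask_orthonormal {..r} m"
begin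

text \<open>The time-domain form of the wavelet relation: the refinement formula with the
  coefficients of the mask \<open>m \<nu>\<close> in place of those of the refinement mask.\<close>

definition psi :: "nat \<Rightarrow> (int \<Rightarrow> nat) \<Rightarrow> complex" where
  "psi \<nu> x = of_nat p * (\<Sum>\<alpha>\<in>vbox (- int n) 0. b \<nu> \<alpha> * \<phi> (vmove 1 \<alpha> x))"

lemma psi_vL2: "psi \<nu> \<in> vL2 p"
  unfolding psi_def[abs_def]
  by (intro vL2_cmult vL2_sum vmove_comp_vL2 phi_L2 vbox_vil)

lemma psi_support:
  assumes "x \<in> vil p" "x \<notin> vU p (- int (max R n))"
  shows "psi \<nu> x = 0"
proof -
  have "\<phi> (vmove 1 \<alpha> x) = 0" if \<alpha>: "\<alpha> \<in> vbox (- int n) 0" for \<alpha>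
  proof (rule phi_support)
    have \<alpha>v: "\<alpha> \<in> vil p" using \<alpha> by (rule vbox_vil)
    show "vmove 1 \<alpha> x \<in> vil p" using \<alpha>v assms(1) by (rule vmove_closed)
    show "vmove 1 \<alpha> x \<notin> vU p (- int R)"
    proof
      assume "vmove 1 \<alpha> x \<in> vU p (- int R)"
      then have "x \<in> vcoset p (dil (-1) \<alpha>) (- int R + 1)"
        using vmove_in_vcoset_iff[OF assms(1) \<alpha>v vzero_in_vil[OF p_pos], of 1 "- int R"] \<alpha>v
        by (simp add: vU_eq_vcoset vadd_vzero_left)
      then have "x j = 0" if "j \<le> - int (max R n)" for j
        using that vbox_eq_0[OF \<alpha>, of "j - 1"] by (simp add: vcoset_def dil_def)
      then show False using assms by (simp add: vU_def)
    qed
  qed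
  then show ?thesis by (simp add: psi_def)
qed

lemma psi_compactly_supported:
  assumes "compactly_supported p \<phi>"
  shows "compactly_supported p (psi \<nu>)"
proof -
  let ?B = "vbox (- int n) 0"
  obtain K where K: "compactin (vtop p) K" "AE x in haar p. x \<notin> K \<longrightarrow> \<phi> x = 0"
    using assms by (auto simp: compactly_supported_def)
  define K' where "K' = \<Union> ((\<lambda>\<alpha>. (\<lambda>y. dil (-1) (vadd p y \<alpha>)) ` K) ` ?B)"
  have "compactin (vtop p) K'" unfolding K'_def
  proof (rule compactin_Union)
    fix S assume "S \<in> (\<lambda>\<alpha>. (\<lambda>y. dil (-1) (vadd p y \<alpha>)) ` K) ` ?B"
    then obtain \<alpha> where "\<alpha> \<in> ?B" "S = (\<lambda>y. dil (-1) (vadd p y \<alpha>)) ` K" by blast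
    then show "compactin (vtop p) S"
      using image_compactin[OF K(1) continuous_map_expand[OF vbox_vil]] by blast
  qed (simp add: finite_vbox)
  moreover have "AE x in haar p. \<forall>\<alpha>\<in>?B. vmove 1 \<alpha> x \<notin> K \<longrightarrow> \<phi> (vmove 1 \<alpha> x) = 0"
    using AE_vmove[OF vbox_vil K(2)] by (intro AE_finite_allI finite_vbox)
  then have "AE x in haar p. x \<notin> K' \<longrightarrow> psi \<nu> x = 0"
    using AE_space
  proof eventually_elim
    case (elim x)
    then have x: "x \<in> vil p" by (simp add: space_haar)
    show ?case
    proof
      assume xK: "x \<notin> K'"
      have "\<phi> (vmove 1 \<alpha> x) = 0" if \<alpha>: "\<alpha> \<in> ?B" for \<alpha>
      proof -
        have "vmove 1 \<alpha> x \<notin> K"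
        proof
          assume "vmove 1 \<alpha> x \<in> K"
          then have "x \<in> (\<lambda>y. dil (-1) (vadd p y \<alpha>)) ` K"
            using expand_vmove[OF vbox_vil[OF \<alpha>] x] by (metis imageI)
          with xK \<alpha> show False by (auto simp: K'_def)
        qed
        then show ?thesis using elim(1) \<alpha> by blast
      qed
      then show "psi \<nu> x = 0" by (simp add: psi_def)
    qed
  qed
  ultimately show ?thesis unfolding compactly_supported_def by blast
qed

text \<open>Writing \<open>x\<close> as the dilate by -1 of \<open>vmove 1 \<alpha> x\<close> plus
  \<alpha>, the character at \<open>x\<close> splits into one factor for each summand, both at the
  frequency \<open>dil (-1) \<omega>\<close>. The factors in \<alpha> assemble the mask.\<close>

lemma psi_fourier:
  assumes \<nu>: "\<nu> \<le> r" and w: "\<omega> \<in> vil p"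
  shows "fourier_integral p (psi \<nu>) \<omega> = m \<nu> (dil (-1) \<omega>) * fourier_integral p \<phi> (dil (-1) \<omega>)"
proof -
  let ?B = "vbox (- int n) 0" and ?w = "dil (-1) \<omega>"
  have w': "?w \<in> vil p" using w by (rule dil_closed)
  define g where "g \<alpha> y = cnj (vchi p \<alpha> ?w) * (\<phi> y * cnj (vchi p y ?w))" for \<alpha> y
  have cm: "(\<lambda>x. cnj (vchi p x \<omega>)) \<in> borel_measurable (haar p)" if "\<omega> \<in> vil p" for \<omega>
    using vchi_measurable[OF that] by measurable
  have L2: "(\<lambda>y. \<phi> y * cnj (vchi p y ?w)) \<in> vL2 p"
    using vL2_mult_bounded[OF phi_L2 cm[OF w']] by (simp add: norm_vchi mult.commute)
  have gi: "integrable (haar p) (g \<alpha>)" for \<alpha>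
    unfolding g_def[abs_def]
    by (intro integrable_mult_right integrable_supported[OF L2, of "- int R"]) (simp add: phi_support)
  have "fourier_integral p (psi \<nu>) \<omega> = (\<integral>x. psi \<nu> x * cnj (vchi p x \<omega>) \<partial>haar p)"
    by (simp add: fourier_integral_def)
  also have "\<dots> = (\<Sum>\<alpha>\<in>?B. b \<nu> \<alpha> * (\<integral>y. g \<alpha> y \<partial>haar p))"
  proof (rule integral_refined)
    show "g \<alpha> \<in> borel_measurable (haar p)" for \<alpha> using gi by (rule borel_measurable_integrable)
    show "integrable (haar p) (g \<alpha>)" for \<alpha> by (rule gi)
    show "(\<lambda>x. psi \<nu> x * cnj (vchi p x \<omega>)) \<in> borel_measurable (haar p)"
      using vL2_measurable[OF psi_vL2] cm[OF w] by (rule borel_measurable_times)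
    show "AE x in haar p. psi \<nu> x * cnj (vchi p x \<omega>) = of_nat p * (\<Sum>\<alpha>\<in>?B. b \<nu> \<alpha> * g \<alpha> (vmove 1 \<alpha> x))"
    proof (intro AE_I2)
      fix x assume "x \<in> space (haar p)"
      then have x: "x \<in> vil p" by (simp add: space_haar)
      have "g \<alpha> (vmove 1 \<alpha> x) = \<phi> (vmove 1 \<alpha> x) * cnj (vchi p x \<omega>)" if "\<alpha> \<in> ?B" for \<alpha>
      proof -
        have \<alpha>: "\<alpha> \<in> vil p" using that by (rule vbox_vil)
        have "vchi p x \<omega> = vchi p (dil (-1) (vadd p (vmove 1 \<alpha> x) \<alpha>)) \<omega>"
          by (simp only: expand_vmove[OF \<alpha> x])
        also have "\<dots> = vchi p (vmove 1 \<alpha> x) ?w * vchi p \<alpha> ?w"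
          unfolding vchi_dil using \<alpha> x w' by (intro vchi_vadd_left vmove_closed)
        finally show ?thesis by (simp add: g_def)
      qed
      then have "(\<Sum>\<alpha>\<in>?B. b \<nu> \<alpha> * g \<alpha> (vmove 1 \<alpha> x)) = (\<Sum>\<alpha>\<in>?B. b \<nu> \<alpha> * \<phi> (vmove 1 \<alpha> x)) * cnj (vchi p x \<omega>)"
        unfolding sum_distrib_right by (intro sum.cong refl) simp
      then show "psi \<nu> x * cnj (vchi p x \<omega>) = of_nat p * (\<Sum>\<alpha>\<in>?B. b \<nu> \<alpha> * g \<alpha> (vmove 1 \<alpha> x))"
        by (simp add: psi_def)
    qed
  qed
  also have "\<dots> = (\<Sum>\<alpha>\<in>?B. b \<nu> \<alpha> * cnj (vchi p \<alpha> ?w)) * fourier_integral p \<phi> ?w"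
    unfolding sum_distrib_right by (intro sum.cong refl) (simp add: g_def fourier_integral_def)
  finally show ?thesis using mask_expansion[OF \<nu> w'] by simp
qed

lemma psi_wavelet_function:
  assumes "\<nu> \<le> r" and \<phi>': "\<phi>' \<in> vL2 p" "AE x in haar p. \<phi>' x = \<phi> x"
  shows "wavelet_function p \<phi>' (m \<nu>) (psi \<nu>)"
  unfolding wavelet_function_def
proof (intro exI conjI)
  show "has_fourier_transform p \<phi>' (fourier_integral p \<phi>)"
    using phi_L2 phi_support \<phi>' by (rule has_fourier_transform_compact)
  show "has_fourier_transform p (psi \<nu>) (fourier_integral p (psi \<nu>))"
    using psi_vL2 psi_support psi_vL2 by (rule has_fourier_transform_compact) simp_all
  show "AE \<omega> in haar p. fourier_integral p (psi \<nu>) \<omega> = m \<nu> (dil (-1) \<omega>) * fourier_integral p \<phi> (dil (-1) \<omega>)"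
    using psi_fourier[OF assms(1)] by (intro AE_I2) (simp add: space_haar)
qed

text \<open>The filter bank identity is applied to the coefficients \<open>c\<close> of level
  \<open>j + 1\<close>. Up to a square root of p, the outputs \<open>d 0\<close> are the scaling
  coefficients of level \<open>j\<close> and the outputs \<open>d \<nu>\<close> with
  \<open>\<nu> \<ge> 1\<close> the wavelet coefficients, so moving the term for 0 to the other side
  gives the increment.\<close>

lemma energy_increment:
  assumes f: "vstep M L f"
  shows "((\<lambda>(h, \<nu>). (cmod (vinner p f (vshift (psi \<nu>) j h)))\<^sup>2) has_sum (energy f (j + 1) - energy f j)) (vH p \<times> {1..r})"
proof -
  \<comment> \<open>One window large enough for the translations of the masks and for the
    coefficients at both levels.\<close>
  define Q where "Q = max n (max R (nat (j + 1 - M)))"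
  have Q: "n \<le> Q" "R \<le> Q" "int Q \<ge> j + 1 - M" "int Q \<ge> j - M" by (auto simp: Q_def)
  let ?K = "vbox (- int Q) 0"
  define c where "c = coef f (j + 1)"
  define d where "d \<nu> k = (\<Sum>\<alpha>\<in>vbox (- int n) 0. cnj (b \<nu> \<alpha>) * c (vadd p (dil 1 k) \<alpha>))" for \<nu> k
  have f2: "f \<in> vL2 p" using f by (rule vstep_vL2)
  have sqrt_p: "(cmod (of_real (sqrt (real p)) * z))\<^sup>2 = real p * (cmod z)\<^sup>2" for z
    by (simp add: norm_mult power_mult_distrib)
  have detail: "(cmod (vinner p f (vshift (psi \<nu>) j k)))\<^sup>2 = real p * (cmod (d \<nu> k))\<^sup>2" if "k \<in> vil p" for \<nu> k
    unfolding sqrt_p[symmetric] d_def c_def coef_def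
    by (subst vinner_vshift_refine[OF f2 phi_L2 psi_vL2 that AE_I2[OF psi_def]]) (rule refl)
  have coarse: "(cmod (coef f j k))\<^sup>2 = real p * (cmod (d 0 k))\<^sup>2" if "k \<in> vil p" for k
    unfolding sqrt_p[symmetric] d_def c_def coef_def b_0
    by (subst vinner_vshift_refine[OF f2 phi_L2 phi_L2 that refinement]) (rule refl)
  \<comment> \<open>A nonzero coordinate of \<open>k\<close> at \<open>i \<le> - int Q\<close>
    becomes coordinate \<open>i - 1\<close> of \<open>dil 1 k\<close>. No \<alpha> from the mask
    reaches that far to cancel it, and the coefficient there vanishes.\<close>
  have d_0: "d \<nu> k = 0" if k: "k \<in> vH p" "k \<notin> ?K" for \<nu> k
    unfolding d_def
  proof (intro sum.neutral ballI)
    fix \<alpha> assume \<alpha>: "\<alpha> \<in> vbox (- int n) 0"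
    obtain i where i: "k i \<noteq> 0" "\<not> (- int Q < i \<and> i \<le> 0)"
      using k vH_vil[OF k(1)] by (auto simp: vbox_def)
    have "i \<le> 0"
    proof (rule ccontr)
      assume "\<not> i \<le> 0"
      with k(1) have "k i = 0" by (simp add: vH_def)
      with i(1) show False by simp
    qed
    with i have iQ: "i \<le> - int Q" by simp
    have kv: "dil 1 k \<in> vil p" using k(1) by (intro dil_closed vH_vil)
    have "\<alpha> (i - 1) = 0" using vbox_eq_0[OF \<alpha>, of "i - 1"] iQ Q by simp
    then have "vadd p (dil 1 k) \<alpha> (i - 1) = k i"
      using vil_less[OF vH_vil[OF k(1)], of i] by (simp add: vadd_def dil_def)
    then have "c (vadd p (dil 1 k) \<alpha>) = 0"
      unfolding c_def using i(1) iQ Q kv \<alpha>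
      by (intro coef_eq_0[OF f, where i = "i - 1"]) (auto simp: vadd_closed vbox_vil)
    then show "cnj (b \<nu> \<alpha>) * c (vadd p (dil 1 k) \<alpha>) = 0" by simp
  qed
  have c_sq: "complex_of_real ((cmod z)\<^sup>2) = z * cnj z" for z by (rule complex_norm_square)
  \<comment> \<open>With \<open>Suc Q\<close> the window of \<open>k\<close> in the identity becomes
    exactly \<open>?K\<close>, since \<open>1 - int (Suc Q)\<close> is
    \<open>- int Q\<close>.\<close>
  have "of_nat p * (\<Sum>\<nu>\<in>{..r}. \<Sum>k\<in>vbox (1 - int (Suc Q)) 0. d \<nu> k * cnj (d \<nu> k)) = (\<Sum>\<gamma>\<in>vbox (- int (Suc Q)) 0. c \<gamma> * cnj (c \<gamma>))"
    by (rule filter_bank_identity[OF _ orthonormal mask_expansion _ _ d_def]) (use Q in auto)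
  then have "complex_of_real (real p * (\<Sum>\<nu>\<in>{..r}. \<Sum>k\<in>?K. (cmod (d \<nu> k))\<^sup>2)) = complex_of_real (\<Sum>\<gamma>\<in>vbox (- int (Suc Q)) 0. (cmod (c \<gamma>))\<^sup>2)"
    by (simp only: of_real_mult of_real_sum c_sq of_real_of_nat_eq) simp
  then have "real p * (\<Sum>\<nu>\<in>{..r}. \<Sum>k\<in>?K. (cmod (d \<nu> k))\<^sup>2) = (\<Sum>\<gamma>\<in>vbox (- int (Suc Q)) 0. (cmod (c \<gamma>))\<^sup>2)"
    by (simp only: of_real_eq_iff)
  also have "\<dots> = energy f (j + 1)"
    unfolding c_def using Q by (intro energy_eq[OF f, symmetric]) auto
  finally have total: "real p * (\<Sum>\<nu>\<in>{..r}. \<Sum>k\<in>?K. (cmod (d \<nu> k))\<^sup>2) = energy f (j + 1)" .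
  have low: "energy f j = real p * (\<Sum>k\<in>?K. (cmod (d 0 k))\<^sup>2)"
    unfolding energy_eq[OF f Q(2,4)] sum_distrib_left by (intro sum.cong refl coarse vbox_vil)
  have "{..r} = insert 0 {1..r}" by auto
  then have split: "(\<Sum>\<nu>\<in>{..r}. \<Sum>k\<in>?K. (cmod (d \<nu> k))\<^sup>2) = (\<Sum>k\<in>?K. (cmod (d 0 k))\<^sup>2) + (\<Sum>\<nu>\<in>{1..r}. \<Sum>k\<in>?K. (cmod (d \<nu> k))\<^sup>2)"
    by simp
  have "energy f (j + 1) - energy f j = real p * (\<Sum>\<nu>\<in>{1..r}. \<Sum>k\<in>?K. (cmod (d \<nu> k))\<^sup>2)"
    unfolding total[symmetric] low split by (simp only: distrib_left add_diff_cancel_left')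
  also have "\<dots> = real p * (\<Sum>k\<in>?K. \<Sum>\<nu>\<in>{1..r}. (cmod (d \<nu> k))\<^sup>2)" by (subst sum.swap) (rule refl)
  also have "\<dots> = (\<Sum>k\<in>?K. \<Sum>\<nu>\<in>{1..r}. (cmod (vinner p f (vshift (psi \<nu>) j k)))\<^sup>2)"
    unfolding sum_distrib_left by (intro sum.cong refl detail[symmetric] vbox_vil)
  also have "\<dots> = (\<Sum>(k, \<nu>)\<in>?K \<times> {1..r}. (cmod (vinner p f (vshift (psi \<nu>) j k)))\<^sup>2)"
    by (rule sum.cartesian_product)
  finally have eq: "energy f (j + 1) - energy f j = (\<Sum>(k, \<nu>)\<in>?K \<times> {1..r}. (cmod (vinner p f (vshift (psi \<nu>) j k)))\<^sup>2)" .
  have "((\<lambda>(h, \<nu>). (cmod (vinner p f (vshift (psi \<nu>) j h)))\<^sup>2) has_sum (energy f (j + 1) - energy f j)) (?K \<times> {1..r})"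
    unfolding eq by (intro has_sum_finite finite_cartesian_product finite_vbox) simp
  then show ?thesis
  proof (rule iffD1[OF has_sum_cong_neutral, rotated -1])
    fix x assume "x \<in> vH p \<times> {1..r} - ?K \<times> {1..r}"
    then obtain k \<nu> where "x = (k, \<nu>)" "k \<in> vH p" "k \<notin> ?K" by auto
    then show "(case x of (h, \<nu>) \<Rightarrow> (cmod (vinner p f (vshift (psi \<nu>) j h)))\<^sup>2) = 0"
      by (simp add: detail vH_vil d_0)
  qed (use vbox_subset_vH in auto)
qed

lemma energy_mono: "vstep M L f \<Longrightarrow> energy f j \<le> energy f (j + 1)"
  using has_sum_nonneg[OF energy_increment, of M L f j] by (simp add: case_prod_beta)

text \<open>The increments vanish from level \<open>J\<close> on. Counted downward from
  \<open>J\<close> they form a telescoping series, and being nonnegative they have an unordered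
  sum.\<close>

lemma energy_telescope:
  assumes f: "vstep M L f"
  shows "((\<lambda>j. energy f (j + 1) - energy f j) has_sum ((cmod mean)\<^sup>2 * (vnorm p f)\<^sup>2)) UNIV"
proof -
  define L' where "L' = max M L"
  define V where "V = (cmod mean)\<^sup>2 * (vnorm p f)\<^sup>2"
  have f': "vstep M L' f" "M \<le> L'" using vstep_mono[OF f, of M L'] by (auto simp: L'_def)
  define J where "J = L' + int R"
  have high: "energy f j = V" if "j \<ge> J" for j
    using energy_high[OF f'] that by (simp add: J_def V_def)
  define u where "u i = energy f (J - int i) - energy f (J - int (Suc i))" for i
  have partial: "(\<Sum>i<k. u i) = V - energy f (J - int k)" for k
  proof (induction k)
    case 0
    then show ?case using high[of J] by simp
  next
    case (Suc k)
    then show ?case by (simp add: u_def)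
  qed
  have "(\<lambda>i. energy f (M - int i)) \<longlonglongrightarrow> 0" using f by (rule energy_low)
  moreover have "J \<ge> M" using f' by (simp add: J_def)
  then have "M - int i = J - int (i + nat (J - M))" for i by simp
  ultimately have "(\<lambda>i. energy f (J - int (i + nat (J - M)))) \<longlonglongrightarrow> 0" by (simp only:)
  then have "(\<lambda>k. energy f (J - int k)) \<longlonglongrightarrow> 0" by (rule LIMSEQ_offset)
  then have "(\<lambda>k. V - energy f (J - int k)) \<longlonglongrightarrow> V - 0" by (intro tendsto_intros)
  then have "u sums V" unfolding sums_def partial by simp
  moreover have "u i \<ge> 0" for i
    using energy_mono[OF f, of "J - int (Suc i)"] by (simp add: u_def)
  ultimately have u: "(u has_sum V) UNIV" by (rule sums_nonneg_imp_has_sum)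
  have inj: "inj (\<lambda>i. J - int (Suc i))" by (auto simp: inj_on_def)
  have "u = (\<lambda>j. energy f (j + 1) - energy f j) \<circ> (\<lambda>i. J - int (Suc i))"
  proof
    fix i
    have "J - int i = J - int (Suc i) + 1" by simp
    then show "u i = ((\<lambda>j. energy f (j + 1) - energy f j) \<circ> (\<lambda>i. J - int (Suc i))) i"
      by (simp only: u_def comp_def)
  qed
  with u have "((\<lambda>j. energy f (j + 1) - energy f j) has_sum V) (range (\<lambda>i. J - int (Suc i)))"
    by (simp only: has_sum_reindex[OF inj])
  moreover have "range (\<lambda>i. J - int (Suc i)) = {..<J}"
  proof (intro equalityI subsetI)
    fix j assume "j \<in> {..<J}"
    then have "j = J - int (Suc (nat (J - 1 - j)))" by simp
    then show "j \<in> range (\<lambda>i. J - int (Suc i))" by (rule range_eqI)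
  qed auto
  ultimately have "((\<lambda>j. energy f (j + 1) - energy f j) has_sum V) {..<J}" by simp
  then show ?thesis unfolding V_def[symmetric]
    by (rule iffD1[OF has_sum_cong_neutral, rotated -1]) (auto simp: high)
qed

text \<open>For a step function the sum over translations and masks at one level is the increment of
  the energy; as all terms are nonnegative, summability of the increments yields that of the joint
  family.\<close>

lemma frame_identity:
  assumes f: "f \<in> vL2 p"
  shows "((\<lambda>(j, h, \<nu>). (cmod (vinner p f (vshift (psi \<nu>) j h)))\<^sup>2) has_sum ((cmod mean)\<^sup>2 * (vnorm p f)\<^sup>2)) (UNIV \<times> vH p \<times> {1..r})"
proof -
  define g where "g = (\<lambda>(j, h, \<nu>). vshift (psi \<nu>) j h)"
  have "((\<lambda>i. (cmod (vinner p f (g i)))\<^sup>2) has_sum ((cmod mean)\<^sup>2 * (vnorm p f)\<^sup>2)) (UNIV \<times> vH p \<times> {1..r})"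
  proof (rule tight_frame_from_steps[OF _ _ _ f])
    fix i :: "int \<times> (int \<Rightarrow> nat) \<times> nat" assume "i \<in> UNIV \<times> vH p \<times> {1..r}"
    then show "g i \<in> vL2 p" by (auto simp: g_def intro: vshift_vL2 psi_vL2 vH_vil)
  next
    fix M L s assume s: "vstep M L s"
    have inner: "((\<lambda>y. (cmod (vinner p s (g (j, y))))\<^sup>2) has_sum (energy s (j + 1) - energy s j)) (vH p \<times> {1..r})" for j
    proof -
      have "(\<lambda>y. (cmod (vinner p s (g (j, y))))\<^sup>2) = (\<lambda>(h, \<nu>). (cmod (vinner p s (vshift (psi \<nu>) j h)))\<^sup>2)"
        by (simp add: g_def fun_eq_iff)
      then show ?thesis using energy_increment[OF s, of j] by (simp only:)
    qed
    show "((\<lambda>i. (cmod (vinner p s (g i)))\<^sup>2) has_sum ((cmod mean)\<^sup>2 * (vnorm p s)\<^sup>2)) (UNIV \<times> vH p \<times> {1..r})"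
    proof (rule has_sum_SigmaI[OF inner energy_telescope[OF s]])
      show "(\<lambda>i. (cmod (vinner p s (g i)))\<^sup>2) summable_on UNIV \<times> vH p \<times> {1..r}"
        by (rule summable_on_SigmaI[OF inner])
          (use energy_telescope[OF s] in \<open>auto simp: summable_on_def\<close>)
    qed
  qed simp
  moreover have "(\<lambda>i. (cmod (vinner p f (g i)))\<^sup>2) = (\<lambda>(j, h, \<nu>). (cmod (vinner p f (vshift (psi \<nu>) j h)))\<^sup>2)"
    by (simp add: g_def fun_eq_iff)
  ultimately show ?thesis by (simp only:)
qed

lemma psi_tight_frame: "tight_wavelet_frame p r psi"
  unfolding tight_wavelet_frame_def
proof (intro exI[of _ "(cmod mean)\<^sup>2"] conjI ballI)
  show "(cmod mean)\<^sup>2 > 0" using mean_neq_0 by simp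
  fix f assume f: "f \<in> vL2 p"
  let ?t = "\<lambda>(j :: int, k :: nat, \<nu> :: nat). (j, vh p k, \<nu>)"
  have inj: "inj_on ?t (UNIV \<times> UNIV \<times> {1..r})"
    using bij_betw_vh by (auto simp: inj_on_def bij_betw_def)
  have img: "?t ` (UNIV \<times> UNIV \<times> {1..r}) = UNIV \<times> vH p \<times> {1..r}"
  proof (intro equalityI subsetI)
    fix y assume "y \<in> (UNIV :: int set) \<times> vH p \<times> {1..r}"
    then obtain j h \<nu> where y: "y = (j, h, \<nu>)" "h \<in> vH p" "\<nu> \<in> {1..r}" by auto
    then obtain k where "h = vh p k" using bij_betw_vh by (auto simp: bij_betw_def)
    then have "y = ?t (j, k, \<nu>)" using y by simp
    then show "y \<in> ?t ` (UNIV \<times> UNIV \<times> {1..r})" using y(3) by blast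
  qed (use vh_in_vH in auto)
  have "((\<lambda>(j, h, \<nu>). (cmod (vinner p f (vshift (psi \<nu>) j h)))\<^sup>2) \<circ> ?t has_sum ((cmod mean)\<^sup>2 * (vnorm p f)\<^sup>2)) (UNIV \<times> UNIV \<times> {1..r})"
    using frame_identity[OF f] has_sum_reindex[OF inj] unfolding img by blast
  moreover have ws: "wavelet_shift p (psi \<nu>) j k = vshift (psi \<nu>) j (vh p k)" for \<nu> j k
    by (intro ext) (simp add: wavelet_shift_def vshift_def vmove_def)
  have "(\<lambda>(j, h, \<nu>). (cmod (vinner p f (vshift (psi \<nu>) j h)))\<^sup>2) \<circ> ?t
      = (\<lambda>(j, k, \<nu>). (cmod (vinner p f (wavelet_shift p (psi \<nu>) j k)))\<^sup>2)"
    by (intro ext) (auto simp: ws)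
  ultimately show "((\<lambda>(j, k, \<nu>). (cmod (vinner p f (wavelet_shift p (psi \<nu>) j k)))\<^sup>2) has_sum ((cmod mean)\<^sup>2 * (vnorm p f)\<^sup>2)) (UNIV \<times> UNIV \<times> {1..r})"
    by (simp only:)
qed

end

section \<open>Completing the mask matrix\<close>

lemma mask_matrix_unitary_iff:
  "mask_matrix p r m \<omega> * mat_adjoint (mask_matrix p r m \<omega>) = 1\<^sub>m p \<longleftrightarrow>
    (\<forall>s<p. \<forall>t<p. (\<Sum>\<nu>\<le>r. m \<nu> (vadd p \<omega> (vdelta p s)) * cnj (m \<nu> (vadd p \<omega> (vdelta p t)))) = (if s = t then 1 else 0))"
proof -
  let ?M = "mask_matrix p r m \<omega>"
  have adj: "mat_adjoint ?M $$ (\<nu>, t) = cnj (m \<nu> (vadd p \<omega> (vdelta p t)))" if "\<nu> \<le> r" "t < p" for \<nu> t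
    using that by (simp add: mask_matrix_def mat_adjoint_def mat_of_rows_index)
  have entry: "(?M * mat_adjoint ?M) $$ (s, t) = (\<Sum>\<nu>\<le>r. m \<nu> (vadd p \<omega> (vdelta p s)) * cnj (m \<nu> (vadd p \<omega> (vdelta p t))))"
    if "s < p" "t < p" for s t
  proof -
    have dim: "dim_row ?M = p" "dim_col ?M = Suc r" "dim_row (mat_adjoint ?M) = Suc r" "dim_col (mat_adjoint ?M) = p"
      by (simp_all add: mask_matrix_def mat_adjoint_def)
    have "(?M * mat_adjoint ?M) $$ (s, t) = (\<Sum>\<nu>\<in>{0..<Suc r}. ?M $$ (s, \<nu>) * mat_adjoint ?M $$ (\<nu>, t))"
      using that dim by (simp add: scalar_prod_def)
    also have "\<dots> = (\<Sum>\<nu>\<le>r. m \<nu> (vadd p \<omega> (vdelta p s)) * cnj (m \<nu> (vadd p \<omega> (vdelta p t))))"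
      unfolding atLeast0LessThan lessThan_Suc_atMost
    proof (rule sum.cong[OF refl])
      fix \<nu> assume "\<nu> \<in> {..r}"
      then have \<nu>: "\<nu> \<le> r" by simp
      then have "?M $$ (s, \<nu>) = m \<nu> (vadd p \<omega> (vdelta p s))" using that by (simp add: mask_matrix_def)
      then show "?M $$ (s, \<nu>) * mat_adjoint ?M $$ (\<nu>, t) = m \<nu> (vadd p \<omega> (vdelta p s)) * cnj (m \<nu> (vadd p \<omega> (vdelta p t)))"
        by (simp only: adj[OF \<nu> that(2)])
    qed
    finally show ?thesis .
  qed
  have "?M * mat_adjoint ?M = 1\<^sub>m p \<longleftrightarrow> (\<forall>s<p. \<forall>t<p. (?M * mat_adjoint ?M) $$ (s, t) = (if s = t then 1 else 0))"
    by (subst mat_eq_iff) (auto simp: mask_matrix_def mat_adjoint_def)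
  then show ?thesis using entry by simp
qed

text \<open>With \<open>v\<close> the first column and \<open>u = v\<^sup>* x\<close> one has \<open>\<bar>u\<bar>\<^sup>2 = \<bar>v\<bar>\<^sup>2\<close> by orthonormality of the rows,
  while the first entry of \<open>u\<close> is \<open>\<bar>v\<bar>\<^sup>2\<close>.\<close>

lemma orthonormal_rows_column_norm:
  fixes x :: "nat \<Rightarrow> nat \<Rightarrow> complex"
  assumes orth: "\<And>s t. s < p \<Longrightarrow> t < p \<Longrightarrow> (\<Sum>\<nu>\<le>r. x s \<nu> * cnj (x t \<nu>)) = (if s = t then 1 else 0)"
  shows "(\<Sum>s<p. (cmod (x s 0))\<^sup>2) \<le> 1"
proof -
  define T where "T = (\<Sum>s<p. (cmod (x s 0))\<^sup>2)"
  define u where "u \<nu> = (\<Sum>s<p. cnj (x s 0) * x s \<nu>)" for \<nu>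
  have T: "complex_of_real T = (\<Sum>s<p. x s 0 * cnj (x s 0))"
    unfolding T_def of_real_sum by (simp only: complex_norm_square)
  have "complex_of_real (\<Sum>\<nu>\<le>r. (cmod (u \<nu>))\<^sup>2) = (\<Sum>\<nu>\<le>r. u \<nu> * cnj (u \<nu>))"
    by (simp only: of_real_sum complex_norm_square)
  also have "\<dots> = (\<Sum>\<nu>\<le>r. \<Sum>s<p. \<Sum>t<p. (cnj (x s 0) * x s \<nu>) * (x t 0 * cnj (x t \<nu>)))"
    by (simp add: u_def sum_product)
  also have "\<dots> = (\<Sum>s<p. \<Sum>\<nu>\<le>r. \<Sum>t<p. (cnj (x s 0) * x s \<nu>) * (x t 0 * cnj (x t \<nu>)))"
    by (rule sum.swap)
  also have "\<dots> = (\<Sum>s<p. \<Sum>t<p. \<Sum>\<nu>\<le>r. (cnj (x s 0) * x s \<nu>) * (x t 0 * cnj (x t \<nu>)))"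
    by (rule sum.cong[OF refl], rule sum.swap)
  also have "\<dots> = (\<Sum>s<p. \<Sum>t<p. if s = t then x s 0 * cnj (x s 0) else 0)"
  proof (intro sum.cong refl)
    fix s t assume st: "s \<in> {..<p}" "t \<in> {..<p}"
    have "(\<Sum>\<nu>\<le>r. (cnj (x s 0) * x s \<nu>) * (x t 0 * cnj (x t \<nu>))) = cnj (x s 0) * x t 0 * (\<Sum>\<nu>\<le>r. x s \<nu> * cnj (x t \<nu>))"
      unfolding sum_distrib_left by (intro sum.cong refl) (simp add: mult_ac)
    also have "\<dots> = (if s = t then x s 0 * cnj (x s 0) else 0)" using st by (simp add: orth mult.commute)
    finally show "(\<Sum>\<nu>\<le>r. (cnj (x s 0) * x s \<nu>) * (x t 0 * cnj (x t \<nu>))) = (if s = t then x s 0 * cnj (x s 0) else 0)" .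
  qed
  also have "\<dots> = complex_of_real T" by (simp add: T)
  finally have "(\<Sum>\<nu>\<le>r. (cmod (u \<nu>))\<^sup>2) = T" by (simp only: of_real_eq_iff)
  moreover have "(cmod (u 0))\<^sup>2 \<le> (\<Sum>\<nu>\<le>r. (cmod (u \<nu>))\<^sup>2)" by (rule member_le_sum) auto
  moreover have "u 0 = complex_of_real T" unfolding T u_def by (simp add: mult.commute)
  ultimately have "T\<^sup>2 \<le> T" by simp
  moreover have "T \<ge> 0" unfolding T_def by (intro sum_nonneg) simp
  ultimately have "T \<le> 1"
    by (cases "T = 0") (auto simp: power2_eq_square)
  then show ?thesis by (simp add: T_def)
qed

context vilenkin begin

lemma fun_upd_vil:
  assumes "\<omega> \<in> vil p" "l < p"
  shows "fun_upd \<omega> 1 l \<in> vil p"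
proof -
  have "{j. j < 0 \<and> (fun_upd \<omega> 1 l) j \<noteq> 0} \<subseteq> {j. j < 0 \<and> \<omega> j \<noteq> 0}" by auto
  then have "finite {j. j < 0 \<and> (fun_upd \<omega> 1 l) j \<noteq> 0}" 
    using assms by (intro finite_subset[OF \<open>_ \<subseteq> _\<close>]) (simp add: vil_def)
  then show ?thesis using assms unfolding vil_def by auto
qed

text \<open>Once coordinate 1 is reset to 0, adding \<open>vdelta p l\<close> sets it to
  \<open>l\<close>. The sum in the theorem, taken at the reset point, is therefore
  \<open>fiber_sq\<close>.\<close>

lemma vadd_vdelta:
  assumes "\<omega> \<in> vil p" "l < p"
  shows "vadd p (fun_upd \<omega> 1 0) (vdelta p l) = (fun_upd \<omega> 1 l)"
  using assms p_ge_2 vil_less[OF assms(1)] by (auto simp: vdelta_eq vadd_def fun_eq_iff)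

lemma vadd_vdelta_off: "s < p \<Longrightarrow> \<omega> \<in> vil p \<Longrightarrow> i \<noteq> 1 \<Longrightarrow> vadd p \<omega> (vdelta p s) i = \<omega> i"
  using p_ge_2 vil_less[of \<omega> i] by (simp add: vdelta_eq vadd_def)

lemma vdelta_vil: "s < p \<Longrightarrow> vdelta p s \<in> vil p"
  unfolding vdelta_def by (intro dil_closed vh_vil)

lemma vadd_vdelta_inj:
  assumes "s < p" "t < p" "\<omega> \<in> vil p" "vadd p \<omega> (vdelta p s) = vadd p \<omega> (vdelta p t)"
  shows "s = t"
proof -
  have "vdelta p s = vadd p (vneg p \<omega>) (vadd p \<omega> (vdelta p s))"
    by (rule vadd_vneg_cancel(2)[OF assms(3) vdelta_vil[OF assms(1)], symmetric])
  also have "\<dots> = vdelta p t"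
    unfolding assms(4) by (rule vadd_vneg_cancel(2)[OF assms(3) vdelta_vil[OF assms(2)]])
  finally have "vdelta p s 1 = vdelta p t 1" by (rule fun_cong)
  then show ?thesis using assms(1,2) p_ge_2 by (simp add: vdelta_eq)
qed

lemma wavelet_masks_mask_orthonormal:
  assumes "p - 1 \<le> r" "\<And>\<nu>. \<nu> \<in> {1..r} \<Longrightarrow> walsh_polynomial p (m \<nu>)" "mask_orthonormal {..r} m"
  shows "wavelet_masks p r m"
  unfolding wavelet_masks_def
proof (intro conjI ballI)
  fix \<omega> assume w: "\<omega> \<in> vil p"
  show "mask_matrix p r m \<omega> * mat_adjoint (mask_matrix p r m \<omega>) = 1\<^sub>m p"
    unfolding mask_matrix_unitary_iff
  proof (intro allI impI)
    fix s t assume st: "s < p" "t < p"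
    have "(\<Sum>\<nu>\<in>{..r}. m \<nu> (vadd p \<omega> (vdelta p s)) * cnj (m \<nu> (vadd p \<omega> (vdelta p t))))
        = (if vadd p \<omega> (vdelta p s) = vadd p \<omega> (vdelta p t) then 1 else 0)"
      using st w by (intro mask_orthonormalD[OF assms(3)]) (auto simp: vadd_closed vdelta_vil vadd_vdelta_off)
    then show "(\<Sum>\<nu>\<le>r. m \<nu> (vadd p \<omega> (vdelta p s)) * cnj (m \<nu> (vadd p \<omega> (vdelta p t)))) = (if s = t then 1 else 0)"
      using vadd_vdelta_inj[OF st w] by auto
  qed
qed (use assms in auto)

text \<open>On each coset of \<open>{\<delta>\<^sub>0, \<dots>, \<delta>\<^sub>p\<^sub>-\<^sub>1}\<close> the column \<open>v\<close> of values of \<open>m\<^sub>0\<close> is completed by the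
  matrix \<open>(I - v v\<^sup>*)\<^sup>1\<^sup>/\<^sup>2 = I - c v v\<^sup>*\<close>, where \<open>c = 1 / (1 + (1 - \<bar>v\<bar>\<^sup>2)\<^sup>1\<^sup>/\<^sup>2)\<close>.\<close>

definition fiber_sq :: "((int \<Rightarrow> nat) \<Rightarrow> complex) \<Rightarrow> (int \<Rightarrow> nat) \<Rightarrow> real" where
  "fiber_sq m0 \<omega> = (\<Sum>l<p. (cmod (m0 (fun_upd \<omega> 1 l)))\<^sup>2)"

definition completion_coeff :: "((int \<Rightarrow> nat) \<Rightarrow> complex) \<Rightarrow> (int \<Rightarrow> nat) \<Rightarrow> real" where
  "completion_coeff m0 \<omega> = 1 / (1 + sqrt (1 - fiber_sq m0 \<omega>))"

text \<open>Mask \<open>Suc k\<close> is column \<open>k\<close> of I - c v v*, and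
  \<open>\<omega> 1\<close> is the row; thus \<open>m0 \<omega>\<close> is the entry of v in that
  row. The number c depends on the fibre alone.\<close>

fun completed_mask :: "((int \<Rightarrow> nat) \<Rightarrow> complex) \<Rightarrow> nat \<Rightarrow> (int \<Rightarrow> nat) \<Rightarrow> complex" where
  "completed_mask m0 0 = m0"
| "completed_mask m0 (Suc k) = (\<lambda>\<omega>. (if \<omega> 1 = k then 1 else 0) -
    of_real (completion_coeff m0 \<omega>) * m0 \<omega> * cnj (m0 (fun_upd \<omega> 1 k)))"

lemma completion_coeff_eq:
  assumes "fiber_sq m0 \<omega> \<le> 1"
  shows "1 - 2 * completion_coeff m0 \<omega> + (completion_coeff m0 \<omega>)\<^sup>2 * fiber_sq m0 \<omega> = 0"
proof -
  define q where "q = sqrt (1 - fiber_sq m0 \<omega>)"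
  have q: "q \<ge> 0" "fiber_sq m0 \<omega> = 1 - q\<^sup>2" using assms by (simp_all add: q_def)
  define c where "c = completion_coeff m0 \<omega>"
  have "c = 1 / (1 + q)" "1 + q \<noteq> 0" using q(1) by (simp_all add: c_def completion_coeff_def q_def[symmetric])
  then have c: "c * (1 + q) = 1" by simp
  have "c\<^sup>2 * (1 - q\<^sup>2) = (c * (1 + q)) * (c * (1 - q))" by (simp add: power2_eq_square algebra_simps)
  also have "\<dots> = c * (1 - q)" by (simp only: c mult_1)
  also have "\<dots> = 2 * c - c * (1 + q)" by (simp add: algebra_simps)
  finally have "c\<^sup>2 * (1 - q\<^sup>2) = 2 * c - 1" by (simp only: c)
  then show ?thesis by (simp only: q(2) c_def[symmetric])
qed

lemma completed_mask_orthonormal: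
  assumes bound: "\<And>\<omega>. \<omega> \<in> vil p \<Longrightarrow> fiber_sq m0 \<omega> \<le> 1"
  shows "mask_orthonormal {..p} (completed_mask m0)"
  unfolding mask_orthonormal_def
proof (intro ballI impI)
  fix \<omega> \<omega>' assume w: "\<omega> \<in> vil p" "\<omega>' \<in> vil p" and eq: "\<forall>i. i \<noteq> 1 \<longrightarrow> \<omega> i = \<omega>' i"
  have upd: "(fun_upd \<omega>' 1 k) = (fun_upd \<omega> 1 k)" for k using eq by (auto simp: fun_eq_iff)
  define v where "v k = m0 (fun_upd \<omega> 1 k)" for k
  define c where "c = completion_coeff m0 \<omega>"
  define t where "t = fiber_sq m0 \<omega>"
  have c': "completion_coeff m0 \<omega>' = c" by (simp add: c_def completion_coeff_def fiber_sq_def upd)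
  have v: "m0 \<omega> = v (\<omega> 1)" "m0 \<omega>' = v (\<omega>' 1)" using upd[of "\<omega>' 1"] by (simp_all add: v_def)
  have s: "\<omega> 1 < p" "\<omega>' 1 < p" using w by (simp_all add: vil_less)
  have ct: "1 - 2 * complex_of_real c + (complex_of_real c)\<^sup>2 * complex_of_real t = 0"
    using arg_cong[OF completion_coeff_eq[OF bound[OF w(1)]], of complex_of_real] by (simp add: c_def t_def)
  have t: "complex_of_real t = (\<Sum>k<p. v k * cnj (v k))"
    unfolding t_def fiber_sq_def v_def of_real_sum by (simp only: complex_norm_square)
  let ?x = "v (\<omega> 1)" and ?y = "cnj (v (\<omega>' 1))" and ?c = "complex_of_real c"
  have "(\<Sum>\<nu>\<le>p. completed_mask m0 \<nu> \<omega> * cnj (completed_mask m0 \<nu> \<omega>'))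
      = ?x * ?y + (\<Sum>k<p. ((if \<omega> 1 = k then 1 else 0) - ?c * ?x * cnj (v k)) * ((if \<omega>' 1 = k then 1 else 0) - ?c * ?y * v k))"
    unfolding sum.atMost_shift
    by (simp add: v upd c' c_def[symmetric] v_def[symmetric])
      (intro sum.cong refl, auto)
  also have "(\<Sum>k<p. ((if \<omega> 1 = k then 1 else 0) - ?c * ?x * cnj (v k)) * ((if \<omega>' 1 = k then 1 else 0) - ?c * ?y * v k))
      = (\<Sum>k<p. (if \<omega> 1 = k then (if \<omega>' 1 = k then 1 else 0) else 0) - (if \<omega> 1 = k then ?c * ?y * v k else 0)
          - (if \<omega>' 1 = k then ?c * ?x * cnj (v k) else 0) + ?c\<^sup>2 * ?x * ?y * (v k * cnj (v k)))"
    by (intro sum.cong refl) (auto simp: algebra_simps power2_eq_square)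
  also have "\<dots> = (if \<omega>' 1 = \<omega> 1 then 1 else 0) - ?c * ?y * ?x - ?c * ?x * ?y + ?c\<^sup>2 * ?x * ?y * of_real t"
    using s by (simp add: sum.distrib sum_subtractf t sum_distrib_left)
  also have "?x * ?y + \<dots> = (if \<omega>' 1 = \<omega> 1 then 1 else 0) + ?x * ?y * (1 - 2 * ?c + ?c\<^sup>2 * of_real t)"
    by (simp add: algebra_simps)
  also have "\<dots> = (if \<omega> = \<omega>' then 1 else 0)"
  proof -
    have "\<omega> = \<omega>'" if "\<omega>' 1 = \<omega> 1"
    proof
      fix i show "\<omega> i = \<omega>' i" using eq that by (cases "i = 1") auto
    qed
    then show ?thesis unfolding ct by auto
  qed
  finally show "(\<Sum>\<nu>\<in>{..p}. completed_mask m0 \<nu> \<omega> * cnj (completed_mask m0 \<nu> \<omega>')) = (if \<omega> = \<omega>' then 1 else 0)" .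
qed

text \<open>Coordinate 1, which the Kronecker term reads, is among the first \<open>n\<close>
  because \<open>n \<ge> 1\<close>; everything else inherits locality from \<open>m0\<close>. The
  square root in \<open>completion_coeff\<close> does no harm, since locality suffices for being a
  Walsh polynomial.\<close>

lemma completed_mask_local:
  assumes m0: "local_on n m0" and n: "n \<ge> 1" and \<nu>: "\<nu> \<le> p"
  shows "local_on n (completed_mask m0 \<nu>)"
proof (cases \<nu>)
  case 0
  with m0 show ?thesis by simp
next
  case (Suc k)
  show ?thesis unfolding local_on_def
  proof (intro ballI impI)
    fix \<omega> \<omega>' assume w: "\<omega> \<in> vil p" "\<omega>' \<in> vil p" and eq: "\<forall>i. 0 < i \<and> i \<le> int n \<longrightarrow> \<omega> i = \<omega>' i"
    have 1: "m0 (fun_upd \<omega> 1 l) = m0 (fun_upd \<omega>' 1 l)" if "l < p" for l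
      using eq by (intro local_onD[OF m0]) (auto simp: fun_upd_vil w that)
    have 2: "m0 \<omega> = m0 \<omega>'" using eq w by (intro local_onD[OF m0]) auto
    have 3: "\<omega> 1 = \<omega>' 1" using eq n by simp
    have 4: "completion_coeff m0 \<omega> = completion_coeff m0 \<omega>'"
      using 1 by (simp add: completion_coeff_def fiber_sq_def)
    have "k < p" using \<nu> Suc by simp
    then show "completed_mask m0 \<nu> \<omega> = completed_mask m0 \<nu> \<omega>'"
      by (simp only: Suc completed_mask.simps 1 2 3 4)
  qed
qed

end

theorem theorem10:
  fixes p :: nat and \<phi> m0 :: "(int \<Rightarrow> nat) \<Rightarrow> complex"
  assumes "p \<ge> 2"
    and "\<phi> \<in> vL2 p"
    and "\<not> (AE x in haar p. \<phi> x = 0)"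
    and "compactly_supported p \<phi>"
    and "refinable_with_mask p \<phi> m0"
  shows "generates_compact_tight_frames p \<phi> m0 \<longleftrightarrow>
           walsh_polynomial p m0 \<and> m0 vzero = 1 \<and>
           (\<forall>\<omega>\<in>vil p. (\<Sum>l<p. (cmod (m0 (vadd p \<omega> (vdelta p l))))\<^sup>2) \<le> 1)"
proof -
  interpret vilenkin p by standard (rule assms(1))
  obtain n a where n: "n \<ge> 1"
    and ref: "AE x in haar p. \<phi> x = of_nat p * (\<Sum>k<p ^ n. a k * \<phi> (vsub p (dil 1 x) (vh p k)))"
    and m0: "\<And>\<omega>. \<omega> \<in> vil p \<Longrightarrow> m0 \<omega> = (\<Sum>k<p ^ n. a k * cnj (walsh p k \<omega>))"
    using assms(5) unfolding refinable_with_mask_def by blast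
  let ?B = "vbox (- int n) 0"
  \<comment> \<open>The coefficients, numbered by \<open>k < p ^ n\<close>, are transported to the
    window \<open>?B\<close> along \<open>vh\<close>.\<close>
  define a' where "a' \<alpha> = a (inv_into UNIV (vh p) \<alpha>)" for \<alpha>
  have a': "a' (vh p k) = a k" for k
    unfolding a'_def using bij_betw_vh by (simp add: bij_betw_def inv_into_f_f)
  have reindex: "(\<Sum>k<p ^ n. a k * F (vh p k)) = (\<Sum>\<alpha>\<in>?B. a' \<alpha> * F \<alpha>)" for F :: "_ \<Rightarrow> complex"
    using sum.reindex_bij_betw[OF bij_betw_vh_vbox, of "\<lambda>\<alpha>. a' \<alpha> * F \<alpha>" n] by (simp add: a')
  have m0': "m0 \<omega> = (\<Sum>\<alpha>\<in>?B. a' \<alpha> * cnj (vchi p \<alpha> \<omega>))" if "\<omega> \<in> vil p" for \<omega>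
    using m0[OF that] reindex[of "\<lambda>\<alpha>. cnj (vchi p \<alpha> \<omega>)"] by (simp add: walsh_def vchi_comm)
  have ref': "AE x in haar p. \<phi> x = of_nat p * (\<Sum>\<alpha>\<in>?B. a' \<alpha> * \<phi> (vmove 1 \<alpha> x))"
    using ref
  proof eventually_elim
    case (elim x)
    then show ?case using reindex[of "\<lambda>\<alpha>. \<phi> (vmove 1 \<alpha> x)"] by (simp add: vmove_def)
  qed
  obtain K where K: "compactin (vtop p) K" "AE x in haar p. x \<notin> K \<longrightarrow> \<phi> x = 0"
    using assms(4) by (auto simp: compactly_supported_def)
  obtain R where R: "K \<subseteq> vU p (- int R)" using compactin_subset_vU[OF K(1)] by blast
  \<comment> \<open>A representative of \<phi> whose support is bounded at every point. It inherits
    the refinement equation because \<open>vmove\<close> pulls null sets back to null sets.\<close>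
  define \<phi>' where "\<phi>' x = indicator (vU p (- int R)) x * \<phi> x" for x
  have \<phi>'_L2: "\<phi>' \<in> vL2 p"
    unfolding \<phi>'_def[abs_def] using assms(2) vU_sets by (rule indicator_mult_vL2)
  have eq: "AE x in haar p. \<phi> x = \<phi>' x"
    using K(2) by eventually_elim (use R in \<open>auto simp: \<phi>'_def indicator_def\<close>)
  have "AE x in haar p. \<forall>\<alpha>\<in>?B. \<phi> (vmove 1 \<alpha> x) = \<phi>' (vmove 1 \<alpha> x)"
    using AE_vmove[OF vbox_vil eq] by (intro AE_finite_allI finite_vbox)
  then have ref'': "AE x in haar p. \<phi>' x = of_nat p * (\<Sum>\<alpha>\<in>?B. a' \<alpha> * \<phi>' (vmove 1 \<alpha> x))"
    using ref' eq
  proof eventually_elim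
    case (elim x)
    have "\<phi>' x = \<phi> x" using elim(3) by (rule sym)
    also have "\<dots> = of_nat p * (\<Sum>\<alpha>\<in>?B. a' \<alpha> * \<phi> (vmove 1 \<alpha> x))" by (rule elim(2))
    also have "(\<Sum>\<alpha>\<in>?B. a' \<alpha> * \<phi> (vmove 1 \<alpha> x)) = (\<Sum>\<alpha>\<in>?B. a' \<alpha> * \<phi>' (vmove 1 \<alpha> x))"
      using elim(1) by (intro sum.cong refl) (simp only:)
    finally show ?case .
  qed
  interpret scaling_function p \<phi>' R n a'
  proof
    show "\<phi>' x = 0" if "x \<in> vil p" "x \<notin> vU p (- int R)" for x using that by (simp add: \<phi>'_def)
    show "\<not> (AE x in haar p. \<phi>' x = 0)"
    proof
      assume "AE x in haar p. \<phi>' x = 0"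
      with eq have "AE x in haar p. \<phi> x = 0" by eventually_elim simp
      with assms(3) show False ..
    qed
  qed (rule \<phi>'_L2 ref'')+
  have local: "local_on n m0" by (rule local_on_character_sum[OF m0'])
  have walsh: "walsh_polynomial p m0" by (rule local_on_walsh_polynomial[OF local])
  have "vzero \<in> vil p" by (rule vzero_in_vil[OF p_pos])
  then have one: "m0 vzero = 1"
    using m0'[of vzero] sum_a by (simp add: vchi_comm[of _ vzero] vchi_vzero_left)
  show ?thesis
  proof
    assume "generates_compact_tight_frames p \<phi> m0"
    then obtain r m where m: "m 0 = m0" "wavelet_masks p r m"
      unfolding generates_compact_tight_frames_def by blast
    have "(\<Sum>l<p. (cmod (m0 (vadd p \<omega> (vdelta p l))))\<^sup>2) \<le> 1" if "\<omega> \<in> vil p" for \<omega>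
      using orthonormal_rows_column_norm[where p = p and r = r and x = "\<lambda>s \<nu>. m \<nu> (vadd p \<omega> (vdelta p s))"] m that
      unfolding wavelet_masks_def mask_matrix_unitary_iff by simp
    then show "walsh_polynomial p m0 \<and> m0 vzero = 1 \<and>
        (\<forall>\<omega>\<in>vil p. (\<Sum>l<p. (cmod (m0 (vadd p \<omega> (vdelta p l))))\<^sup>2) \<le> 1)"
      using walsh one by blast
  next
    assume "walsh_polynomial p m0 \<and> m0 vzero = 1 \<and>
        (\<forall>\<omega>\<in>vil p. (\<Sum>l<p. (cmod (m0 (vadd p \<omega> (vdelta p l))))\<^sup>2) \<le> 1)"
    then have bound: "(\<Sum>l<p. (cmod (m0 (vadd p \<omega> (vdelta p l))))\<^sup>2) \<le> 1" if "\<omega> \<in> vil p" for \<omega>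
      using that by blast
    define m where "m = completed_mask m0"
    have "fiber_sq m0 \<omega> \<le> 1" if "\<omega> \<in> vil p" for \<omega>
      using bound[OF fun_upd_vil[OF that p_pos]] vadd_vdelta[OF that] by (simp add: fiber_sq_def)
    then have orth: "mask_orthonormal {..p} m" unfolding m_def by (rule completed_mask_orthonormal)
    have loc: "local_on n (m \<nu>)" if "\<nu> \<le> p" for \<nu>
      unfolding m_def using local n that by (rule completed_mask_local)
    have "\<exists>b. \<forall>\<omega>\<in>vil p. m \<nu> \<omega> = (\<Sum>\<alpha>\<in>?B. b \<alpha> * cnj (vchi p \<alpha> \<omega>))" if "\<nu> \<le> p" for \<nu>
      using local_on_expansion[OF loc[OF that]] by metis
    then obtain b where b: "\<And>\<nu> \<omega>. \<nu> \<le> p \<Longrightarrow> \<omega> \<in> vil p \<Longrightarrow> m \<nu> \<omega> = (\<Sum>\<alpha>\<in>?B. b \<nu> \<alpha> * cnj (vchi p \<alpha> \<omega>))"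
      by metis
    \<comment> \<open>The chosen expansion of \<open>m 0\<close> is replaced by \<open>a'\<close>,
      which also expands \<open>m0\<close>, so that index 0 carries the refinement coefficients
      themselves.\<close>
    interpret wavelet_filters p \<phi>' R n a' p m "fun_upd b 0 a'"
    proof
      show "m \<nu> \<omega> = (\<Sum>\<alpha>\<in>?B. (fun_upd b 0 a') \<nu> \<alpha> * cnj (vchi p \<alpha> \<omega>))" if "\<nu> \<le> p" "\<omega> \<in> vil p" for \<nu> \<omega>
        using b[OF that] m0'[OF that(2)] by (cases \<nu>) (simp_all add: m_def)
    qed (simp_all add: orth)
    have supp: "compactly_supported p \<phi>'"
      unfolding compactly_supported_def
      by (intro exI[of _ K] conjI K(1)) (use K(2) in \<open>eventually_elim, simp add: \<phi>'_def\<close>)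
    have "wavelet_masks p p m"
      using loc by (intro wavelet_masks_mask_orthonormal orth local_on_walsh_polynomial) auto
    moreover have "wavelet_function p \<phi> (m \<nu>) (psi \<nu>)" if "\<nu> \<in> {1..p}" for \<nu>
      using that assms(2) eq by (intro psi_wavelet_function) auto
    ultimately show "generates_compact_tight_frames p \<phi> m0"
      unfolding generates_compact_tight_frames_def
      using psi_tight_frame psi_compactly_supported[OF supp]
      by (intro exI[of _ p] exI[of _ m] exI[of _ psi]) (simp add: m_def)
  qed
qed

end
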